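(* Let $\mathbb{F}=\mathbb{R}$ or $\mathbb{C}$. Let $P(\lambda)=\sum_{i=0}^dP_i\lambda^i\in\mathbb{F}[\lambda]^{m\times n}$ be nonzero and let $\mathcal{L}(\lambda)$ be either a $(0,n,\eta,m)$-block Kronecker pencil $$\mathcal{L}(\lambda)=\begin{bmatrix}\lambda M_1+M_0 & L_\eta(\lambda)^T\otimes I_m\end{bmatrix}$$ with $d=\eta+1$ such that $P(\lambda)=(\Lambda_\eta(\lambda)^T\otimes I_m)(\lambda M_1+M_0)$ (in which case set $\varepsilon=0$), or an $(\varepsilon,n,0,m)$-block Kronecker pencil $$\mathcal{L}(\lambda)=\begin{bmatrix}\lambda M_1+M_0\\ L_\varepsilon(\lambda)\otimes I_n\end{bmatrix}$$ with $d=\varepsilon+1$ such that $P(\lambda)=(\lambda M_1+M_0)(\Lambda_\varepsilon(\lambda)\otimes I_n)$ (in which case set $\eta=0$). If $\Delta\mathcal{L}(\lambda)$ is any pencil with the same size as $\mathcal{L}(\lambda)$ and such that $$\|\Delta\mathcal{L}(\lambda)\|_F<\frac{1}{2\,d^{3/2}},$$ then $\mathcal{L}(\lambda)+\Delta\mathcal{L}(\lambda)$ is a strong linearization of a matrix polynomial $P(\lambda)+\Delta P(\lambda)$ with grade $d$ and such that $$\frac{\|\Delta P(\lambda)\|_F}{\|P(\lambda)\|_F}\le2\,d\,\frac{\|\mathcal{L}(\lambda)\|_F}{\|P(\lambda)\|_F}\,\bigl(1+\|\lambda M_1+M_0\|_F\bigr)\,\frac{\|\Delta\mathcal{L}(\lambda)\|_F}{\|\mathcal{L}(\lambda)\|_F}.$$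 In addition, the right minimal indices of $\mathcal{L}(\lambda)+\Delta\mathcal{L}(\lambda)$ are those of $P(\lambda)+\Delta P(\lambda)$ shifted by $\varepsilon$, and the left minimal indices of $\mathcal{L}(\lambda)+\Delta\mathcal{L}(\lambda)$ are those of $P(\lambda)+\Delta P(\lambda)$ shifted by $\eta$.
   Context: $L_k(\lambda)\in\mathbb{F}[\lambda]^{k\times(k+1)}$ is the pencil with $-1$ in positions $(i,i)$, $\lambda$ in positions $(i,i+1)$, $i=1,\dots,k$, and zeros elsewhere; $\Lambda_k(\lambda)^T=[\lambda^k\ \cdots\ \lambda\ 1]$. $\otimes$ is the Kronecker product. In the displayed pencils $\lambda M_1+M_0$ is an arbitrary pencil of size $(\eta+1)m\times n$ in the first case and $m\times(\varepsilon+1)n$ in the second. For a matrix polynomial $R(\lambda)=\sum_iR_i\lambda^i$, $\|R(\lambda)\|_F:=\sqrt{\sum_i\|R_i\|_F^2}$, with $\|R_i\|_F$ the Frobenius norm of the constant matrix $R_i$. A matrix polynomial $P(\lambda)$ has grade $d$ if it is written $\sum_{i=0}^dP_i\lambda^i$ (possibly $P_d=0$). $\mathrm{rev}_dP(\lambda):=\lambda^dP(\lambda^{-1})$. A pencil (grade $1$ matrix polynomial) $\mathcal{L}(\lambda)$ is a linearization of $P(\lambda)$ of grade $d$ if for some $s\ge0$ there are unimodular matrix polynomials (nonzero constant determinant) $U(\lambda),V(\lambda)$ with $U(\lambda)\mathcal{L}(\lambda)V(\lambda)=\mathrm{diag}(I_s,P(\lambda))$; it is a strong linearization if moreover $\mathrm{rev}_1\mathcal{L}(\lambda)$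 is a linearization of $\mathrm{rev}_dP(\lambda)$. Right (resp. left) minimal indices of an $m\times n$ matrix polynomial $P$: the ordered list of degrees of the vectors in any polynomial basis, of least total degree among polynomial bases, of $\{x\in\mathbb{F}(\lambda)^{n\times1}:Px=0\}$ (resp. $\{y^T\in\mathbb{F}(\lambda)^{1\times m}:y^TP=0\}$). "The right (left) minimal indices of $A$ are those of $B$ shifted by $k$" means: if $\alpha_1\le\cdots\le\alpha_p$ are the right (left) minimal indices of $B$, then $\alpha_1+k\le\cdots\le\alpha_p+k$ are the right (left) minimal indices of $A$. *)

theory Defs
  imports
    Complex_Main
    "HOL-Computational_Algebra.Polynomial_Factorial"
    "Jordan_Normal_Form.Matrix_Kernel"
begin

text \<open>Matrix polynomials are matrices with polynomial entries; sizes may be zero. The norm of a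
  \<^class>\<open>real_normed_field\<close> is multiplicative, so by Ostrowski's theorem its instances are,
  up to isometric isomorphism, exactly the real and the complex numbers.\<close>

definition has_grade :: "nat \<Rightarrow> 'a::zero poly mat \<Rightarrow> bool" where
  "has_grade d P \<longleftrightarrow> (\<forall>i < dim_row P. \<forall>j < dim_col P. degree (P $$ (i, j)) \<le> d)"

definition coeff_mat :: "'a::zero poly mat \<Rightarrow> nat \<Rightarrow> 'a mat" where
  "coeff_mat P k = map_mat (\<lambda>p. coeff p k) P"

definition pencil :: "'a::comm_monoid_add mat \<Rightarrow> 'a mat \<Rightarrow> 'a poly mat" where
  "pencil M1 M0 = map_mat (\<lambda>a. monom a 1) M1 + map_mat (\<lambda>a. monom a 0) M0"

definition frobenius_norm :: "'a::real_normed_vector mat \<Rightarrow> real" where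
  "frobenius_norm A = sqrt (\<Sum>i < dim_row A. \<Sum>j < dim_col A. (norm (A $$ (i, j)))\<^sup>2)"

text \<open>The series below has only finitely many nonzero terms.\<close>

definition poly_frobenius_norm :: "'a::real_normed_vector poly mat \<Rightarrow> real" where
  "poly_frobenius_norm R = sqrt (\<Sum>k. (frobenius_norm (coeff_mat R k))\<^sup>2)"

definition kronecker :: "'a::times mat \<Rightarrow> 'a mat \<Rightarrow> 'a mat" where
  "kronecker A B = mat (dim_row A * dim_row B) (dim_col A * dim_col B)
     (\<lambda>(i, j). A $$ (i div dim_row B, j div dim_col B) * B $$ (i mod dim_row B, j mod dim_col B))"

definition append_cols :: "'a::zero mat \<Rightarrow> 'a mat \<Rightarrow> 'a mat" where
  "append_cols A B = four_block_mat A B (0\<^sub>m 0 (dim_col A)) (0\<^sub>m 0 (dim_col B))"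

definition L_pencil :: "nat \<Rightarrow> 'a::comm_ring_1 poly mat" where
  "L_pencil k = mat k (k + 1)
     (\<lambda>(i, j). if j = i then -1 else if j = i + 1 then monom 1 1 else 0)"

definition Lambda_col :: "nat \<Rightarrow> 'a::comm_ring_1 poly mat" where
  "Lambda_col k = mat (k + 1) 1 (\<lambda>(i, j). monom 1 (k - i))"

definition block_kronecker_row :: "nat \<Rightarrow> nat \<Rightarrow> 'a::comm_ring_1 mat \<Rightarrow> 'a mat \<Rightarrow> 'a poly mat" where
  "block_kronecker_row m \<eta> M1 M0 =
     append_cols (pencil M1 M0) (kronecker (transpose_mat (L_pencil \<eta>)) (1\<^sub>m m))"

definition block_kronecker_col :: "nat \<Rightarrow> nat \<Rightarrow> 'a::comm_ring_1 mat \<Rightarrow> 'a mat \<Rightarrow> 'a poly mat" where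
  "block_kronecker_col n \<epsilon> M1 M0 =
     append_rows (pencil M1 M0) (kronecker (L_pencil \<epsilon>) (1\<^sub>m n))"

text \<open>On a polynomial of grade \<open>d\<close> this is \<open>\<lambda>\<^sup>d p(\<lambda>\<inverse>)\<close>; unlike \<^const>\<open>reflect_poly\<close>
  it depends on the grade and not on the degree.\<close>

definition rev_poly :: "nat \<Rightarrow> 'a::comm_monoid_add poly \<Rightarrow> 'a poly" where
  "rev_poly d p = (\<Sum>i\<le>d. monom (coeff p i) (d - i))"

definition rev_mat :: "nat \<Rightarrow> 'a::comm_monoid_add poly mat \<Rightarrow> 'a poly mat" where
  "rev_mat d P = map_mat (rev_poly d) P"

definition unimodular :: "nat \<Rightarrow> 'a::field poly mat \<Rightarrow> bool" where
  "unimodular k U \<longleftrightarrow> U \<in> carrier_mat k k \<and> (\<exists>c. c \<noteq> 0 \<and> det U = [:c:])"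

definition is_linearization :: "'a::field poly mat \<Rightarrow> 'a poly mat \<Rightarrow> bool" where
  "is_linearization L P \<longleftrightarrow> has_grade 1 L \<and>
     (\<exists>s U V. L \<in> carrier_mat (s + dim_row P) (s + dim_col P) \<and>
        unimodular (s + dim_row P) U \<and> unimodular (s + dim_col P) V \<and>
        U * L * V = diag_block_mat [1\<^sub>m s, P])"

definition is_strong_linearization :: "nat \<Rightarrow> 'a::field poly mat \<Rightarrow> 'a poly mat \<Rightarrow> bool" where
  "is_strong_linearization d L P \<longleftrightarrow> has_grade d P \<and>
     is_linearization L P \<and> is_linearization (rev_mat 1 L) (rev_mat d P)"

text \<open>Null spaces over the field of rational functions; a row vector \<open>y\<^sup>T\<close> is represented by
  the vector \<open>y\<close>.\<close>

definition right_nullspace :: "'a::field poly mat \<Rightarrow> 'a poly fract vec set" where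
  "right_nullspace P =
     {x \<in> carrier_vec (dim_col P). map_mat to_fract P *\<^sub>v x = 0\<^sub>v (dim_row P)}"

definition left_nullspace :: "'a::field poly mat \<Rightarrow> 'a poly fract vec set" where
  "left_nullspace P =
     {y \<in> carrier_vec (dim_row P). mat_of_row y * map_mat to_fract P = 0\<^sub>m 1 (dim_col P)}"

definition poly_basis :: "nat \<Rightarrow> 'a::field poly fract vec set \<Rightarrow> 'a poly vec list \<Rightarrow> bool" where
  "poly_basis N W bs \<longleftrightarrow> set bs \<subseteq> carrier_vec N \<and> distinct bs \<and>
     vectorspace.basis class_ring ((module_vec TYPE('a poly fract) N)\<lparr>carrier := W\<rparr>)
       (map_vec to_fract ` set bs)"

definition vec_degree :: "'a::zero poly vec \<Rightarrow> nat" where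
  "vec_degree v = Max (insert 0 ((\<lambda>i. degree (v $ i)) ` {..<dim_vec v}))"

definition minimal_poly_basis ::
    "nat \<Rightarrow> 'a::field poly fract vec set \<Rightarrow> 'a poly vec list \<Rightarrow> bool" where
  "minimal_poly_basis N W bs \<longleftrightarrow> poly_basis N W bs \<and>
     (\<forall>cs. poly_basis N W cs \<longrightarrow>
        sum_list (map vec_degree bs) \<le> sum_list (map vec_degree cs))"

text \<open>Existence of a minimal polynomial basis suffices here, since all of them have the same
  ordered list of degrees.\<close>

definition are_right_minimal_indices :: "'a::field poly mat \<Rightarrow> nat list \<Rightarrow> bool" where
  "are_right_minimal_indices P \<alpha> \<longleftrightarrow>
     (\<exists>bs. minimal_poly_basis (dim_col P) (right_nullspace P) bs \<and>
        \<alpha> = sort (map vec_degree bs))"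

definition are_left_minimal_indices :: "'a::field poly mat \<Rightarrow> nat list \<Rightarrow> bool" where
  "are_left_minimal_indices P \<alpha> \<longleftrightarrow>
     (\<exists>bs. minimal_poly_basis (dim_row P) (left_nullspace P) bs \<and>
        \<alpha> = sort (map vec_degree bs))"

end

theory Submission
  imports Defs "HOL-Analysis.L2_Norm"
begin

text \<open>The second form of the pencil is the transpose of the first, so consider
  \<open>\<L> = [M K]\<close> with \<open>K = L\<^sub>\<eta>(\<lambda>)\<^sup>T \<otimes> I\<close>, and let \<open>\<Delta>\<L> = [\<Delta>M \<Delta>K]\<close>. A generic pencil has an open
  orbit under strict equivalence, and quantitatively: there are constant invertible matrices
  \<open>A = I + X\<close> and \<open>Z\<close> with \<open>A (K + \<Delta>K) = K Z\<close>. Existence of \<open>Z\<close> amounts to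
  \<open>(\<Lambda>\<^sub>\<eta>\<^sup>T \<otimes> I) A (K + \<Delta>K) = 0\<close>. Comparing coefficients, this prescribes the differences
  of blocks of \<open>X\<close> that are neighbours on a diagonal; summing along diagonals has norm at most
  \<open>sqrt (d (d - 1) / 2)\<close>, which turns the equation for \<open>X\<close> into a linear fixed point problem with
  contraction factor at most \<open>1/4\<close> and gives \<open>\<parallel>X\<parallel> \<le> (4/3) d \<parallel>\<Delta>K\<parallel>\<close>.

  Then \<open>P + \<Delta>P = (\<Lambda>\<^sub>\<eta>\<^sup>T \<otimes> I) A (M + \<Delta>M)\<close>. Multiplication by \<open>\<Lambda>\<^sub>\<eta>\<^sup>T \<otimes> I\<close> increases norms of
  pencils by at most \<open>sqrt 2\<close>, whence the bound. The explicit unimodular completion of \<open>K\<close>,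
  conjugated by \<open>A\<close> and \<open>Z\<close>, yields the strong linearization and explicit isomorphisms between
  the null spaces of \<open>P + \<Delta>P\<close> and \<open>\<L> + \<Delta>\<L>\<close> that shift degrees by \<open>0\<close> and \<open>\<eta>\<close>.\<close>

section \<open>Transfer of minimal indices between null spaces\<close>

text \<open>A dual basis of the perturbed block chosen without care might have the wrong degrees or
  a singular leading coefficient. Strict equivalence by constants excludes this: multiplication by
  the invertible A changes neither the grade of the dual basis nor the rank of its leading
  coefficient. Moreover, reversing a pencil just swaps its two coefficients, so the same A and Z
  also serve the reversed pencil. On the constants: let \<kappa> be sqrt (\<eta> (\<eta> + 1)) times
  the norm of \<Delta>K. The solution satisfies X = \<Theta> 1 + \<Theta> X with a linear \<Theta>
  of norm at most \<kappa>, and \<Theta> 1 also has norm at most \<kappa>. So the norm of X is at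
  most \<kappa> / (1 - \<kappa>) \<le> (4/3) \<kappa> \<le> 1/3, which makes A invertible too. As
  \<Delta>P is the dual basis times \<Delta>M + X (M + \<Delta>M), and this pencil has norm at most
  (4/3) d (1 + \<mu>) \<delta>, with \<mu> and \<delta> the norms of M and \<Delta>\<L>, rounding
  sqrt 2 up to 3/2 produces the factor 2 d.\<close>

interpretation to_fract_hom: inj_idom_hom "to_fract :: 'a :: idom \<Rightarrow> 'a fract"
  by (unfold_locales, auto)

lemma right_nullspace_eq_mat_kernel: "right_nullspace P = mat_kernel (map_mat to_fract P)"
  by (auto simp: right_nullspace_def mat_kernel_def)

text \<open>Lets every statement on left null spaces be derived from the one on right null spaces of
  the transpose.\<close>

lemma left_nullspace_eq: "left_nullspace P = right_nullspace (transpose_mat P)"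
proof -
  have "mat_of_row y * map_mat to_fract P = 0\<^sub>m 1 (dim_col P) \<longleftrightarrow>
      map_mat to_fract (transpose_mat P) *\<^sub>v y = 0\<^sub>v (dim_col P)"
    if y: "y \<in> carrier_vec (dim_row P)" for y :: "'a poly fract vec"
  proof -
    have "(mat_of_row y * map_mat to_fract P) $$ (0, j) =
        (map_mat to_fract (transpose_mat P) *\<^sub>v y) $ j" if j: "j < dim_col P" for j
      using y j by (auto simp: scalar_prod_def mult.commute intro!: sum.cong)
    then show ?thesis
      by (auto simp: mat_eq_iff vec_eq_iff)
  qed
  then show ?thesis
    by (auto simp: left_nullspace_def right_nullspace_def)
qed

text \<open>\<open>\<Psi>\<close> inverts \<open>\<Phi>\<close> only up to a multiple of
  \<open>A\<close>, which vanishes on the kernel. Kernel membership and invertibility are certified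
  by matrix identities with cofactors \<open>C1\<close> and \<open>C4\<close>; such identities
  between polynomial matrices persist over the rational functions.\<close>

lemma kernel_map:
  fixes A B \<Phi> \<Psi> :: "'a::field mat"
  assumes A: "A \<in> carrier_mat r n" and B: "B \<in> carrier_mat r' n'"
    and \<Phi>: "\<Phi> \<in> carrier_mat n' n" and \<Psi>: "\<Psi> \<in> carrier_mat n n'"
    and C: "C1 \<in> carrier_mat r' r" "C4 \<in> carrier_mat n r"
    and eq: "B * \<Phi> = C1 * A" "\<Psi> * \<Phi> + C4 * A = 1\<^sub>m n"
    and x: "x \<in> mat_kernel A"
  shows "\<Phi> *\<^sub>v x \<in> mat_kernel B" "\<Psi> *\<^sub>v (\<Phi> *\<^sub>v x) = x"
proof -
  have xc: "x \<in> carrier_vec n" and Ax: "A *\<^sub>v x = 0\<^sub>v r"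
    using mat_kernelD[OF A x] by auto
  have "B *\<^sub>v (\<Phi> *\<^sub>v x) = (B * \<Phi>) *\<^sub>v x"
    using B \<Phi> xc by simp
  also have "\<dots> = C1 *\<^sub>v (A *\<^sub>v x)"
    using A C xc eq by simp
  also have "\<dots> = 0\<^sub>v r'"
    using C Ax by auto
  finally show "\<Phi> *\<^sub>v x \<in> mat_kernel B"
    using B \<Phi> xc by (intro mat_kernelI) auto
  have "x = (\<Psi> * \<Phi> + C4 * A) *\<^sub>v x"
    using eq xc by simp
  also have "\<dots> = \<Psi> *\<^sub>v (\<Phi> *\<^sub>v x) + C4 *\<^sub>v (A *\<^sub>v x)"
    using A \<Phi> \<Psi> C xc by (simp add: add_mult_distrib_mat_vec[of _ n n])
  also have "\<dots> = \<Psi> *\<^sub>v (\<Phi> *\<^sub>v x)"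
    using Ax C \<Phi> \<Psi> xc by auto
  finally show "\<Psi> *\<^sub>v (\<Phi> *\<^sub>v x) = x" ..
qed

text \<open>The data are symmetric in \<open>A\<close> and \<open>B\<close>, so
  \<open>kernel_map\<close> applies in both directions and makes \<open>\<Phi>\<close> an
  isomorphism of the two kernels.\<close>

lemma kernel_basis_image:
  fixes A B \<Phi> \<Psi> :: "'a::field mat"
  assumes A: "A \<in> carrier_mat r n" and B: "B \<in> carrier_mat r' n'"
    and \<Phi>: "\<Phi> \<in> carrier_mat n' n" and \<Psi>: "\<Psi> \<in> carrier_mat n n'"
    and C: "C1 \<in> carrier_mat r' r" "C2 \<in> carrier_mat r r'"
           "C3 \<in> carrier_mat n' r'" "C4 \<in> carrier_mat n r"
    and eq: "B * \<Phi> = C1 * A" "A * \<Psi> = C2 * B"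
            "\<Phi> * \<Psi> + C3 * B = 1\<^sub>m n'" "\<Psi> * \<Phi> + C4 * A = 1\<^sub>m n"
    and fin: "finite X"
    and X: "vectorspace.basis class_ring ((module_vec TYPE('a) n)\<lparr>carrier := mat_kernel A\<rparr>) X"
  shows "vectorspace.basis class_ring ((module_vec TYPE('a) n')\<lparr>carrier := mat_kernel B\<rparr>)
           ((*\<^sub>v) \<Phi> ` X)"
proof -
  interpret KA: kernel r n A by (unfold_locales, rule A)
  interpret KB: kernel r' n' B by (unfold_locales, rule B)
  note fwd = kernel_map[OF A B \<Phi> \<Psi> C(1,4) eq(1,4)]
  note bwd = kernel_map[OF B A \<Psi> \<Phi> C(2,3) eq(2,3)]
  interpret lm: linear_map class_ring KA.VK KB.VK "(*\<^sub>v) \<Phi>"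
  proof unfold_locales
    show "(*\<^sub>v) \<Phi> \<in> LinearCombinations.module_hom class_ring KA.VK KB.VK"
      unfolding LinearCombinations.module_hom_def
      using fwd(1) mat_kernel_carrier[OF A] \<Phi>
      by (auto simp: mult_add_distrib_mat_vec[OF \<Phi>] mult_mat_vec[OF \<Phi>] subset_iff)
  qed
  have fd: "KA.Ker.fin_dim"
    using X fin unfolding KA.Ker.basis_def KA.Ker.fin_dim_def by auto
  have inj: "inj_on ((*\<^sub>v) \<Phi>) (carrier KA.VK)"
    by (rule inj_on_inverseI[of _ "(*\<^sub>v) \<Psi>"]) (simp add: fwd)
  have surj: "(*\<^sub>v) \<Phi> ` carrier KA.VK = carrier KB.VK"
    using fwd bwd by (auto simp: image_iff) metis
  show ?thesis
    by (rule lm.linear_inj_image_is_basis[OF inj surj X fd])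
qed

text \<open>Bases live over the rational functions but consist of polynomial vectors; applying
  \<open>to_fract\<close> entrywise to the polynomial certificates bridges the two levels. The
  second claim returns to polynomials by injectivity of \<open>to_fract\<close>: degrees are only
  controlled on nonzero polynomial null vectors.\<close>

lemma poly_basis_image:
  fixes A B \<Phi> \<Psi> :: "'a::field poly mat"
  assumes A: "A \<in> carrier_mat r n" and B: "B \<in> carrier_mat r' n'"
    and \<Phi>: "\<Phi> \<in> carrier_mat n' n" and \<Psi>: "\<Psi> \<in> carrier_mat n n'"
    and C: "C1 \<in> carrier_mat r' r" "C2 \<in> carrier_mat r r'"
           "C3 \<in> carrier_mat n' r'" "C4 \<in> carrier_mat n r"
    and eq: "B * \<Phi> = C1 * A" "A * \<Psi> = C2 * B"
            "\<Phi> * \<Psi> + C3 * B = 1\<^sub>m n'" "\<Psi> * \<Phi> + C4 * A = 1\<^sub>m n"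
    and bs: "poly_basis n (right_nullspace A) bs"
  shows "poly_basis n' (right_nullspace B) (map ((*\<^sub>v) \<Phi>) bs)"
    and "\<And>b. b \<in> set bs \<Longrightarrow> A *\<^sub>v b = 0\<^sub>v r \<and> b \<in> carrier_vec n \<and> b \<noteq> 0\<^sub>v n"
proof -
  define f where "f = map_mat (to_fract :: 'a poly \<Rightarrow> _)"
  have f_carrier: "f X \<in> carrier_mat a b" if "X \<in> carrier_mat a b" for X a b
    unfolding f_def using that by simp
  have f_mult: "f (X * Y) = f X * f Y" if "X \<in> carrier_mat a b" "Y \<in> carrier_mat b c" for X Y a b c
    unfolding f_def using that by (rule to_fract_hom.mat_hom_mult)
  have f_add: "f (X + Y) = f X + f Y" if "X \<in> carrier_mat a b" "Y \<in> carrier_mat a b" for X Y a b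
    unfolding f_def using that by (auto simp: mat_eq_iff)
  have f_one: "f (1\<^sub>m a) = 1\<^sub>m a" for a
    unfolding f_def by (rule to_fract_hom.mat_hom_one)
  have vec: "map_vec to_fract (\<Phi> *\<^sub>v b) = f \<Phi> *\<^sub>v map_vec to_fract b" if "b \<in> carrier_vec n" for b
    unfolding f_def using that \<Phi> to_fract_hom.mult_mat_vec_hom by blast
  have eq': "f B * f \<Phi> = f C1 * f A" "f A * f \<Psi> = f C2 * f B"
            "f \<Phi> * f \<Psi> + f C3 * f B = 1\<^sub>m n'" "f \<Psi> * f \<Phi> + f C4 * f A = 1\<^sub>m n"
    using arg_cong[OF eq(1), of f] arg_cong[OF eq(2), of f] arg_cong[OF eq(3), of f]
      arg_cong[OF eq(4), of f] A B \<Phi> \<Psi> C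
    by (simp_all add: f_mult f_one f_add[of _ n n] f_add[of _ n' n'])
  have bsc: "set bs \<subseteq> carrier_vec n" and dist: "distinct bs"
    and basis: "vectorspace.basis class_ring
      ((module_vec TYPE('a poly fract) n)\<lparr>carrier := mat_kernel (f A)\<rparr>) (map_vec to_fract ` set bs)"
    using bs unfolding poly_basis_def right_nullspace_eq_mat_kernel f_def by auto
  have "vectorspace.basis class_ring ((module_vec TYPE('a poly fract) n')\<lparr>carrier := mat_kernel (f B)\<rparr>)
       ((*\<^sub>v) (f \<Phi>) ` (map_vec to_fract ` set bs))"
    by (rule kernel_basis_image[OF f_carrier[OF A] f_carrier[OF B] f_carrier[OF \<Phi>] f_carrier[OF \<Psi>]
        C[THEN f_carrier] eq' _ basis]) simp
  also have "(*\<^sub>v) (f \<Phi>) ` (map_vec to_fract ` set bs) = map_vec to_fract ` set (map ((*\<^sub>v) \<Phi>) bs)"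
    unfolding set_map image_image by (rule image_cong) (use vec bsc in auto)
  finally have basis': "vectorspace.basis class_ring
      ((module_vec TYPE('a poly fract) n')\<lparr>carrier := mat_kernel (f B)\<rparr>)
      (map_vec to_fract ` set (map ((*\<^sub>v) \<Phi>) bs))" .
  interpret KA: kernel r n "f A" by (unfold_locales) (use A in \<open>auto intro: f_carrier\<close>)
  have li: "KA.Ker.lin_indpt (map_vec to_fract ` set bs)"
    and sub: "map_vec to_fract ` set bs \<subseteq> mat_kernel (f A)"
    using basis unfolding KA.Ker.basis_def by auto
  have inj_vec: "inj (map_vec to_fract :: 'a poly vec \<Rightarrow> _)"
    using to_fract_hom.vec_hom_inj by (rule injI)
  show props: "A *\<^sub>v b = 0\<^sub>v r \<and> b \<in> carrier_vec n \<and> b \<noteq> 0\<^sub>v n" if b: "b \<in> set bs" for b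
  proof (intro conjI)
    show bc: "b \<in> carrier_vec n" using b bsc by auto
    have "map_vec to_fract b \<in> mat_kernel (f A)" using b sub by auto
    then have "f A *\<^sub>v map_vec to_fract b = 0\<^sub>v r"
      using mat_kernelD[OF KA.A] by auto
    then have "map_vec to_fract (A *\<^sub>v b) = map_vec to_fract (0\<^sub>v r)"
      unfolding f_def using to_fract_hom.mult_mat_vec_hom[OF A bc] to_fract_hom.vec_hom_zero by metis
    then show "A *\<^sub>v b = 0\<^sub>v r" by (rule injD[OF inj_vec])
    show "b \<noteq> 0\<^sub>v n"
    proof
      assume "b = 0\<^sub>v n"
      then have "0\<^sub>v n \<in> map_vec to_fract ` set bs"
        using b to_fract_hom.vec_hom_zero[of n] by (metis imageI)
      then show False
        using KA.Ker.zero_nin_lin_indpt[OF sub li] by (metis UNIV_I singletonD zero_neq_one)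
    qed
  qed
  have "inj_on ((*\<^sub>v) \<Phi>) (set bs)"
  proof (rule inj_onI)
    fix x y assume xy: "x \<in> set bs" "y \<in> set bs" and "\<Phi> *\<^sub>v x = \<Phi> *\<^sub>v y"
    then have e: "f \<Phi> *\<^sub>v map_vec to_fract x = f \<Phi> *\<^sub>v map_vec to_fract y"
      using vec bsc by (metis subsetD)
    have "f \<Psi> *\<^sub>v (f \<Phi> *\<^sub>v map_vec to_fract v) = map_vec to_fract v" if "v \<in> set bs" for v
      by (rule kernel_map(2)[OF f_carrier[OF A] f_carrier[OF B] f_carrier[OF \<Phi>] f_carrier[OF \<Psi>]
          f_carrier[OF C(1)] f_carrier[OF C(4)] eq'(1,4)]) (use sub that in auto)
    then have "map_vec to_fract x = map_vec to_fract y"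
      using xy e by metis
    then show "x = y" by (rule injD[OF inj_vec])
  qed
  then show "poly_basis n' (right_nullspace B) (map ((*\<^sub>v) \<Phi>) bs)"
    using dist bsc \<Phi> basis' unfolding poly_basis_def right_nullspace_eq_mat_kernel f_def
    by (auto simp: distinct_map)
qed

text \<open>Shifting each degree by \<open>k\<close> changes a degree sum by \<open>k\<close> times
  the length of the basis; minimality survives because this length is the same for all
  bases.\<close>

lemma poly_basis_length_eq:
  fixes A :: "'a::field poly mat"
  assumes A: "A \<in> carrier_mat r n"
    and bs: "poly_basis n (right_nullspace A) bs" "poly_basis n (right_nullspace A) cs"
  shows "length bs = length cs"
proof -
  interpret KA: kernel r n "map_mat to_fract A" by (unfold_locales) (use A in auto)
  have inj_vec: "inj (map_vec to_fract :: 'a poly vec \<Rightarrow> _)"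
    using to_fract_hom.vec_hom_inj by (rule injI)
  have "length bs = KA.dim" if "poly_basis n (right_nullspace A) bs" for bs
  proof -
    have "KA.basis (map_vec to_fract ` set bs)" "distinct bs"
      using that unfolding poly_basis_def right_nullspace_eq_mat_kernel by auto
    moreover from this have "KA.dim = card (map_vec to_fract ` set bs)"
      by (intro KA.Ker.dim_basis) auto
    ultimately show ?thesis
      by (simp add: card_image inj_on_subset[OF inj_vec] distinct_card)
  qed
  then show ?thesis using bs by simp
qed

lemma sort_map_add: "sort (map (\<lambda>a. a + k) xs) = map (\<lambda>a. a + k) (sort (xs :: nat list))"
  by (rule properties_for_sort) (auto simp: sorted_map intro!: sorted_wrt_mono_rel[OF _ sorted_sort])

text \<open>\<open>\<Phi>\<close> and \<open>\<Psi>\<close> are polynomial, so they match the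
  polynomial bases of the two null spaces, and all degree sums move by the same amount. Hence a
  basis of least total degree is mapped to one of least total degree.\<close>

lemma right_minimal_indices_transfer:
  fixes A B \<Phi> \<Psi> :: "'a::field poly mat"
  assumes A: "A \<in> carrier_mat r n" and B: "B \<in> carrier_mat r' n'"
    and \<Phi>: "\<Phi> \<in> carrier_mat n' n" and \<Psi>: "\<Psi> \<in> carrier_mat n n'"
    and C: "C1 \<in> carrier_mat r' r" "C2 \<in> carrier_mat r r'"
           "C3 \<in> carrier_mat n' r'" "C4 \<in> carrier_mat n r"
    and eq: "B * \<Phi> = C1 * A" "A * \<Psi> = C2 * B"
            "\<Phi> * \<Psi> + C3 * B = 1\<^sub>m n'" "\<Psi> * \<Phi> + C4 * A = 1\<^sub>m n"
    and deg: "\<And>x. x \<in> carrier_vec n \<Longrightarrow> x \<noteq> 0\<^sub>v n \<Longrightarrow> A *\<^sub>v x = 0\<^sub>v r \<Longrightarrow>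
                vec_degree (\<Phi> *\<^sub>v x) = vec_degree x + k"
    and \<alpha>: "are_right_minimal_indices A \<alpha>"
  shows "are_right_minimal_indices B (map (\<lambda>a. a + k) \<alpha>)"
proof -
  note fwd = poly_basis_image[OF A B \<Phi> \<Psi> C eq]
  note bwd = poly_basis_image[OF B A \<Psi> \<Phi> C(2,1,4,3) eq(2,1,4,3)]
  have shift: "sum_list (map vec_degree (map ((*\<^sub>v) \<Phi>) bs)) = sum_list (map vec_degree bs) + length bs * k"
    and shift': "map vec_degree (map ((*\<^sub>v) \<Phi>) bs) = map (\<lambda>a. a + k) (map vec_degree bs)"
    if bs: "poly_basis n (right_nullspace A) bs" for bs
  proof -
    show e: "map vec_degree (map ((*\<^sub>v) \<Phi>) bs) = map (\<lambda>a. a + k) (map vec_degree bs)"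
      using fwd(2)[OF bs] deg by simp
    show "sum_list (map vec_degree (map ((*\<^sub>v) \<Phi>) bs)) = sum_list (map vec_degree bs) + length bs * k"
      unfolding e by (induction bs) auto
  qed
  obtain bs where bs: "poly_basis n (right_nullspace A) bs"
    and min: "\<And>cs. poly_basis n (right_nullspace A) cs \<Longrightarrow>
        sum_list (map vec_degree bs) \<le> sum_list (map vec_degree cs)"
    and \<alpha>_eq: "\<alpha> = sort (map vec_degree bs)"
    using \<alpha> A unfolding are_right_minimal_indices_def minimal_poly_basis_def by auto
  have "minimal_poly_basis n' (right_nullspace B) (map ((*\<^sub>v) \<Phi>) bs)"
    unfolding minimal_poly_basis_def
  proof (intro conjI allI impI)
    show "poly_basis n' (right_nullspace B) (map ((*\<^sub>v) \<Phi>) bs)"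
      by (rule fwd(1)[OF bs])
    fix cs assume cs: "poly_basis n' (right_nullspace B) cs"
    \<comment> \<open>A competitor \<open>cs\<close> for \<open>B\<close> is pulled back to
      \<open>A\<close>, where minimality of \<open>bs\<close> is known. Mapping it forward again
      returns \<open>cs\<close>, so the degree shift applies to it.\<close>
    let ?cs = "map ((*\<^sub>v) \<Psi>) cs"
    note cs' = bwd(1)[OF cs]
    have "\<Phi> *\<^sub>v (\<Psi> *\<^sub>v c) = c" if c: "c \<in> set cs" for c
    proof -
      have cc: "c \<in> carrier_vec n'" and Bc: "B *\<^sub>v c = 0\<^sub>v r'"
        using bwd(2)[OF cs c] by auto
      have "c = (\<Phi> * \<Psi> + C3 * B) *\<^sub>v c"
        using eq cc by simp
      also have "\<dots> = \<Phi> *\<^sub>v (\<Psi> *\<^sub>v c) + C3 *\<^sub>v (B *\<^sub>v c)"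
        using B \<Phi> \<Psi> C cc by (simp add: add_mult_distrib_mat_vec[of _ n' n'])
      also have "\<dots> = \<Phi> *\<^sub>v (\<Psi> *\<^sub>v c)"
        using Bc C \<Phi> \<Psi> cc by auto
      finally show ?thesis ..
    qed
    then have "cs = map ((*\<^sub>v) \<Phi>) ?cs"
      by (simp add: map_idI)
    then have "sum_list (map vec_degree cs) = sum_list (map vec_degree ?cs) + length ?cs * k"
      using shift(1)[OF cs'] by simp
    moreover have "length ?cs = length bs"
      by (rule poly_basis_length_eq[OF A cs' bs])
    ultimately show "sum_list (map vec_degree (map ((*\<^sub>v) \<Phi>) bs)) \<le> sum_list (map vec_degree cs)"
      using shift(1)[OF bs] min[OF cs'] by simp
  qed
  moreover have "map (\<lambda>a. a + k) \<alpha> = sort (map vec_degree (map ((*\<^sub>v) \<Phi>) bs))"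
    unfolding shift'[OF bs] \<alpha>_eq sort_map_add ..
  ultimately show ?thesis
    unfolding are_right_minimal_indices_def using B by auto
qed

section \<open>Linearizations from unimodular completions\<close>

lemma append_cols_carrier [simp, intro]:
  "A \<in> carrier_mat r c1 \<Longrightarrow> B \<in> carrier_mat r c2 \<Longrightarrow> append_cols A B \<in> carrier_mat r (c1 + c2)"
  unfolding append_cols_def by auto

lemma append_cols_mult_append_rows:
  fixes A :: "'a::semiring_0 mat"
  assumes "A \<in> carrier_mat r a" "B \<in> carrier_mat r b" "C \<in> carrier_mat a c" "D \<in> carrier_mat b c"
  shows "append_cols A B * append_rows C D = A * C + B * D"
proof -
  have dims: "dim_col A = a" "dim_col B = b" "dim_row C = a" "dim_row D = b" using assms by auto
  show ?thesis
    unfolding append_cols_def append_rows_def dims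
    by (subst mult_four_block_mat[OF assms(1,2) _ _ assms(3) _ assms(4)])
      (use assms in \<open>auto intro!: eq_matI\<close>)
qed

lemma append_rows_mult_append_cols:
  fixes A :: "'a::semiring_0 mat"
  assumes "A \<in> carrier_mat r1 a" "B \<in> carrier_mat r2 a" "C \<in> carrier_mat a c1" "D \<in> carrier_mat a c2"
  shows "append_rows A B * append_cols C D = four_block_mat (A * C) (A * D) (B * C) (B * D)"
proof -
  have dims: "dim_row A = r1" "dim_row B = r2" "dim_col C = c1" "dim_col D = c2" using assms by auto
  have z: "0\<^sub>m x 0 * 0\<^sub>m 0 y = (0\<^sub>m x y :: 'a mat)" for x y
    by (auto intro!: eq_matI simp: scalar_prod_def)
  show ?thesis
    unfolding append_cols_def append_rows_def dims
    by (subst mult_four_block_mat[OF assms(1) _ assms(2) _ assms(3,4)])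
      (use assms in \<open>auto simp: z\<close>)
qed

lemma mult_append_cols:
  fixes A :: "'a::semiring_0 mat"
  assumes "A \<in> carrier_mat r a" "C \<in> carrier_mat a c1" "D \<in> carrier_mat a c2"
  shows "A * append_cols C D = append_cols (A * C) (A * D)"
proof (rule eq_matI)
  fix i j assume "i < dim_row (append_cols (A * C) (A * D))" "j < dim_col (append_cols (A * C) (A * D))"
  then show "(A * append_cols C D) $$ (i, j) = append_cols (A * C) (A * D) $$ (i, j)"
    using assms by (auto simp: append_cols_def scalar_prod_def intro!: sum.cong)
qed (use assms in \<open>auto simp: append_cols_def\<close>)

text \<open>Determinants multiply, and the units among the polynomials over a field are the nonzero
  constants.\<close>

lemma unimodular_if_right_inverse:
  fixes U W :: "'a::field poly mat"
  assumes U: "U \<in> carrier_mat n n" and W: "W \<in> carrier_mat n n" and UW: "U * W = 1\<^sub>m n"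
  shows "unimodular n U"
proof -
  have "det U * det W = 1"
    using det_mult[OF U W] UW by simp
  then have "is_unit (det U)"
    by (metis dvd_triv_left)
  then show ?thesis
    unfolding unimodular_def using U by (auto simp: is_unit_poly_iff)
qed

text \<open>\<open>[U; D]\<close> is the inverse of the square matrix \<open>[K E]\<close>. In the application \<open>K\<close> is the
  (perturbed) Kronecker block and \<open>D\<close> is dual to it; \<open>E\<close> completes \<open>K\<close> to a unimodular matrix.\<close>

definition dual_frame ::
    "nat \<Rightarrow> nat \<Rightarrow> 'a::comm_ring_1 mat \<Rightarrow> 'a mat \<Rightarrow> 'a mat \<Rightarrow> 'a mat \<Rightarrow> bool" where
  "dual_frame k m U D K E \<longleftrightarrow>
     U \<in> carrier_mat k (k + m) \<and> D \<in> carrier_mat m (k + m) \<and>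
     K \<in> carrier_mat (k + m) k \<and> E \<in> carrier_mat (k + m) m \<and>
     U * K = 1\<^sub>m k \<and> U * E = 0\<^sub>m k m \<and> D * K = 0\<^sub>m m k \<and> D * E = 1\<^sub>m m \<and>
     K * U + E * D = 1\<^sub>m (k + m)"

text \<open>Since \<open>K' = Ai * K * Z\<close>, the square matrix \<open>[K E]\<close> is
  multiplied by \<open>Ai\<close> on the left and by \<open>diag(Z, 1)\<close> on the right. Its
  inverse \<open>[U; D]\<close> is therefore multiplied by \<open>diag(Zi, 1)\<close> on the left
  and by \<open>A\<close> on the right.\<close>

lemma dual_frame_conj:
  fixes U D K E :: "'a::comm_ring_1 mat"
  assumes fr: "dual_frame k m U D K E"
    and A: "A \<in> carrier_mat (k + m) (k + m)" "Ai \<in> carrier_mat (k + m) (k + m)"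
       "A * Ai = 1\<^sub>m (k + m)" "Ai * A = 1\<^sub>m (k + m)"
    and Z: "Z \<in> carrier_mat k k" "Zi \<in> carrier_mat k k" "Z * Zi = 1\<^sub>m k" "Zi * Z = 1\<^sub>m k"
    and K': "K' \<in> carrier_mat (k + m) k" "A * K' = K * Z"
  shows "dual_frame k m (Zi * (U * A)) (D * A) K' (Ai * E)"
proof -
  define N where "N = k + m"
  note fr' = fr[unfolded dual_frame_def, folded N_def]
  note A' = A[folded N_def] and K'' = K'[folded N_def]
  have U: "U \<in> carrier_mat k N" and D: "D \<in> carrier_mat m N"
    and K: "K \<in> carrier_mat N k" and E: "E \<in> carrier_mat N m"
    and id: "U * K = 1\<^sub>m k" "U * E = 0\<^sub>m k m" "D * K = 0\<^sub>m m k" "D * E = 1\<^sub>m m" "K * U + E * D = 1\<^sub>m N"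
    using fr' by auto
  have UA: "U * A \<in> carrier_mat k N" and AiE: "Ai * E \<in> carrier_mat N m" using U A' E by auto
  have K'_eq: "K' = Ai * (K * Z)"
    unfolding K'(2)[symmetric] using A' K''(1) assoc_mult_mat[OF A'(2,1) K''(1), symmetric] by simp
  have AAiE: "A * (Ai * E) = E"
    using A' E assoc_mult_mat[OF A'(1,2) E, symmetric] by simp
  have "(Zi * (U * A)) * K' = Zi * (U * (A * K'))"
    using A' K'' U Z UA by (simp add: assoc_mult_mat[OF Z(2) UA K''(1)] assoc_mult_mat[OF U A'(1) K''(1)])
  also have "\<dots> = Zi * ((U * K) * Z)"
    unfolding K'(2) using assoc_mult_mat[OF U K Z(1)] by simp
  also have "\<dots> = 1\<^sub>m k" using id Z by simp
  finally have 1: "(Zi * (U * A)) * K' = 1\<^sub>m k" .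
  have "(Zi * (U * A)) * (Ai * E) = Zi * (U * (A * (Ai * E)))"
    using assoc_mult_mat[OF Z(2) UA AiE] assoc_mult_mat[OF U A'(1) AiE] by simp
  also have "\<dots> = 0\<^sub>m k m" using id Z AAiE by simp
  finally have 2: "(Zi * (U * A)) * (Ai * E) = 0\<^sub>m k m" .
  have "(D * A) * K' = (D * K) * Z"
    using assoc_mult_mat[OF D A'(1) K''(1)] assoc_mult_mat[OF D K Z(1)] K'(2) by simp
  then have 3: "(D * A) * K' = 0\<^sub>m m k" using id Z by simp
  have 4: "(D * A) * (Ai * E) = 1\<^sub>m m"
    using assoc_mult_mat[OF D A'(1) AiE] AAiE id by simp
  have KU: "K * U \<in> carrier_mat N N" and ED: "E * D \<in> carrier_mat N N"
    using K U E D by auto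
  have "K' * (Zi * (U * A)) = Ai * ((K * U) * A)"
  proof -
    have "K' * (Zi * (U * A)) = Ai * ((K * Z) * (Zi * (U * A)))"
      unfolding K'_eq using A' K Z UA by (intro assoc_mult_mat[of _ N N _ k _ N]) auto
    moreover have "(K * Z) * (Zi * (U * A)) = K * (Z * (Zi * (U * A)))"
      using K Z UA by (intro assoc_mult_mat[of _ N k _ k _ N]) auto
    moreover have "Z * (Zi * (U * A)) = U * A"
      using Z(3) left_mult_one_mat[OF UA] assoc_mult_mat[OF Z(1,2) UA, symmetric] by simp
    ultimately show ?thesis
      by (simp only: assoc_mult_mat[OF K U A'(1)])
  qed
  moreover have "(Ai * E) * (D * A) = Ai * ((E * D) * A)"
    using assoc_mult_mat[OF A'(2) E, of "D * A" N] assoc_mult_mat[OF E D A'(1)] D A' by simp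
  ultimately have "K' * (Zi * (U * A)) + (Ai * E) * (D * A) = Ai * ((K * U) * A) + Ai * ((E * D) * A)"
    by simp
  also have "\<dots> = Ai * ((K * U) * A + (E * D) * A)"
    by (rule mult_add_distrib_mat[symmetric, OF A'(2) mult_carrier_mat[OF KU A'(1)] mult_carrier_mat[OF ED A'(1)]])
  also have "(K * U) * A + (E * D) * A = (K * U + E * D) * A"
    by (rule add_mult_distrib_mat[symmetric, OF KU ED A'(1)])
  also have "Ai * \<dots> = 1\<^sub>m N" using id A' by simp
  finally have 5: "K' * (Zi * (U * A)) + (Ai * E) * (D * A) = 1\<^sub>m N" .
  show ?thesis
    unfolding dual_frame_def N_def[symmetric] using 1 2 3 4 5 U D E A' Z K'' by auto
qed

text \<open>Multiplying \<open>[M K]\<close> by \<open>[U; D]\<close> gives the blocks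
  \<open>U M\<close>, \<open>1\<close> over \<open>D M\<close>, \<open>0\<close>. It remains to
  exchange the block columns and to clear \<open>U M\<close> with the identity block.\<close>

lemma dual_frame_linearization:
  fixes U D K E M :: "'a::field poly mat"
  assumes fr: "dual_frame k m U D K E" and M: "M \<in> carrier_mat (k + m) n"
    and grade: "has_grade 1 (append_cols M K)"
  shows "is_linearization (append_cols M K) (D * M)"
proof -
  have U: "U \<in> carrier_mat k (k + m)" and D: "D \<in> carrier_mat m (k + m)"
    and K: "K \<in> carrier_mat (k + m) k" and E: "E \<in> carrier_mat (k + m) m"
    and id: "U * K = 1\<^sub>m k" "U * E = 0\<^sub>m k m" "D * K = 0\<^sub>m m k" "D * E = 1\<^sub>m m"
    using fr unfolding dual_frame_def by auto
  have UM: "U * M \<in> carrier_mat k n" and DM: "D * M \<in> carrier_mat m n" using U D M by auto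
  \<comment> \<open>The exchange of block columns combined with the elimination of
    \<open>U M\<close>; \<open>Vi\<close> is its inverse.\<close>
  define V where "V = four_block_mat (0\<^sub>m n k) (1\<^sub>m n) (1\<^sub>m k) (- (U * M))"
  define Vi where "Vi = four_block_mat (U * M) (1\<^sub>m k) (1\<^sub>m n) (0\<^sub>m n k)"
  have V: "V \<in> carrier_mat (k + n) (k + n)" and Vi: "Vi \<in> carrier_mat (k + n) (k + n)"
    unfolding V_def Vi_def
    using four_block_carrier_mat[of "0\<^sub>m n k" n k "- (U * M)" k n]
      four_block_carrier_mat[of "U * M" k n "0\<^sub>m n k" n k] UM
    by (auto simp: add.commute[of n k])
  have "V * Vi = four_block_mat (1\<^sub>m n) (0\<^sub>m n k) (U * M - U * M) (1\<^sub>m k)"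
    unfolding V_def Vi_def
    by (subst mult_four_block_mat[of _ n k _ n _ k _ _ n _ k])
      (use UM U M in \<open>auto simp: left_mult_zero_mat[OF UM]\<close>)
  also have "\<dots> = 1\<^sub>m (k + n)"
    unfolding minus_r_inv_mat[OF UM] by (simp add: add.commute)
  finally have VVi: "V * Vi = 1\<^sub>m (k + n)" .
  have "append_rows U D * append_cols K E = four_block_mat (1\<^sub>m k) (0\<^sub>m k m) (0\<^sub>m m k) (1\<^sub>m m)"
    by (subst append_rows_mult_append_cols[OF U D K E]) (simp add: id)
  then have UW: "append_rows U D * append_cols K E = 1\<^sub>m (k + m)" by simp
  have "append_rows U D * append_cols M K = four_block_mat (U * M) (1\<^sub>m k) (D * M) (0\<^sub>m m k)"
    by (subst append_rows_mult_append_cols[OF U D M K]) (simp add: id)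
  then have "append_rows U D * append_cols M K * V =
      four_block_mat (1\<^sub>m k) (U * M - U * M) (0\<^sub>m m k) (D * M)"
    unfolding V_def using UM DM U M D
    by (simp, subst mult_four_block_mat[of _ k n _ k _ m _ _ k _ n]) auto
  also have "\<dots> = diag_block_mat [1\<^sub>m k, D * M]"
    unfolding minus_r_inv_mat[OF UM] diag_block_mat.simps(2)[of "1\<^sub>m k"] diag_block_mat_singleton
      Let_def carrier_matD[OF DM] by simp
  finally have eq: "append_rows U D * append_cols M K * V = diag_block_mat [1\<^sub>m k, D * M]" .
  have dims: "dim_row (D * M) = m" "dim_col (D * M) = n" using D M by auto
  have "append_cols M K \<in> carrier_mat (k + m) (k + n)"
    using M K by (metis add.commute append_cols_carrier)
  then show ?thesis
    unfolding is_linearization_def dims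
    using grade eq unimodular_if_right_inverse[OF V Vi VVi]
      unimodular_if_right_inverse[OF carrier_append_rows[OF U D] append_cols_carrier[OF K E] UW]
    by blast
qed

text \<open>If \<open>M x + K y = 0\<close>, applying \<open>U\<close> forces
  \<open>y = - U M x\<close>, and applying \<open>D\<close> leaves \<open>D M x = 0\<close>. So
  \<open>\<Phi>\<close> parametrizes the kernel of \<open>[M K]\<close> by that of
  \<open>D M\<close>, and \<open>\<Psi>\<close> projects back to \<open>x\<close>. The remaining
  identities are the cofactor certificates; transposed, they also settle the left null
  spaces.\<close>

lemma dual_frame_identities:
  fixes U D K E M :: "'a::comm_ring_1 mat"
  assumes fr: "dual_frame k m U D K E" and M: "M \<in> carrier_mat (k + m) n"
  defines "L \<equiv> append_cols M K"
    and "\<Phi> \<equiv> append_rows (1\<^sub>m n) (- (U * M))" and "\<Psi> \<equiv> append_cols (1\<^sub>m n) (0\<^sub>m n k)"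
    and "C \<equiv> append_rows (0\<^sub>m n (k + m)) U"
  shows "L \<in> carrier_mat (k + m) (n + k)" "\<Phi> \<in> carrier_mat (n + k) n" "\<Psi> \<in> carrier_mat n (n + k)"
    "C \<in> carrier_mat (n + k) (k + m)"
    "L * \<Phi> = E * (D * M)" "(D * M) * \<Psi> = D * L" "\<Phi> * \<Psi> + C * L = 1\<^sub>m (n + k)" "\<Psi> * \<Phi> = 1\<^sub>m n"
    "L * C + E * D = 1\<^sub>m (k + m)"
proof -
  have U: "U \<in> carrier_mat k (k + m)" and D: "D \<in> carrier_mat m (k + m)"
    and K: "K \<in> carrier_mat (k + m) k" and E: "E \<in> carrier_mat (k + m) m"
    and id: "U * K = 1\<^sub>m k" "D * K = 0\<^sub>m m k" "K * U + E * D = 1\<^sub>m (k + m)"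
    using fr unfolding dual_frame_def by auto
  have UM: "U * M \<in> carrier_mat k n" and DM: "D * M \<in> carrier_mat m n"
    and EDM: "E * (D * M) \<in> carrier_mat (k + m) n" and KUM: "K * (U * M) \<in> carrier_mat (k + m) n"
    using U D M E K by auto
  show "L \<in> carrier_mat (k + m) (n + k)" "\<Phi> \<in> carrier_mat (n + k) n" "\<Psi> \<in> carrier_mat n (n + k)"
    "C \<in> carrier_mat (n + k) (k + m)"
    unfolding L_def \<Phi>_def \<Psi>_def C_def using M K U UM by auto
  have "M = (K * U + E * D) * M" using id M by simp
  also have "\<dots> = K * (U * M) + E * (D * M)"
    using add_mult_distrib_mat[of "K * U" "k + m" "k + m" "E * D" M n]
      assoc_mult_mat[OF K U M] assoc_mult_mat[OF E D M] K U E D M by simp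
  finally have M_eq: "M = K * (U * M) + E * (D * M)" .
  have "L * \<Phi> = M + K * (- (U * M))"
    unfolding L_def \<Phi>_def using UM M K by (subst append_cols_mult_append_rows[OF M K]) auto
  also have "\<dots> = M - K * (U * M)"
    using minus_add_uminus_mat[OF M KUM] uminus_mult_right_mat[of K "U * M"]
      carrier_matD[OF K] carrier_matD[OF U] by simp
  also have "\<dots> = E * (D * M)"
  proof (rule eq_matI)
    fix i j assume "i < dim_row (E * (D * M))" "j < dim_col (E * (D * M))"
    then have ij: "i < k + m" "j < n" using EDM by auto
    have "M $$ (i, j) = (K * (U * M)) $$ (i, j) + (E * (D * M)) $$ (i, j)"
      by (subst M_eq, rule index_add_mat(1)) (use EDM ij in auto)
    then show "(M - K * (U * M)) $$ (i, j) = (E * (D * M)) $$ (i, j)"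
      using KUM ij by (subst index_minus_mat) auto
  qed (use E D K U M in auto)
  finally show "L * \<Phi> = E * (D * M)" .
  have "D * L = append_cols (D * M) (0\<^sub>m m k)"
    unfolding L_def mult_append_cols[OF D M K] id ..
  also have "\<dots> = (D * M) * \<Psi>"
    unfolding \<Psi>_def mult_append_cols[OF DM one_carrier_mat zero_carrier_mat]
      right_mult_one_mat[OF DM] right_mult_zero_mat[OF DM] ..
  finally show "(D * M) * \<Psi> = D * L" ..
  have "\<Phi> * \<Psi> = four_block_mat (1\<^sub>m n) (0\<^sub>m n k) (- (U * M)) (0\<^sub>m k k)"
    unfolding \<Phi>_def \<Psi>_def using UM U M
    by (subst append_rows_mult_append_cols[of _ n n _ k _ n _ k]) auto
  moreover have "C * L = four_block_mat (0\<^sub>m n n) (0\<^sub>m n k) (U * M) (1\<^sub>m k)"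
    unfolding C_def L_def using U M K
    by (subst append_rows_mult_append_cols[of _ n "k + m" _ k _ n _ k]) (auto simp: id)
  moreover have "four_block_mat (1\<^sub>m n) (0\<^sub>m n k) (- (U * M)) (0\<^sub>m k k)
      + four_block_mat (0\<^sub>m n n) (0\<^sub>m n k) (U * M) (1\<^sub>m k) = 1\<^sub>m (n + k)"
    using UM by (subst add_four_block_mat[of _ n n _ k _ k]) (auto simp: uminus_l_inv_mat[OF UM])
  ultimately show "\<Phi> * \<Psi> + C * L = 1\<^sub>m (n + k)" by simp
  show "\<Psi> * \<Phi> = 1\<^sub>m n"
    unfolding \<Phi>_def \<Psi>_def using UM U M
    by (subst append_cols_mult_append_rows[of _ n n _ k _ n]) auto
  have "L * C = K * U"
    unfolding L_def C_def using U K M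
    by (subst append_cols_mult_append_rows[of _ "k + m" n _ k _ "k + m"]) auto
  then show "L * C + E * D = 1\<^sub>m (k + m)" using id by simp
qed

lemma dual_frame_right_minimal_indices:
  fixes U D K E M :: "'a::field poly mat"
  assumes fr: "dual_frame k m U D K E" and M: "M \<in> carrier_mat (k + m) n"
    and deg: "\<And>x y. x \<in> carrier_vec n \<Longrightarrow> y \<in> carrier_vec k \<Longrightarrow> M *\<^sub>v x + K *\<^sub>v y = 0\<^sub>v (k + m) \<Longrightarrow>
                vec_degree (x @\<^sub>v y) = vec_degree x"
    and \<alpha>: "are_right_minimal_indices (D * M) \<alpha>"
  shows "are_right_minimal_indices (append_cols M K) \<alpha>"
proof -
  note id = dual_frame_identities[OF fr M]
  have car: "U \<in> carrier_mat k (k + m)" "D \<in> carrier_mat m (k + m)"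
    "K \<in> carrier_mat (k + m) k" "E \<in> carrier_mat (k + m) m" "D * M \<in> carrier_mat m n"
    using fr M unfolding dual_frame_def by auto
  let ?\<Phi> = "append_rows (1\<^sub>m n) (- (U * M))"
  have "are_right_minimal_indices (append_cols M K) (map (\<lambda>a. a + 0) \<alpha>)"
  \<comment> \<open>The cofactors are \<open>E\<close>, \<open>D\<close>, the block
    \<open>[0; U]\<close> and 0; the last is 0 because \<open>\<Psi> * \<Phi>\<close> is exactly the
    identity.\<close>
  proof (rule right_minimal_indices_transfer[OF car(5) id(1-3) car(4,2) id(4) zero_carrier_mat id(5-7) _ _ \<alpha>])
    show "append_cols (1\<^sub>m n) (0\<^sub>m n k) * ?\<Phi> + 0\<^sub>m n m * (D * M) = 1\<^sub>m n"
      unfolding left_mult_zero_mat[OF car(5)] id(8) by simp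
    fix x assume x: "x \<in> carrier_vec n" "D * M *\<^sub>v x = 0\<^sub>v m"
    define y where "y = - (U * M) *\<^sub>v x"
    have UM: "- (U * M) \<in> carrier_mat k n" using car M by auto
    have y: "y \<in> carrier_vec k" unfolding y_def using UM x by auto
    have \<Phi>x: "?\<Phi> *\<^sub>v x = x @\<^sub>v y"
      unfolding y_def using mat_mult_append[OF one_carrier_mat UM x(1)] x by simp
    have "append_cols M K *\<^sub>v (?\<Phi> *\<^sub>v x) = (E * (D * M)) *\<^sub>v x"
      using assoc_mult_mat_vec[OF id(1,2) x(1)] id(5) by simp
    also have "\<dots> = E *\<^sub>v (D * M *\<^sub>v x)"
      by (rule assoc_mult_mat_vec[OF car(4,5) x(1)])
    also have "\<dots> = 0\<^sub>v (k + m)" unfolding x(2) using car(4) by auto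
    finally have "append_cols M K *\<^sub>v (x @\<^sub>v y) = 0\<^sub>v (k + m)" unfolding \<Phi>x .
    moreover have "append_cols M K *\<^sub>v (x @\<^sub>v y) = M *\<^sub>v x + K *\<^sub>v y"
    proof (rule eq_vecI)
      fix i assume "i < dim_vec (M *\<^sub>v x + K *\<^sub>v y)"
      then have i: "i < k + m" using car(3) by auto
      have r: "row (append_cols M K) i = row M i @\<^sub>v row K i"
        unfolding append_cols_def using M car(3) i
        by (intro row_four_block_mat(1)[of _ "k + m" n _ k _ 0]) auto
      have "(append_cols M K *\<^sub>v (x @\<^sub>v y)) $ i = row (append_cols M K) i \<bullet> (x @\<^sub>v y)"
        by (rule index_mult_mat_vec) (use carrier_matD[OF id(1)] i in simp)
      also have "\<dots> = row M i \<bullet> x + row K i \<bullet> y"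
        unfolding r by (rule scalar_prod_append) (use M car(3) x(1) y in auto)
      also have "\<dots> = (M *\<^sub>v x + K *\<^sub>v y) $ i"
        using i M car(3) by simp
      finally show "(append_cols M K *\<^sub>v (x @\<^sub>v y)) $ i = (M *\<^sub>v x + K *\<^sub>v y) $ i" .
    qed (use car(3) carrier_matD[OF id(1)] in auto)
    ultimately show "vec_degree (?\<Phi> *\<^sub>v x) = vec_degree x + 0"
      using deg[OF x(1) y] \<Phi>x by simp
  qed
  then show ?thesis by simp
qed

lemma are_left_minimal_indices_eq:
  "are_left_minimal_indices P = are_right_minimal_indices (transpose_mat P)"
  by (auto simp: fun_eq_iff are_left_minimal_indices_def are_right_minimal_indices_def left_nullspace_eq)

text \<open>If \<open>z\<close> annihilates \<open>D M\<close> from the left, then the row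
  \<open>z D\<close> annihilates both \<open>M\<close> and \<open>K\<close>. Conversely a row
  annihilating \<open>K\<close> is a combination of the rows of \<open>D\<close>, by
  \<open>K * U + E * D = 1\<close>, and \<open>E\<close> recovers the coefficients.\<close>

lemma dual_frame_left_minimal_indices:
  fixes U D K E M :: "'a::field poly mat"
  assumes fr: "dual_frame k m U D K E" and M: "M \<in> carrier_mat (k + m) n"
    and deg: "\<And>z. z \<in> carrier_vec m \<Longrightarrow> z \<noteq> 0\<^sub>v m \<Longrightarrow>
                vec_degree (transpose_mat D *\<^sub>v z) = vec_degree z + \<eta>"
    and \<alpha>: "are_left_minimal_indices (D * M) \<alpha>"
  shows "are_left_minimal_indices (append_cols M K) (map (\<lambda>a. a + \<eta>) \<alpha>)"
proof -
  note left = are_left_minimal_indices_eq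
  note id = dual_frame_identities[OF fr M]
  have car: "U \<in> carrier_mat k (k + m)" "D \<in> carrier_mat m (k + m)"
    "K \<in> carrier_mat (k + m) k" "E \<in> carrier_mat (k + m) m" "D * M \<in> carrier_mat m n"
    "D * E = 1\<^sub>m m"
    using fr M unfolding dual_frame_def by auto
  let ?L = "append_cols M K"
  let ?\<Phi> = "append_rows (1\<^sub>m n) (- (U * M))" and ?\<Psi> = "append_cols (1\<^sub>m n) (0\<^sub>m n k :: 'a poly mat)"
  let ?C = "append_rows (0\<^sub>m n (k + m)) U"
  have t: "transpose_mat X \<in> carrier_mat b a" if "X \<in> carrier_mat a b" for X :: "'a poly mat" and a b
    using that by simp
  show ?thesis
    unfolding left
  \<comment> \<open>The roles are exchanged: the transposes of \<open>D\<close> and \<open>E\<close>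
    are the maps, and the transposes of \<open>\<Psi>\<close>, \<open>\<Phi>\<close> and
    \<open>[0; U]\<close> become cofactors.\<close>
  proof (rule right_minimal_indices_transfer[OF car(5)[THEN t] id(1)[THEN t] car(2)[THEN t] car(4)[THEN t]
        id(3)[THEN t] id(2)[THEN t] id(4)[THEN t] zero_carrier_mat _ _ _ _ deg \<alpha>[unfolded left]])
    show "transpose_mat ?L * transpose_mat D = transpose_mat ?\<Psi> * transpose_mat (D * M)"
      using transpose_mult[OF car(2) id(1)] transpose_mult[OF car(5) id(3)] id(6) by simp
    show "transpose_mat (D * M) * transpose_mat E = transpose_mat ?\<Phi> * transpose_mat ?L"
      using transpose_mult[OF car(4,5)] transpose_mult[OF id(1,2)] id(5) by simp
    have "transpose_mat (E * D) + transpose_mat (?L * ?C) = 1\<^sub>m (k + m)"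
      using arg_cong[OF id(9), of transpose_mat] car id(1,4)
      by (simp add: transpose_add[of _ "k + m" "k + m"] comm_add_mat[of _ "k + m" "k + m"])
    then show "transpose_mat D * transpose_mat E + transpose_mat ?C * transpose_mat ?L = 1\<^sub>m (k + m)"
      using transpose_mult[OF car(4,2)] transpose_mult[OF id(1,4)] by simp
    show "transpose_mat E * transpose_mat D + 0\<^sub>m m n * transpose_mat (D * M) = 1\<^sub>m m"
      unfolding left_mult_zero_mat[OF car(5)[THEN t]] transpose_mult[OF car(2,4), symmetric] car(6)
      by simp
  qed auto
qed

section \<open>Pencils, reversals and degrees\<close>

interpretation const_poly_hom: inj_comm_ring_hom "\<lambda>a :: 'a :: comm_ring_1. [:a:]"
  by unfold_locales auto

abbreviation const_mat :: "'a::zero mat \<Rightarrow> 'a poly mat" where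
  "const_mat \<equiv> map_mat (\<lambda>a. [:a:])"

lemma mult_mat_entry:
  assumes "A \<in> carrier_mat r s" "B \<in> carrier_mat s c" "i < r" "j < c"
  shows "(A * B) $$ (i, j) = (\<Sum>t<s. A $$ (i, t) * B $$ (t, j))"
  using assms by (simp add: scalar_prod_def lessThan_atLeast0)

lemma mult_mat_vec_entry:
  assumes "A \<in> carrier_mat r s" "v \<in> carrier_vec s" "i < r"
  shows "(A *\<^sub>v v) $ i = (\<Sum>t<s. A $$ (i, t) * v $ t)"
  using assms by (simp add: scalar_prod_def lessThan_atLeast0)

lemma pencil_carrier [simp, intro]:
  "M1 \<in> carrier_mat r c \<Longrightarrow> M0 \<in> carrier_mat r c \<Longrightarrow> pencil M1 M0 \<in> carrier_mat r c"
  unfolding pencil_def by auto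

lemma dim_pencil [simp]:
  "dim_row (pencil M1 M0) = dim_row M0" "dim_col (pencil M1 M0) = dim_col M0"
  unfolding pencil_def by auto

lemma pencil_index:
  assumes "M1 \<in> carrier_mat r c" "M0 \<in> carrier_mat r c" "i < r" "j < c"
  shows "pencil M1 M0 $$ (i, j) = [:M0 $$ (i, j), M1 $$ (i, j):]"
  using assms unfolding pencil_def by (auto simp: monom_Suc monom_0)

lemma has_grade_pencil: "M1 \<in> carrier_mat r c \<Longrightarrow> M0 \<in> carrier_mat r c \<Longrightarrow> has_grade 1 (pencil M1 M0)"
  unfolding has_grade_def using pencil_index[of M1 r c M0] by auto

lemma pencil_coeff_mat:
  assumes "Q \<in> carrier_mat r c" "has_grade 1 Q"
  shows "Q = pencil (coeff_mat Q 1) (coeff_mat Q 0)"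
proof (rule eq_matI)
  have car: "coeff_mat Q i \<in> carrier_mat r c" for i using assms unfolding coeff_mat_def by simp
  show "dim_row Q = dim_row (pencil (coeff_mat Q 1) (coeff_mat Q 0))"
    "dim_col Q = dim_col (pencil (coeff_mat Q 1) (coeff_mat Q 0))" by (auto simp: coeff_mat_def)
  fix i j assume "i < dim_row (pencil (coeff_mat Q 1) (coeff_mat Q 0))"
    "j < dim_col (pencil (coeff_mat Q 1) (coeff_mat Q 0))"
  then have ij: "i < r" "j < c" using car[of 0] by auto
  have "degree (Q $$ (i, j)) \<le> 1" using assms ij unfolding has_grade_def by auto
  then have "Q $$ (i, j) = [:coeff (Q $$ (i, j)) 0, coeff (Q $$ (i, j)) 1:]"
    by (intro poly_eqI) (auto simp: coeff_pCons coeff_eq_0 split: nat.splits)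
  moreover have "pencil (coeff_mat Q 1) (coeff_mat Q 0) $$ (i, j) = [:coeff (Q $$ (i, j)) 0, coeff (Q $$ (i, j)) 1:]"
    unfolding pencil_index[OF car car ij] using ij assms(1) by (simp add: coeff_mat_def)
  ultimately show "Q $$ (i, j) = pencil (coeff_mat Q 1) (coeff_mat Q 0) $$ (i, j)" by simp
qed

lemma pencil_add:
  fixes A1 :: "'a::comm_monoid_add mat"
  assumes "A1 \<in> carrier_mat r c" "A0 \<in> carrier_mat r c" "B1 \<in> carrier_mat r c" "B0 \<in> carrier_mat r c"
  shows "pencil A1 A0 + pencil B1 B0 = pencil (A1 + B1) (A0 + B0)"
proof -
  have car: "A1 + B1 \<in> carrier_mat r c" "A0 + B0 \<in> carrier_mat r c" using assms by auto
  show ?thesis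
    by (rule eq_matI)
      (use assms in \<open>auto simp: pencil_index[OF assms(1,2)] pencil_index[OF assms(3,4)] pencil_index[OF car]\<close>)
qed

lemma sum_const_mult_pCons:
  "(\<Sum>t\<in>S. [:f t:] * [:g t, h t:]) = [:\<Sum>t\<in>S. f t * g t, \<Sum>t\<in>S. f t * (h t :: 'a::comm_ring_1):]"
  by (induction S rule: infinite_finite_induct) auto

lemma const_mat_mult_pencil:
  fixes A :: "'a::comm_ring_1 mat"
  assumes A: "A \<in> carrier_mat r s" and B: "B1 \<in> carrier_mat s c" "B0 \<in> carrier_mat s c"
  shows "const_mat A * pencil B1 B0 = pencil (A * B1) (A * B0)"
proof -
  have car: "A * B1 \<in> carrier_mat r c" "A * B0 \<in> carrier_mat r c" using A B by auto
  note p = pencil_carrier[OF B] pencil_carrier[OF car]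
  show ?thesis
  proof (rule eq_matI)
    fix i j assume "i < dim_row (pencil (A * B1) (A * B0))" "j < dim_col (pencil (A * B1) (A * B0))"
    then have ij: "i < r" "j < c" using p by auto
    have "(const_mat A * pencil B1 B0) $$ (i, j) = (\<Sum>t<s. const_mat A $$ (i, t) * pencil B1 B0 $$ (t, j))"
      by (rule mult_mat_entry) (use A p ij in auto)
    also have "\<dots> = (\<Sum>t<s. [:A $$ (i, t):] * [:B0 $$ (t, j), B1 $$ (t, j):])"
      by (rule sum.cong) (use A ij pencil_index[OF B] in auto)
    also have "\<dots> = pencil (A * B1) (A * B0) $$ (i, j)"
      unfolding sum_const_mult_pCons pencil_index[OF car ij]
      using A B ij by (simp add: scalar_prod_def lessThan_atLeast0)
    finally show "(const_mat A * pencil B1 B0) $$ (i, j) = pencil (A * B1) (A * B0) $$ (i, j)" .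
  qed (use A p in auto)
qed

lemma transpose_pencil:
  assumes B: "B1 \<in> carrier_mat s c" "B0 \<in> carrier_mat s c"
  shows "transpose_mat (pencil B1 B0) = pencil (transpose_mat B1) (transpose_mat B0)"
  unfolding pencil_def using B by (auto intro!: eq_matI)

lemma pencil_mult_const_mat:
  fixes A :: "'a::comm_ring_1 mat"
  assumes A: "A \<in> carrier_mat c s" and B: "B1 \<in> carrier_mat r c" "B0 \<in> carrier_mat r c"
  shows "pencil B1 B0 * const_mat A = pencil (B1 * A) (B0 * A)"
proof -
  have "transpose_mat (pencil B1 B0 * const_mat A) = const_mat (transpose_mat A) * transpose_mat (pencil B1 B0)"
    using transpose_mult[OF pencil_carrier[OF B], of "const_mat A" s] A
    by (simp add: map_mat_transpose)
  also have "\<dots> = transpose_mat (pencil (B1 * A) (B0 * A))"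
    using A B transpose_mult[OF B(1) A] transpose_mult[OF B(2) A]
    by (simp add: transpose_pencil[of _ r c] transpose_pencil[of _ r s]
        const_mat_mult_pencil[of _ s c _ r])
  finally show ?thesis by (metis transpose_transpose)
qed

section \<open>Reversal and grade\<close>

lemma rev_poly_pCons: "rev_poly 1 [:a, b:] = [:b, a :: 'a::comm_monoid_add:]"
  unfolding rev_poly_def by (simp add: atMost_Suc monom_Suc monom_0 coeff_pCons)

lemma rev_mat_pencil:
  fixes B1 :: "'a::comm_monoid_add mat"
  assumes B: "B1 \<in> carrier_mat r c" "B0 \<in> carrier_mat r c"
  shows "rev_mat 1 (pencil B1 B0) = pencil B0 B1"
  by (rule eq_matI)
    (use B in
      \<open>auto simp: rev_mat_def pencil_index[OF B] pencil_index[OF B(2,1)] rev_poly_pCons[unfolded One_nat_def]\<close>)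

lemma coeff_rev_poly: "coeff (rev_poly d p) i = (if i \<le> d then coeff p (d - i) else 0)"
proof -
  have "coeff (rev_poly d p) i = (\<Sum>j\<le>d. if j = d - i \<and> i \<le> d then coeff p j else 0)"
    unfolding rev_poly_def coeff_sum by (rule sum.cong) auto
  then show ?thesis by (auto simp: sum.delta')
qed

lemma rev_poly_sum: "rev_poly d (\<Sum>t\<in>S. f t) = (\<Sum>t\<in>S. rev_poly d (f t))"
  by (rule poly_eqI) (simp add: coeff_rev_poly coeff_sum)

text \<open>The monomial accounts for the gap between degree and grade. In this form the
  multiplicativity of \<open>reflect_poly\<close> carries over to reversals with respect to a
  grade.\<close>

lemma rev_poly_eq_reflect_poly:
  fixes p :: "'a::comm_ring_1 poly"
  assumes "degree p \<le> d"
  shows "rev_poly d p = monom 1 (d - degree p) * reflect_poly p"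
  by (rule poly_eqI)
    (use assms in \<open>auto simp: coeff_rev_poly coeff_monom_mult coeff_reflect_poly coeff_eq_0\<close>)

lemma rev_poly_mult:
  fixes p q :: "'a::idom poly"
  assumes "degree p \<le> a" "degree q \<le> b"
  shows "rev_poly (a + b) (p * q) = rev_poly a p * rev_poly b q"
proof (cases "p = 0 \<or> q = 0")
  case False
  then have "degree (p * q) = degree p + degree q" by (simp add: degree_mult_eq)
  moreover have "a + b - (degree p + degree q) = (a - degree p) + (b - degree q)" using assms by simp
  ultimately show ?thesis
    using assms mult_monom[of "1 :: 'a" "a - degree p" 1 "b - degree q"]
    by (simp add: rev_poly_eq_reflect_poly reflect_poly_mult ac_simps)
qed (auto simp: rev_poly_def)

lemma rev_mat_mult:
  fixes X Y :: "'a::idom poly mat"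
  assumes X: "X \<in> carrier_mat r s" "has_grade a X" and Y: "Y \<in> carrier_mat s c" "has_grade b Y"
  shows "rev_mat (a + b) (X * Y) = rev_mat a X * rev_mat b Y"
proof (rule eq_matI)
  fix i j assume "i < dim_row (rev_mat a X * rev_mat b Y)" "j < dim_col (rev_mat a X * rev_mat b Y)"
  then have ij: "i < r" "j < c" using X Y by (auto simp: rev_mat_def)
  then have "rev_mat (a + b) (X * Y) $$ (i, j) = (\<Sum>t<s. rev_poly (a + b) (X $$ (i, t) * Y $$ (t, j)))"
    using X Y by (simp add: rev_mat_def scalar_prod_def lessThan_atLeast0 rev_poly_sum)
  also have "\<dots> = (\<Sum>t<s. rev_poly a (X $$ (i, t)) * rev_poly b (Y $$ (t, j)))"
    by (intro sum.cong rev_poly_mult) (use X Y ij in \<open>auto simp: has_grade_def\<close>)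
  also have "\<dots> = (rev_mat a X * rev_mat b Y) $$ (i, j)"
    using X Y ij by (simp add: rev_mat_def scalar_prod_def lessThan_atLeast0)
  finally show "rev_mat (a + b) (X * Y) $$ (i, j) = (rev_mat a X * rev_mat b Y) $$ (i, j)" .
qed (use X Y in \<open>auto simp: rev_mat_def\<close>)

lemma has_grade_mult:
  fixes X Y :: "'a::comm_ring_1 poly mat"
  assumes X: "X \<in> carrier_mat r s" "has_grade a X" and Y: "Y \<in> carrier_mat s c" "has_grade b Y"
  shows "has_grade (a + b) (X * Y)"
  unfolding has_grade_def
proof (intro allI impI)
  fix i j assume "i < dim_row (X * Y)" "j < dim_col (X * Y)"
  then have ij: "i < r" "j < c" using X Y by auto
  have "degree (X $$ (i, t) * Y $$ (t, j)) \<le> a + b" if "t < s" for t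
  proof (rule order_trans[OF degree_mult_le add_mono])
    show "degree (X $$ (i, t)) \<le> a" "degree (Y $$ (t, j)) \<le> b"
      using X Y ij that unfolding has_grade_def by auto
  qed
  then show "degree ((X * Y) $$ (i, j)) \<le> a + b"
    using X Y ij by (auto simp: scalar_prod_def lessThan_atLeast0 intro!: degree_sum_le)
qed

lemma rev_mat_append_cols:
  fixes A B :: "'a::comm_monoid_add poly mat"
  assumes "A \<in> carrier_mat r a" "B \<in> carrier_mat r b"
  shows "rev_mat d (append_cols A B) = append_cols (rev_mat d A) (rev_mat d B)"
  unfolding rev_mat_def append_cols_def using assms by (auto intro!: eq_matI)

lemma has_grade_append_cols:
  assumes "A \<in> carrier_mat r a" "B \<in> carrier_mat r b" "has_grade d A" "has_grade d B"
  shows "has_grade d (append_cols A B)"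
  using assms unfolding has_grade_def append_cols_def by auto

section \<open>Degrees of polynomial vectors\<close>

lemma degree_le_vec_degree: "i < dim_vec v \<Longrightarrow> degree (v $ i) \<le> vec_degree v"
  unfolding vec_degree_def by (auto intro!: Max_ge)

lemma vec_degree_le: "(\<And>i. i < dim_vec v \<Longrightarrow> degree (v $ i) \<le> d) \<Longrightarrow> vec_degree v \<le> d"
  unfolding vec_degree_def by auto

lemma vec_degree_attained:
  assumes "v \<noteq> 0\<^sub>v (dim_vec v)"
  obtains i where "i < dim_vec v" "coeff (v $ i) (vec_degree v) \<noteq> 0"
proof -
  obtain j where j: "j < dim_vec v" "v $ j \<noteq> 0" using assms by (auto simp: vec_eq_iff)
  show thesis
  \<comment> \<open>Degree 0 may stem from the inserted default or from zero entries, so in that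
    case the witness has to be an entry known to be nonzero.\<close>
  proof (cases "vec_degree v = 0")
    case True
    then have "degree (v $ j) = 0" using degree_le_vec_degree[OF j(1)] by simp
    then show thesis using that[OF j(1)] j(2) True by (metis leading_coeff_neq_0)
  next
    case False
    have "vec_degree v \<in> insert 0 ((\<lambda>i. degree (v $ i)) ` {..<dim_vec v})"
      unfolding vec_degree_def by (rule Max_in) auto
    then obtain i where "i < dim_vec v" "vec_degree v = degree (v $ i)" using False by auto
    then show thesis using that[of i] False by (metis degree_0 leading_coeff_neq_0)
  qed
qed

text \<open>If \<open>y\<close> had degree \<open>e\<close> larger than that of \<open>x\<close>,
  the coefficient at \<open>e + 1\<close> in the equation would involve only \<open>F1\<close> and
  the leading coefficient of \<open>y\<close>. Injectivity of \<open>F1\<close> forbids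
  this.\<close>

lemma vec_degree_append_pencil:
  fixes M1 M0 F1 F0 :: "'a::comm_ring_1 mat"
  assumes M: "M1 \<in> carrier_mat r n" "M0 \<in> carrier_mat r n"
    and F: "F1 \<in> carrier_mat r k" "F0 \<in> carrier_mat r k"
    and inj: "\<And>v. v \<in> carrier_vec k \<Longrightarrow> F1 *\<^sub>v v = 0\<^sub>v r \<Longrightarrow> v = 0\<^sub>v k"
    and x: "x \<in> carrier_vec n" and y: "y \<in> carrier_vec k"
    and eq: "pencil M1 M0 *\<^sub>v x + pencil F1 F0 *\<^sub>v y = 0\<^sub>v r"
  shows "vec_degree (x @\<^sub>v y) = vec_degree x"
proof -
  have le: "vec_degree y \<le> vec_degree x"
  proof (rule ccontr)
    assume less: "\<not> vec_degree y \<le> vec_degree x"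
    define e where "e = vec_degree y"
    have "y \<noteq> 0\<^sub>v (dim_vec y)"
    proof
      assume "y = 0\<^sub>v (dim_vec y)"
      then have "vec_degree y \<le> 0" by (intro vec_degree_le) (metis degree_0 index_zero_vec(1) order_refl)
      then show False using less by simp
    qed
    then obtain j where j: "j < k" "coeff (y $ j) e \<noteq> 0"
      using y unfolding e_def by (metis vec_degree_attained carrier_vecD)
    \<comment> \<open>The leading coefficient vector of \<open>y\<close>, nonzero at
      \<open>j\<close>, which will turn out to lie in the kernel of \<open>F1\<close>.\<close>
    define v where "v = vec k (\<lambda>j. coeff (y $ j) e)"
    have "F1 *\<^sub>v v = 0\<^sub>v r"
    proof (rule eq_vecI)
      fix p assume "p < dim_vec (0\<^sub>v r)"
      then have p: "p < r" by simp
      have xc: "coeff (x $ t) e = 0" "coeff (x $ t) (Suc e) = 0" if "t < n" for t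
        using degree_le_vec_degree[of t x] that x less unfolding e_def by (auto intro!: coeff_eq_0)
      have yc: "coeff (y $ t) (Suc e) = 0" if "t < k" for t
        using degree_le_vec_degree[of t y] that y unfolding e_def by (auto intro!: coeff_eq_0)
      have "(pencil M1 M0 *\<^sub>v x + pencil F1 F0 *\<^sub>v y) $ p =
          (\<Sum>t<n. [:M0 $$ (p, t), M1 $$ (p, t):] * x $ t) + (\<Sum>t<k. [:F0 $$ (p, t), F1 $$ (p, t):] * y $ t)"
        using p F mult_mat_vec_entry[OF pencil_carrier[OF M] x p] mult_mat_vec_entry[OF pencil_carrier[OF F] y p]
        by (simp add: pencil_index[OF M p] pencil_index[OF F p] del: mult_pCons_left)
      then have "coeff ((\<Sum>t<n. [:M0 $$ (p, t), M1 $$ (p, t):] * x $ t)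
          + (\<Sum>t<k. [:F0 $$ (p, t), F1 $$ (p, t):] * y $ t)) (Suc e) = 0"
        using eq p by simp
      then have "(\<Sum>t<k. F1 $$ (p, t) * coeff (y $ t) e) = 0"
        by (simp add: coeff_sum xc yc)
      then show "(F1 *\<^sub>v v) $ p = 0\<^sub>v r $ p"
        using F p by (simp add: scalar_prod_def lessThan_atLeast0 v_def)
    qed (use F in auto)
    then have "v = 0\<^sub>v k" by (intro inj) (auto simp: v_def)
    then show False using j unfolding v_def by (metis index_vec index_zero_vec(1))
  qed
  show ?thesis
  proof (rule antisym)
    show "vec_degree (x @\<^sub>v y) \<le> vec_degree x"
    proof (rule vec_degree_le)
      fix i assume "i < dim_vec (x @\<^sub>v y)"
      then have "\<not> i < dim_vec x \<Longrightarrow> degree (y $ (i - dim_vec x)) \<le> vec_degree y"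
        by (intro degree_le_vec_degree) auto
      then show "degree ((x @\<^sub>v y) $ i) \<le> vec_degree x"
        using \<open>i < _\<close> le degree_le_vec_degree[of i x] by auto
    qed
    show "vec_degree x \<le> vec_degree (x @\<^sub>v y)"
      using degree_le_vec_degree[of _ "x @\<^sub>v y"]
      by (intro vec_degree_le) (metis index_append_vec trans_less_add1)
  qed
qed

lemma coeff_mult_bounded_degree:
  fixes p q :: "'a::comm_ring_1 poly"
  assumes "degree p \<le> a" "degree q \<le> b"
  shows "coeff (p * q) (a + b) = coeff p a * coeff q b"
proof -
  have "coeff (p * q) (a + b) = (\<Sum>i\<le>a + b. if i = a then coeff p a * coeff q b else 0)"
    unfolding coeff_mult
  proof (rule sum.cong[OF refl])
    fix i assume i: "i \<in> {..a + b}"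
    consider "i < a" | "i = a" | "i > a" by linarith
    then show "coeff p i * coeff q (a + b - i) = (if i = a then coeff p a * coeff q b else 0)"
      using assms i coeff_eq_0[of p i] coeff_eq_0[of q "a + b - i"] by cases auto
  qed
  then show ?thesis by simp
qed

text \<open>The predictable degree property of a row reduced matrix whose rows all have degree
  \<open>\<eta>\<close>: the leading coefficients of \<open>D\<close> have full row rank and so
  cannot annihilate the leading coefficient of \<open>z\<close>.\<close>

lemma vec_degree_transpose_mult:
  fixes D :: "'a::comm_ring_1 poly mat"
  assumes D: "D \<in> carrier_mat m N" "has_grade \<eta> D"
    and inj: "\<And>v. v \<in> carrier_vec m \<Longrightarrow> transpose_mat (coeff_mat D \<eta>) *\<^sub>v v = 0\<^sub>v N \<Longrightarrow> v = 0\<^sub>v m"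
    and z: "z \<in> carrier_vec m" "z \<noteq> 0\<^sub>v m"
  shows "vec_degree (transpose_mat D *\<^sub>v z) = vec_degree z + \<eta>"
proof (rule antisym)
  define e where "e = vec_degree z"
  have Dd: "degree (D $$ (r, q)) \<le> \<eta>" if "r < m" "q < N" for r q
    using D that unfolding has_grade_def by auto
  have zd: "degree (z $ r) \<le> e" if "r < m" for r
    using degree_le_vec_degree[of r z] z that unfolding e_def by auto
  have idx: "(transpose_mat D *\<^sub>v z) $ q = (\<Sum>r<m. D $$ (r, q) * z $ r)" if "q < N" for q
    using D z that by (auto simp: scalar_prod_def lessThan_atLeast0)
  show "vec_degree (transpose_mat D *\<^sub>v z) \<le> vec_degree z + \<eta>"
  proof (rule vec_degree_le)
    fix q assume "q < dim_vec (transpose_mat D *\<^sub>v z)"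
    then have q: "q < N" using D by simp
    have "degree (D $$ (r, q) * z $ r) \<le> e + \<eta>" if "r < m" for r
      using degree_mult_le[of "D $$ (r, q)" "z $ r"] Dd[OF that q] zd[OF that] by linarith
    then show "degree ((transpose_mat D *\<^sub>v z) $ q) \<le> vec_degree z + \<eta>"
      unfolding idx[OF q] e_def[symmetric] by (intro degree_sum_le) auto
  qed
  obtain r where r: "r < m" "coeff (z $ r) e \<noteq> 0"
    using vec_degree_attained[of z] z unfolding e_def by auto
  define v where "v = vec m (\<lambda>r. coeff (z $ r) e)"
  have "v \<noteq> 0\<^sub>v m" using r unfolding v_def by (metis index_vec index_zero_vec(1))
  then have "transpose_mat (coeff_mat D \<eta>) *\<^sub>v v \<noteq> 0\<^sub>v N" using inj[of v] by (auto simp: v_def)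
  then obtain q where q: "q < N" "(transpose_mat (coeff_mat D \<eta>) *\<^sub>v v) $ q \<noteq> 0"
    using D by (auto simp: vec_eq_iff coeff_mat_def)
  have "coeff ((transpose_mat D *\<^sub>v z) $ q) (\<eta> + e) = (\<Sum>r<m. coeff (D $$ (r, q)) \<eta> * coeff (z $ r) e)"
    unfolding idx[OF q(1)] coeff_sum
    by (intro sum.cong coeff_mult_bounded_degree) (use Dd zd q in auto)
  also have "\<dots> = (transpose_mat (coeff_mat D \<eta>) *\<^sub>v v) $ q"
    using D q by (simp add: scalar_prod_def lessThan_atLeast0 v_def coeff_mat_def)
  finally have "\<eta> + e \<le> degree ((transpose_mat D *\<^sub>v z) $ q)"
    using q by (intro le_degree) simp
  also have "\<dots> \<le> vec_degree (transpose_mat D *\<^sub>v z)"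
    by (rule degree_le_vec_degree) (use D q in simp)
  finally show "vec_degree z + \<eta> \<le> vec_degree (transpose_mat D *\<^sub>v z)" unfolding e_def by simp
qed

section \<open>The unperturbed Kronecker blocks\<close>

text \<open>Covers the Kronecker block, its reversal and the constant coefficients of both, with
  \<open>k\<close> standing for \<open>\<eta> * m\<close>. Blocks of size \<open>m\<close> are
  encoded by an index offset \<open>m\<close>, which spares a second level of indices.\<close>

definition bidiag :: "nat \<Rightarrow> nat \<Rightarrow> 'a::comm_ring_1 \<Rightarrow> 'a \<Rightarrow> 'a mat" where
  "bidiag k m a b = mat (k + m) k (\<lambda>(p, q). (if p = q then - a else 0) + (if p = q + m then b else 0))"

lemma bidiag_carrier [simp]: "bidiag k m a b \<in> carrier_mat (k + m) k"
  by (simp add: bidiag_def)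

lemma dim_bidiag [simp]: "dim_row (bidiag k m a b) = k + m" "dim_col (bidiag k m a b) = k"
  by (simp_all add: bidiag_def)

lemma pencil_bidiag:
  shows "pencil (bidiag k m 0 1) (bidiag k m 1 0) = (bidiag k m 1 [:0, 1:] :: 'a::comm_ring_1 poly mat)" (is ?th1)
    and "pencil (bidiag k m 1 0) (bidiag k m 0 1) = (bidiag k m [:0, 1:] 1 :: 'a::comm_ring_1 poly mat)" (is ?th2)
proof -
  have e: "bidiag k m a b $$ (p, q) = (if p = q then - a else 0) + (if p = q + m then b else 0)"
    if "p < k + m" "q < k" for p q and a b :: "'b::comm_ring_1"
    using that by (simp add: bidiag_def)
  note idx = pencil_index[OF bidiag_carrier bidiag_carrier]
  show ?th1
  proof (rule eq_matI)
    fix p q assume "p < dim_row (bidiag k m 1 [:0, 1:] :: 'a poly mat)" "q < dim_col (bidiag k m 1 [:0, 1:] :: 'a poly mat)"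
    then have pq: "p < k + m" "q < k" by simp_all
    show "pencil (bidiag k m 0 1) (bidiag k m 1 0) $$ (p, q) = (bidiag k m 1 [:0, 1:] :: 'a poly mat) $$ (p, q)"
      unfolding idx[OF pq] e[OF pq] by (auto intro!: poly_eqI simp: coeff_pCons split: nat.splits)
  qed simp_all
  show ?th2
  proof (rule eq_matI)
    fix p q assume "p < dim_row (bidiag k m [:0, 1:] 1 :: 'a poly mat)" "q < dim_col (bidiag k m [:0, 1:] 1 :: 'a poly mat)"
    then have pq: "p < k + m" "q < k" by simp_all
    show "pencil (bidiag k m 1 0) (bidiag k m 0 1) $$ (p, q) = (bidiag k m [:0, 1:] 1 :: 'a poly mat) $$ (p, q)"
      unfolding idx[OF pq] e[OF pq] by (auto intro!: poly_eqI simp: coeff_pCons split: nat.splits)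
  qed simp_all
qed

lemma mult_bidiag:
  assumes X: "X \<in> carrier_mat r (k + m)" and i: "i < r" "q < k"
  shows "(X * bidiag k m a b) $$ (i, q) = X $$ (i, q + m) * b - X $$ (i, q) * a"
proof -
  have "(X * bidiag k m a b) $$ (i, q) = (\<Sum>p<k + m. X $$ (i, p) * bidiag k m a b $$ (p, q))"
    by (rule mult_mat_entry[OF X _ i]) simp
  also have "\<dots> = (\<Sum>p<k + m. (if p = q then - X $$ (i, p) * a else 0) + (if p = q + m then X $$ (i, p) * b else 0))"
    by (rule sum.cong) (use i in \<open>auto simp: bidiag_def algebra_simps\<close>)
  also have "\<dots> = X $$ (i, q + m) * b - X $$ (i, q) * a"
    unfolding sum.distrib using i by (simp add: sum.delta)
  finally show ?thesis .
qed

lemma bidiag_mult: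
  assumes Y: "Y \<in> carrier_mat k c" and p: "p < k + m" "j < c"
  shows "(bidiag k m a b * Y) $$ (p, j) =
    (if m \<le> p then b * Y $$ (p - m, j) else 0) - (if p < k then a * Y $$ (p, j) else 0)"
proof -
  have "(bidiag k m a b * Y) $$ (p, j) = (\<Sum>q<k. bidiag k m a b $$ (p, q) * Y $$ (q, j))"
    by (rule mult_mat_entry[OF _ Y p]) simp
  also have "\<dots> = (\<Sum>q<k. (if q = p then - a * Y $$ (q, j) else 0)
      + (if q = p - m then (if m \<le> p then b * Y $$ (q, j) else 0) else 0))"
    by (rule sum.cong) (use p in \<open>auto simp: bidiag_def algebra_simps\<close>)
  also have "\<dots> = (if m \<le> p then b * Y $$ (p - m, j) else 0) - (if p < k then a * Y $$ (p, j) else 0)"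
    unfolding sum.distrib using p by (auto simp: sum.delta)
  finally show ?thesis .
qed

text \<open>The entries of the inverse of the lower bidiagonal Toeplitz matrix with blocks
  \<open>I\<close> and \<open>-\<lambda>I\<close>, of block size \<open>m\<close>.\<close>

definition shift_power :: "nat \<Rightarrow> nat \<Rightarrow> nat \<Rightarrow> 'a::comm_ring_1 poly" where
  "shift_power m p q = (if q \<le> p \<and> m dvd (p - q) then monom 1 ((p - q) div m) else 0)"

lemma dvd_diff_iff_mod_eq:
  fixes p q m :: nat
  assumes "q \<le> p"
  shows "m dvd (p - q) \<longleftrightarrow> p mod m = q mod m"
  using assms by (metis mod_eq_dvd_iff_nat)

lemma shift_power_step_col:
  assumes "m > 0"
  shows "shift_power m p q - shift_power m p (q + m) * [:0, 1:] = (if p = q then 1 else 0)"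
proof -
  consider "p < q" | "p = q" | "q < p" "\<not> m dvd (p - q)" | "q < p" "m dvd (p - q)" by linarith
  then show ?thesis
  proof cases
    case 3
    then have "\<not> m dvd (p - (q + m))" if "q + m \<le> p"
      using dvd_diff_iff_mod_eq[OF that, of m] dvd_diff_iff_mod_eq[of q p m] 3 by simp
    then show ?thesis using 3 by (auto simp: shift_power_def)
  next
    case 4
    then obtain t where t: "p - q = m * t" by (auto elim: dvdE)
    then obtain t' where t': "t = Suc t'" using 4 by (cases t) auto
    have "p = q + m * t" using t 4 by simp
    then have p: "p = q + m + m * t'" using t' by simp
    show ?thesis using assms unfolding p by (simp add: shift_power_def monom_Suc)
  qed (use assms in \<open>auto simp: shift_power_def\<close>)
qed

lemma shift_power_add: "shift_power m (p + m) (q + m) = shift_power m p q"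
  by (simp add: shift_power_def)

lemma shift_power_small: "p < q \<Longrightarrow> shift_power m p q = 0"
  by (simp add: shift_power_def)

text \<open>By the Toeplitz structure, lowering the row by \<open>m\<close> is the same as raising
  the column by \<open>m\<close>. In the first block row the vanishing above the diagonal provides
  the default 0.\<close>

lemma shift_power_step_row:
  assumes "m > 0"
  shows "shift_power m p q - (if m \<le> p then [:0, 1:] * shift_power m (p - m) q else 0) =
    (if p = q then 1 else 0 :: 'a::comm_ring_1 poly)"
proof (cases "m \<le> p")
  case True
  then have "shift_power m (p - m) q = (shift_power m p (q + m) :: 'a poly)"
    using shift_power_add[of m "p - m" q, where 'a = 'a] by simp
  then show ?thesis using shift_power_step_col[OF assms, of p q, where 'a = 'a] True by (simp add: mult.commute)
next
  case False
  then have "shift_power m p (q + m) = (0 :: 'a poly)" by (intro shift_power_small) simp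
  then show ?thesis using shift_power_step_col[OF assms, of p q, where 'a = 'a] False by simp
qed

text \<open>The last block row of the inverse is the dual basis: block column \<open>q div m\<close>
  carries the power \<open>\<eta> - q div m\<close>.\<close>

lemma shift_power_last:
  assumes "r < m" "q < \<eta> * m + m"
  shows "shift_power m (\<eta> * m + r) q = (if r = q mod m then monom 1 (\<eta> - q div m) else 0)"
proof -
  have qd: "q div m \<le> \<eta>"
    using assms by (metis add.commute less_Suc_eq_le less_mult_imp_div_less mult_Suc)
  show ?thesis
  proof (cases "r = q mod m")
    case True
    have q: "q = q div m * m + r" using True by simp
    have le: "q div m * m \<le> \<eta> * m" using qd by simp
    have "\<eta> * m + r - q = (\<eta> - q div m) * m"
      using q le by (metis diff_diff_left diff_mult_distrib add.commute add_diff_cancel_right)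
    moreover have "q \<le> \<eta> * m + r" using q le by linarith
    ultimately show ?thesis using True assms by (simp add: shift_power_def)
  next
    case False
    then have "\<not> m dvd (\<eta> * m + r - q)" if "q \<le> \<eta> * m + r"
      using dvd_diff_iff_mod_eq[OF that] assms by auto
    then show ?thesis using False by (auto simp: shift_power_def)
  qed
qed

lemma shift_power_first:
  assumes "r < m"
  shows "shift_power m q r = (if r = q mod m then monom 1 (q div m) else 0)"
proof (cases "r = q mod m")
  case True
  have "q - r = q div m * m" using True by (simp add: minus_mod_eq_div_mult)
  then show ?thesis using True assms by (auto simp: shift_power_def)
next
  case False
  then show ?thesis using dvd_diff_iff_mod_eq[of r q m] assms by (auto simp: shift_power_def)
qed

text \<open>Let T be the block bidiagonal matrix with blocks I and -\<lambda>I. Appending the last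
  \<open>m\<close> unit columns to \<open>K\<close> yields -T with its last \<open>m\<close> columns
  negated. Its inverse is the inverse of T with all but the last \<open>m\<close> rows negated,
  whence the signs of \<open>?U\<close> and \<open>?D\<close>.\<close>

lemma dual_frame_bidiag:
  fixes k m :: nat
  assumes m: "m > 0"
  shows "dual_frame k m (mat k (k + m) (\<lambda>(p, q). - shift_power m p q))
     (mat m (k + m) (\<lambda>(r, q). shift_power m (k + r) q))
     (bidiag k m 1 [:0, 1:] :: 'a::comm_ring_1 poly mat)
     (mat (k + m) m (\<lambda>(p, c). if p = k + c then 1 else 0))" (is "dual_frame k m ?U ?D ?K ?E")
proof -
  have car: "?U \<in> carrier_mat k (k + m)" "?D \<in> carrier_mat m (k + m)" "?E \<in> carrier_mat (k + m) m" by auto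
  have XE: "(X * ?E) $$ (i, c) = X $$ (i, k + c)"
    if "X \<in> carrier_mat r (k + m)" "i < r" "c < m" for X :: "'a poly mat" and r i c
    using that by (subst mult_mat_entry[of _ r "k + m" _ m]) (auto simp: if_distrib cong: if_cong)
  have EY: "(?E * Y) $$ (p, c) = (if k \<le> p then Y $$ (p - k, c) else 0)"
    if "Y \<in> carrier_mat m r" "p < k + m" "c < r" for Y :: "'a poly mat" and r p c
  proof -
    have "(?E * Y) $$ (p, c) = (\<Sum>t<m. if t = p - k then (if k \<le> p then Y $$ (t, c) else 0) else 0)"
      unfolding mult_mat_entry[OF car(3) that] by (rule sum.cong) (use that in auto)
    then show ?thesis using that by auto
  qed
  have "?U * ?K = 1\<^sub>m k"
  proof (rule eq_matI)
    fix p q assume "p < dim_row (1\<^sub>m k :: 'a poly mat)" "q < dim_col (1\<^sub>m k :: 'a poly mat)"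
    then have pq: "p < k" "q < k" by auto
    have "(?U * ?K) $$ (p, q) = ?U $$ (p, q + m) * [:0, 1:] - ?U $$ (p, q) * 1"
      by (rule mult_bidiag[OF car(1) pq])
    also have "\<dots> = shift_power m p q - shift_power m p (q + m) * [:0, 1:]"
      using pq by simp
    also have "\<dots> = 1\<^sub>m k $$ (p, q)"
      unfolding shift_power_step_col[OF m] using pq by simp
    finally show "(?U * ?K) $$ (p, q) = 1\<^sub>m k $$ (p, q)" .
  qed auto
  moreover have "?U * ?E = 0\<^sub>m k m"
  proof (rule eq_matI)
    fix p c assume "p < dim_row (0\<^sub>m k m :: 'a poly mat)" "c < dim_col (0\<^sub>m k m :: 'a poly mat)"
    then have pc: "p < k" "c < m" by auto
    show "(?U * ?E) $$ (p, c) = 0\<^sub>m k m $$ (p, c)"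
      unfolding XE[OF car(1) pc] using pc by (simp add: shift_power_small)
  qed auto
  moreover have "?D * ?K = 0\<^sub>m m k"
  proof (rule eq_matI)
    fix r q assume "r < dim_row (0\<^sub>m m k :: 'a poly mat)" "q < dim_col (0\<^sub>m m k :: 'a poly mat)"
    then have rq: "r < m" "q < k" by auto
    have "(?D * ?K) $$ (r, q) = ?D $$ (r, q + m) * [:0, 1:] - ?D $$ (r, q) * 1"
      by (rule mult_bidiag[OF car(2) rq])
    also have "\<dots> = - (shift_power m (k + r) q - shift_power m (k + r) (q + m) * [:0, 1:])"
      using rq by simp
    also have "\<dots> = 0"
      unfolding shift_power_step_col[OF m] using rq by simp
    finally show "(?D * ?K) $$ (r, q) = 0\<^sub>m m k $$ (r, q)" using rq by simp
  qed auto
  moreover have "?D * ?E = 1\<^sub>m m"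
  proof (rule eq_matI)
    fix r c assume "r < dim_row (1\<^sub>m m :: 'a poly mat)" "c < dim_col (1\<^sub>m m :: 'a poly mat)"
    then have rc: "r < m" "c < m" by auto
    then have "m dvd (r - c) \<longleftrightarrow> r \<le> c" "m dvd (c - r) \<longleftrightarrow> c \<le> r"
      by (auto dest: dvd_imp_le)
    then show "(?D * ?E) $$ (r, c) = 1\<^sub>m m $$ (r, c)"
      unfolding XE[OF car(2) rc] using rc by (auto simp: shift_power_def)
  qed auto
  moreover have "?K * ?U + ?E * ?D = 1\<^sub>m (k + m)"
  proof (rule eq_matI)
    fix p q assume "p < dim_row (1\<^sub>m (k + m) :: 'a poly mat)" "q < dim_col (1\<^sub>m (k + m) :: 'a poly mat)"
    then have pq: "p < k + m" "q < k + m" by auto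
    have "(?K * ?U + ?E * ?D) $$ (p, q) = (?K * ?U) $$ (p, q) + (?E * ?D) $$ (p, q)"
      using pq by (intro index_add_mat(1)) auto
    also have "\<dots> = shift_power m p q - (if m \<le> p then [:0, 1:] * shift_power m (p - m) q else 0)"
      unfolding bidiag_mult[OF car(1) pq] EY[OF car(2) pq] using pq by auto
    also have "\<dots> = 1\<^sub>m (k + m) $$ (p, q)"
      unfolding shift_power_step_row[OF m] using pq by simp
    finally show "(?K * ?U + ?E * ?D) $$ (p, q) = 1\<^sub>m (k + m) $$ (p, q)" .
  qed auto
  ultimately show ?thesis unfolding dual_frame_def by simp
qed

text \<open>For the reversed block the first \<open>m\<close> unit columns are the right completion:
  put in front of \<open>K\<close>, they give the transpose of the matrix inverted by
  \<open>shift_power\<close>. Hence the exchanged arguments, with \<open>?D\<close> taken from the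
  first \<open>m\<close> rows and \<open>?U\<close> from the rest.\<close>

lemma dual_frame_bidiag_rev:
  fixes k m :: nat
  assumes m: "m > 0"
  shows "dual_frame k m (mat k (k + m) (\<lambda>(p, q). shift_power m q (p + m)))
     (mat m (k + m) (\<lambda>(r, q). shift_power m q r))
     (bidiag k m [:0, 1:] 1 :: 'a::comm_ring_1 poly mat)
     (mat (k + m) m (\<lambda>(p, c). if p = c then 1 else 0))" (is "dual_frame k m ?U ?D ?K ?E")
proof -
  have car: "?U \<in> carrier_mat k (k + m)" "?D \<in> carrier_mat m (k + m)" "?E \<in> carrier_mat (k + m) m" by auto
  have XE: "(X * ?E) $$ (i, c) = X $$ (i, c)"
    if "X \<in> carrier_mat r (k + m)" "i < r" "c < m" for X :: "'a poly mat" and r i c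
    using that by (subst mult_mat_entry[of _ r "k + m" _ m]) (auto simp: if_distrib cong: if_cong)
  have EY: "(?E * Y) $$ (p, c) = (if p < m then Y $$ (p, c) else 0)"
    if "Y \<in> carrier_mat m r" "p < k + m" "c < r" for Y :: "'a poly mat" and r p c
  proof -
    have "(?E * Y) $$ (p, c) = (\<Sum>t<m. if t = p then Y $$ (t, c) else 0)"
      unfolding mult_mat_entry[OF car(3) that] by (rule sum.cong) (use that in auto)
    then show ?thesis using that by auto
  qed
  have "?U * ?K = 1\<^sub>m k"
  proof (rule eq_matI)
    fix p q assume "p < dim_row (1\<^sub>m k :: 'a poly mat)" "q < dim_col (1\<^sub>m k :: 'a poly mat)"
    then have pq: "p < k" "q < k" by auto
    have "(?U * ?K) $$ (p, q) = ?U $$ (p, q + m) * 1 - ?U $$ (p, q) * [:0, 1:]"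
      by (rule mult_bidiag[OF car(1) pq])
    also have "\<dots> = shift_power m q p - shift_power m q (p + m) * [:0, 1:]"
      using pq by (simp add: shift_power_add)
    also have "\<dots> = 1\<^sub>m k $$ (p, q)"
      unfolding shift_power_step_col[OF m] using pq by simp
    finally show "(?U * ?K) $$ (p, q) = 1\<^sub>m k $$ (p, q)" .
  qed auto
  moreover have "?U * ?E = 0\<^sub>m k m"
  proof (rule eq_matI)
    fix p c assume "p < dim_row (0\<^sub>m k m :: 'a poly mat)" "c < dim_col (0\<^sub>m k m :: 'a poly mat)"
    then have pc: "p < k" "c < m" by auto
    show "(?U * ?E) $$ (p, c) = 0\<^sub>m k m $$ (p, c)"
      unfolding XE[OF car(1) pc] using pc by (simp add: shift_power_small)
  qed auto
  moreover have "?D * ?K = 0\<^sub>m m k"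
  proof (rule eq_matI)
    fix r q assume "r < dim_row (0\<^sub>m m k :: 'a poly mat)" "q < dim_col (0\<^sub>m m k :: 'a poly mat)"
    then have rq: "r < m" "q < k" by auto
    have "(?D * ?K) $$ (r, q) = ?D $$ (r, q + m) * 1 - ?D $$ (r, q) * [:0, 1:]"
      by (rule mult_bidiag[OF car(2) rq])
    also have "\<dots> = shift_power m (q + m) r - (if m \<le> q + m then [:0, 1:] * shift_power m (q + m - m) r else 0)"
      using rq by (simp add: mult.commute)
    also have "\<dots> = 0"
      unfolding shift_power_step_row[OF m] using rq by simp
    finally show "(?D * ?K) $$ (r, q) = 0\<^sub>m m k $$ (r, q)" using rq by simp
  qed auto
  moreover have "?D * ?E = 1\<^sub>m m"
  proof (rule eq_matI)
    fix r c assume "r < dim_row (1\<^sub>m m :: 'a poly mat)" "c < dim_col (1\<^sub>m m :: 'a poly mat)"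
    then have rc: "r < m" "c < m" by auto
    then have "m dvd (r - c) \<longleftrightarrow> r \<le> c" "m dvd (c - r) \<longleftrightarrow> c \<le> r"
      by (auto dest: dvd_imp_le)
    then show "(?D * ?E) $$ (r, c) = 1\<^sub>m m $$ (r, c)"
      unfolding XE[OF car(2) rc] using rc by (auto simp: shift_power_def)
  qed auto
  moreover have "?K * ?U + ?E * ?D = 1\<^sub>m (k + m)"
  proof (rule eq_matI)
    fix p q assume "p < dim_row (1\<^sub>m (k + m) :: 'a poly mat)" "q < dim_col (1\<^sub>m (k + m) :: 'a poly mat)"
    then have pq: "p < k + m" "q < k + m" by auto
    have "(?K * ?U + ?E * ?D) $$ (p, q) = (?K * ?U) $$ (p, q) + (?E * ?D) $$ (p, q)"
      using pq by (intro index_add_mat(1)) auto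
    also have "\<dots> = shift_power m q p - shift_power m q (p + m) * [:0, 1:]"
      unfolding bidiag_mult[OF car(1) pq] EY[OF car(2) pq]
      using pq shift_power_small[of q "p + m" m] by (auto simp: mult.commute)
    also have "\<dots> = 1\<^sub>m (k + m) $$ (p, q)"
      unfolding shift_power_step_col[OF m] using pq by simp
    finally show "(?K * ?U + ?E * ?D) $$ (p, q) = 1\<^sub>m (k + m) $$ (p, q)" .
  qed auto
  ultimately show ?thesis unfolding dual_frame_def by simp
qed

section \<open>Identification with the Kronecker products\<close>

lemma kronecker_L_pencil:
  "kronecker (transpose_mat (L_pencil \<eta>)) (1\<^sub>m m) = (bidiag (\<eta> * m) m 1 [:0, 1:] :: 'a::comm_ring_1 poly mat)"
proof (rule eq_matI)
  fix p q
  assume "p < dim_row (bidiag (\<eta> * m) m 1 [:0, 1:] :: 'a poly mat)"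
    "q < dim_col (bidiag (\<eta> * m) m 1 [:0, 1:] :: 'a poly mat)"
  then have pq: "p < (\<eta> + 1) * m" "q < \<eta> * m" by auto
  then have m: "m > 0" by (cases m) auto
  have d: "p div m < \<eta> + 1" "q div m < \<eta>"
    using pq by (auto intro!: less_mult_imp_div_less)
  have e: "p = q \<longleftrightarrow> p div m = q div m \<and> p mod m = q mod m"
    by (metis div_mult_mod_eq)
  have e': "p = q + m \<longleftrightarrow> p div m = q div m + 1 \<and> p mod m = q mod m"
  proof
    assume "p div m = q div m + 1 \<and> p mod m = q mod m"
    then show "p = q + m" using div_mult_mod_eq[of p m] div_mult_mod_eq[of q m] by (simp add: algebra_simps)
  qed (use m in auto)
  have "kronecker (transpose_mat (L_pencil \<eta>)) (1\<^sub>m m) $$ (p, q) =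
      (if p div m = q div m then - 1 else if p div m = q div m + 1 then [:0, 1:] else 0 :: 'a poly) *
      (if p mod m = q mod m then 1 else 0)"
    using pq d m by (auto simp: kronecker_def L_pencil_def monom_Suc monom_0)
  also have "\<dots> = bidiag (\<eta> * m) m 1 [:0, 1:] $$ (p, q)"
    using pq m by (auto simp: bidiag_def e e')
  finally show "kronecker (transpose_mat (L_pencil \<eta>)) (1\<^sub>m m) $$ (p, q) =
      (bidiag (\<eta> * m) m 1 [:0, 1:] :: 'a poly mat) $$ (p, q)" .
qed (auto simp: kronecker_def L_pencil_def)

lemma kronecker_Lambda_col:
  "kronecker (transpose_mat (Lambda_col \<eta>)) (1\<^sub>m m) =
     (mat m (\<eta> * m + m) (\<lambda>(r, q). shift_power m (\<eta> * m + r) q) :: 'a::comm_ring_1 poly mat)"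
proof (rule eq_matI)
  fix r q
  assume "r < dim_row (mat m (\<eta> * m + m) (\<lambda>(r, q). shift_power m (\<eta> * m + r) q) :: 'a poly mat)"
    "q < dim_col (mat m (\<eta> * m + m) (\<lambda>(r, q). shift_power m (\<eta> * m + r) q) :: 'a poly mat)"
  then have rq: "r < m" "q < \<eta> * m + m" by auto
  have d: "q div m < \<eta> + 1"
    using rq by (intro less_mult_imp_div_less) simp
  show "kronecker (transpose_mat (Lambda_col \<eta>)) (1\<^sub>m m) $$ (r, q) =
      (mat m (\<eta> * m + m) (\<lambda>(r, q). shift_power m (\<eta> * m + r) q) :: 'a poly mat) $$ (r, q)"
    using rq d by (auto simp: kronecker_def Lambda_col_def shift_power_last)
qed (auto simp: kronecker_def Lambda_col_def)

text \<open>The dual basis reversed at grade \<open>\<eta>\<close> is dual to the reversed block.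
  This links the two frames, as needed for a strong linearization.\<close>

lemma rev_shift_power:
  assumes "r < m" "q < \<eta> * m + m"
  shows "rev_poly \<eta> (shift_power m (\<eta> * m + r) q) = (shift_power m q r :: 'a::comm_ring_1 poly)"
proof -
  have "q div m \<le> \<eta>"
    using assms by (metis add.commute less_Suc_eq_le less_mult_imp_div_less mult_Suc)
  then have "rev_poly \<eta> (monom 1 (\<eta> - q div m)) = (monom 1 (q div m) :: 'a poly)"
    by (intro poly_eqI) (auto simp: coeff_rev_poly)
  moreover have "rev_poly \<eta> 0 = (0 :: 'a poly)" by (simp add: rev_poly_def)
  ultimately show ?thesis
    using assms by (simp add: shift_power_last shift_power_first)
qed

lemma has_grade_shift_power:
  "has_grade \<eta> (mat m (\<eta> * m + m) (\<lambda>(r, q). shift_power m (\<eta> * m + r) q) :: 'a::comm_ring_1 poly mat)"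
  unfolding has_grade_def by (auto simp: shift_power_last degree_monom_eq)

text \<open>Only the first block reaches the power \<open>\<eta>\<close>, so the leading coefficient
  is \<open>[1 0]\<close>, visibly of full row rank.\<close>

lemma coeff_mat_shift_power:
  "coeff_mat (mat m (\<eta> * m + m) (\<lambda>(r, q). shift_power m (\<eta> * m + r) q)) \<eta> =
     (mat m (\<eta> * m + m) (\<lambda>(r, q). if q = r then 1 else 0) :: 'a::comm_ring_1 mat)"
proof (rule eq_matI)
  fix r q
  assume "r < dim_row (mat m (\<eta> * m + m) (\<lambda>(r, q). if q = r then 1 else 0) :: 'a mat)"
    "q < dim_col (mat m (\<eta> * m + m) (\<lambda>(r, q). if q = r then 1 else 0) :: 'a mat)"
  then have rq: "r < m" "q < \<eta> * m + m" by auto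
  then have "q div m \<le> \<eta>"
    by (metis add.commute less_Suc_eq_le less_mult_imp_div_less mult_Suc)
  then have "\<eta> - q div m = \<eta> \<longleftrightarrow> q div m = 0" by auto
  then have "(\<eta> - q div m = \<eta> \<and> r = q mod m) \<longleftrightarrow> q = r"
    using rq by (metis add_0 div_less div_mult_mod_eq mod_less mult_0)
  then show "coeff_mat (mat m (\<eta> * m + m) (\<lambda>(r, q). shift_power m (\<eta> * m + r) q)) \<eta> $$ (r, q) =
     (mat m (\<eta> * m + m) (\<lambda>(r, q). if q = r then 1 else 0) :: 'a mat) $$ (r, q)"
    using rq by (auto simp: coeff_mat_def shift_power_last)
qed (auto simp: coeff_mat_def)

section \<open>Frobenius norms and summation along diagonals\<close>

lemma inverse_if_injective:
  fixes A :: "'a::field mat"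
  assumes A: "A \<in> carrier_mat n n"
    and inj: "\<And>v. v \<in> carrier_vec n \<Longrightarrow> A *\<^sub>v v = 0\<^sub>v n \<Longrightarrow> v = 0\<^sub>v n"
  obtains B where "B \<in> carrier_mat n n" "A * B = 1\<^sub>m n" "B * A = 1\<^sub>m n"
proof -
  have "det A \<noteq> 0"
    using inj det_0_iff_vec_prod_zero_field[OF A] by auto
  then have "A \<in> Units (ring_mat TYPE('a) n ())"
    by (rule det_non_zero_imp_unit[OF A])
  then show thesis
    using that by (auto simp: Units_def ring_mat_def)
qed

text \<open>For an endomorphism of a finite-dimensional space, injectivity of \<open>1 - T\<close>
  implies surjectivity. The index set is an arbitrary finite \<open>I\<close>, so that unknown
  matrices can be indexed by pairs; \<open>local\<close> makes \<open>T\<close> an operator on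
  functions on \<open>I\<close>.\<close>

lemma finite_dim_fixpoint:
  fixes T :: "('i \<Rightarrow> 'a::field) \<Rightarrow> 'i \<Rightarrow> 'a"
  assumes fin: "finite I"
    and add: "\<And>x y i. T (\<lambda>i. x i + y i) i = T x i + T y i"
    and scale: "\<And>a x i. T (\<lambda>i. a * x i) i = a * T x i"
    and local: "\<And>x y. (\<And>i. i \<in> I \<Longrightarrow> x i = y i) \<Longrightarrow> T x = T y"
    and inj: "\<And>x. (\<And>i. i \<in> I \<Longrightarrow> x i = T x i) \<Longrightarrow> (\<And>i. i \<in> I \<Longrightarrow> x i = 0)"
  shows "\<exists>x. \<forall>i\<in>I. x i = b i + T x i"
proof -
  define n where "n = card I"
  obtain h where h: "bij_betw h {..<n} I"
    using ex_bij_betw_nat_finite[OF fin] unfolding n_def by (auto simp: lessThan_atLeast0)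
  define e where "e j i = (if i = j then 1 else 0 :: 'a)" for i j :: 'i
  have T_sum: "T (\<lambda>i. \<Sum>j\<in>J. x j * e j i) i0 = (\<Sum>j\<in>J. x j * T (e j) i0)" if "finite J" for J x i0
    using that
  proof induction
    case empty
    show ?case using scale[of 0 "\<lambda>_. 0" i0] by simp
  next
    case (insert j J)
    then show ?case by (simp add: add scale)
  qed
  have T_eq: "T x i0 = (\<Sum>t<n. T (e (h t)) i0 * x (h t))" for x i0
  proof -
    have "T x i0 = T (\<lambda>i. \<Sum>j\<in>I. x j * e j i) i0"
      by (rule fun_cong[OF local]) (use fin in \<open>simp add: e_def if_distrib cong: if_cong\<close>)
    also have "\<dots> = (\<Sum>j\<in>I. x j * T (e j) i0)"
      by (rule T_sum[OF fin])
    also have "\<dots> = (\<Sum>t<n. x (h t) * T (e (h t)) i0)"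
      by (rule sum.reindex_bij_betw[OF h, symmetric])
    finally show ?thesis by (simp add: mult.commute)
  qed
  \<comment> \<open>The matrix of \<open>1 - T\<close> in the basis of unit functions, after
    enumerating \<open>I\<close> by \<open>h\<close>.\<close>
  define C where "C = mat n n (\<lambda>(s, t). (if s = t then 1 else 0) - T (e (h t)) (h s))"
  have C: "C \<in> carrier_mat n n" by (simp add: C_def)
  have Cv: "(C *\<^sub>v v) $ s = v $ s - (\<Sum>t<n. T (e (h t)) (h s) * v $ t)"
    if "v \<in> carrier_vec n" "s < n" for v s
  proof -
    have "(C *\<^sub>v v) $ s = (\<Sum>t<n. C $$ (s, t) * v $ t)"
      by (rule mult_mat_vec_entry[OF C that])
    also have "\<dots> = (\<Sum>t<n. (if t = s then v $ t else 0) - T (e (h t)) (h s) * v $ t)"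
      by (rule sum.cong) (use that in \<open>auto simp: C_def algebra_simps\<close>)
    also have "\<dots> = v $ s - (\<Sum>t<n. T (e (h t)) (h s) * v $ t)"
      using that by (simp add: sum_subtractf)
    finally show ?thesis .
  qed
  define g where "g = inv_into {..<n} h"
  have gh: "g (h t) = t" if "t < n" for t
    unfolding g_def using h that by (simp add: bij_betw_def inv_into_f_f)
  have hg: "h (g i) = i" "g i < n" if "i \<in> I" for i
    using that bij_betw_inv_into_right[OF h that] bij_betwE[OF bij_betw_inv_into[OF h]]
    unfolding g_def by auto
  obtain B where B: "B \<in> carrier_mat n n" "C * B = 1\<^sub>m n"
  proof (rule inverse_if_injective[OF C])
    fix v assume v: "v \<in> carrier_vec n" "C *\<^sub>v v = 0\<^sub>v n"
    define x where "x i = v $ g i" for i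
    have "x i = T x i" if i: "i \<in> I" for i
    proof -
      have "0 = v $ g i - (\<Sum>t<n. T (e (h t)) (h (g i)) * v $ t)"
        using Cv[OF v(1) hg(2)[OF i]] v hg[OF i] by simp
      moreover have "T x i = (\<Sum>t<n. T (e (h t)) i * v $ t)"
        unfolding T_eq[of x] by (rule sum.cong) (auto simp: x_def gh)
      ultimately show ?thesis using hg[OF i] by (simp add: x_def)
    qed
    then have x0: "x i = 0" if "i \<in> I" for i using inj that by blast
    show "v = 0\<^sub>v n"
    proof (rule eq_vecI)
      fix t assume "t < dim_vec (0\<^sub>v n :: 'a vec)"
      then have t: "t < n" by simp
      then have "h t \<in> I" using h by (auto dest: bij_betwE)
      then show "v $ t = 0\<^sub>v n $ t" using x0[of "h t"] t by (simp add: x_def gh)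
    qed (use v in auto)
  qed auto
  define v where "v = B *\<^sub>v vec n (\<lambda>t. b (h t))"
  have v: "v \<in> carrier_vec n" using B by (simp add: v_def)
  have "C *\<^sub>v v = (C * B) *\<^sub>v vec n (\<lambda>t. b (h t))"
    unfolding v_def by (rule assoc_mult_mat_vec[OF C B(1), symmetric]) simp
  then have Cvb: "C *\<^sub>v v = vec n (\<lambda>t. b (h t))" unfolding B(2) by simp
  define x where "x i = v $ g i" for i
  have "x i = b i + T x i" if i: "i \<in> I" for i
  proof -
    have "b (h (g i)) = v $ g i - (\<Sum>t<n. T (e (h t)) (h (g i)) * v $ t)"
      using Cv[OF v hg(2)[OF i]] Cvb hg(2)[OF i] by simp
    moreover have "T x i = (\<Sum>t<n. T (e (h t)) i * v $ t)"
      unfolding T_eq[of x] by (rule sum.cong) (auto simp: x_def gh)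
    ultimately show ?thesis using hg(1)[OF i] by (simp add: x_def)
  qed
  then show ?thesis by blast
qed

section \<open>The Frobenius norm of constant matrices\<close>

lemma frobenius_norm_sq:
  "A \<in> carrier_mat r c \<Longrightarrow> (frobenius_norm A)\<^sup>2 = (\<Sum>i<r. \<Sum>j<c. (norm (A $$ (i, j)))\<^sup>2)"
  unfolding frobenius_norm_def by (auto intro!: real_sqrt_pow2 sum_nonneg)

lemma frobenius_norm_nonneg: "frobenius_norm A \<ge> 0"
  unfolding frobenius_norm_def by (auto intro!: sum_nonneg)

lemma frobenius_norm_eq_L2_set:
  "A \<in> carrier_mat r c \<Longrightarrow> frobenius_norm A = L2_set (\<lambda>x. norm (A $$ x)) ({..<r} \<times> {..<c})"
  unfolding frobenius_norm_def L2_set_def by (auto simp: sum.cartesian_product intro!: sum.cong)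

lemma frobenius_norm_add_le:
  assumes "A \<in> carrier_mat r c" "B \<in> carrier_mat r c"
  shows "frobenius_norm (A + B) \<le> frobenius_norm A + frobenius_norm B"
proof -
  have "frobenius_norm (A + B) \<le> L2_set (\<lambda>x. norm (A $$ x) + norm (B $$ x)) ({..<r} \<times> {..<c})"
    unfolding frobenius_norm_eq_L2_set[OF add_carrier_mat[OF assms(2)], of A]
    using assms by (intro L2_set_mono) (auto intro: norm_triangle_ineq)
  also have "\<dots> \<le> frobenius_norm A + frobenius_norm B"
    unfolding frobenius_norm_eq_L2_set[OF assms(1)] frobenius_norm_eq_L2_set[OF assms(2)]
    by (rule L2_set_triangle_ineq)
  finally show ?thesis .
qed

lemma norm_sum_mult_sq_le:
  fixes f g :: "'i \<Rightarrow> 'a::real_normed_field"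
  shows "(norm (\<Sum>t\<in>A. f t * g t))\<^sup>2 \<le> (\<Sum>t\<in>A. (norm (f t))\<^sup>2) * (\<Sum>t\<in>A. (norm (g t))\<^sup>2)"
proof -
  have "norm (\<Sum>t\<in>A. f t * g t) \<le> (\<Sum>t\<in>A. \<bar>norm (f t)\<bar> * \<bar>norm (g t)\<bar>)"
    by (rule order_trans[OF norm_sum]) (simp add: norm_mult)
  also have "\<dots> \<le> L2_set (\<lambda>t. norm (f t)) A * L2_set (\<lambda>t. norm (g t)) A"
    by (rule L2_set_mult_ineq)
  finally have "(norm (\<Sum>t\<in>A. f t * g t))\<^sup>2 \<le> (L2_set (\<lambda>t. norm (f t)) A * L2_set (\<lambda>t. norm (g t)) A)\<^sup>2"
    by (rule power_mono) simp
  then show ?thesis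
    by (simp add: power_mult_distrib L2_set_def sum_nonneg)
qed

lemma norm_sum_sq_le_card:
  fixes f :: "'i \<Rightarrow> 'a::real_normed_field"
  shows "(norm (\<Sum>t\<in>A. f t))\<^sup>2 \<le> card A * (\<Sum>t\<in>A. (norm (f t))\<^sup>2)"
  using norm_sum_mult_sq_le[of "\<lambda>_. 1" f A] by simp

lemma frobenius_norm_mult_le:
  fixes A B :: "'a::real_normed_field mat"
  assumes A: "A \<in> carrier_mat r s" and B: "B \<in> carrier_mat s c"
  shows "frobenius_norm (A * B) \<le> frobenius_norm A * frobenius_norm B"
proof (rule power2_le_imp_le)
  have "(frobenius_norm (A * B))\<^sup>2 = (\<Sum>i<r. \<Sum>j<c. (norm (\<Sum>t<s. A $$ (i, t) * B $$ (t, j)))\<^sup>2)"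
    unfolding frobenius_norm_sq[OF mult_carrier_mat[OF A B]]
    by (intro sum.cong) (auto simp: mult_mat_entry[OF A B])
  also have "\<dots> \<le> (\<Sum>i<r. \<Sum>j<c. (\<Sum>t<s. (norm (A $$ (i, t)))\<^sup>2) * (\<Sum>t<s. (norm (B $$ (t, j)))\<^sup>2))"
    by (intro sum_mono norm_sum_mult_sq_le)
  also have "\<dots> = (frobenius_norm A)\<^sup>2 * (frobenius_norm B)\<^sup>2"
    unfolding frobenius_norm_sq[OF A] frobenius_norm_sq[OF B] sum_product[symmetric]
    by (subst sum.swap[of _ "{..<s}"]) (rule refl)
  finally show "(frobenius_norm (A * B))\<^sup>2 \<le> (frobenius_norm A * frobenius_norm B)\<^sup>2"
    by (simp add: power_mult_distrib)
qed (simp add: frobenius_norm_nonneg)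

text \<open>Along each shifted diagonal \<open>(p, q), (p + m, q + m), \<dots>\<close> the equation
  \<open>X (p, q + m) - X (p - m, q) = r (p, q)\<close> is solved by summation, starting from the top left end
  above the diagonal and from the bottom right end below it.\<close>

definition diag_sum :: "nat \<Rightarrow> nat \<Rightarrow> (nat \<Rightarrow> nat \<Rightarrow> 'a::comm_ring_1) \<Rightarrow> nat \<Rightarrow> nat \<Rightarrow> 'a" where
  "diag_sum \<eta> m r p q =
     (if p \<le> q then \<Sum>t | t < \<eta> \<and> t * m \<le> p \<and> Suc t * m \<le> q. r (p - t * m) (q - Suc t * m)
      else - (\<Sum>t | t < \<eta> \<and> p + t * m < \<eta> * m + m \<and> q + t * m < \<eta> * m. r (p + Suc t * m) (q + t * m)))"

lemma diag_sum_step: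
  fixes r :: "nat \<Rightarrow> nat \<Rightarrow> 'a::comm_ring_1"
  assumes pq: "p < \<eta> * m + m + m" "q < \<eta> * m"
  shows "(if p < \<eta> * m + m then diag_sum \<eta> m r p (q + m) else 0)
       - (if m \<le> p then diag_sum \<eta> m r (p - m) q else 0) = r p q"
proof -
  from pq have \<eta>: "\<eta> > 0" and m: "m > 0" by (auto intro: Nat.gr0I)
  \<comment> \<open>The condition places \<open>(p, q + m)\<close> and \<open>(p - m, q)\<close> on
    the same side of the diagonal, so both values use the same branch. The two partial sums then
    differ by the single summand with \<open>t = 0\<close>.\<close>
  show ?thesis
  proof (cases "p \<le> q + m")
    case True
    let ?A = "{t. t < \<eta> \<and> t * m \<le> p \<and> Suc t * m \<le> q + m}"
    \<comment> \<open>Including \<open>m \<le> p\<close> makes the set empty in the first block row,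
      where the second term is cut off to 0 and \<open>p - m\<close> would be truncated.\<close>
    let ?B = "{t. t < \<eta> \<and> m \<le> p \<and> t * m \<le> p - m \<and> Suc t * m \<le> q}"
    have A: "?A = insert 0 (Suc ` ?B)"
    proof (intro equalityI subsetI)
      fix t assume t: "t \<in> ?A"
      show "t \<in> insert 0 (Suc ` ?B)" using t by (cases t) auto
    next
      fix t assume "t \<in> insert 0 (Suc ` ?B)"
      then consider "t = 0" | s where "t = Suc s" "s \<in> ?B" by auto
      then show "t \<in> ?A"
      proof cases
        case 2
        \<comment> \<open>Holds because \<open>Suc s * m \<le> q < \<eta> * m\<close>.\<close>
        have "Suc s < \<eta>"
        proof (rule ccontr)
          assume "\<not> Suc s < \<eta>"
          then have "\<eta> * m \<le> Suc s * m" by (intro mult_le_mono1) simp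
          then show False using 2 pq by simp
        qed
        then show ?thesis using 2 by auto
      qed (use \<eta> in auto)
    qed
    have "diag_sum \<eta> m r p (q + m) = (\<Sum>t\<in>?A. r (p - t * m) (q + m - Suc t * m))"
      using True by (simp add: diag_sum_def)
    also have "\<dots> = r p q + (\<Sum>t\<in>Suc ` ?B. r (p - t * m) (q + m - Suc t * m))"
      unfolding A by (subst sum.insert) auto
    also have "(\<Sum>t\<in>Suc ` ?B. r (p - t * m) (q + m - Suc t * m)) = (\<Sum>t\<in>?B. r (p - m - t * m) (q - Suc t * m))"
      by (subst sum.reindex) (auto intro!: sum.cong)
    also have "\<dots> = (if m \<le> p then diag_sum \<eta> m r (p - m) q else 0)"
      using True by (auto simp: diag_sum_def)
    finally show ?thesis using True pq by simp
  next
    case False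
    then have mp: "m \<le> p" and less: "q < p - m" by auto
    let ?A = "{t. t < \<eta> \<and> p - m + t * m < \<eta> * m + m \<and> q + t * m < \<eta> * m}"
    let ?B = "{t. t < \<eta> \<and> p + t * m < \<eta> * m + m \<and> q + m + t * m < \<eta> * m}"
    have A: "?A = insert 0 (Suc ` ?B)"
    proof (intro equalityI subsetI)
      fix t assume t: "t \<in> ?A"
      show "t \<in> insert 0 (Suc ` ?B)" using t mp by (cases t) auto
    next
      fix t assume "t \<in> insert 0 (Suc ` ?B)"
      then consider "t = 0" | s where "t = Suc s" "s \<in> ?B" by auto
      then show "t \<in> ?A"
      proof cases
        case 1
        then show ?thesis using \<eta> pq mp by auto
      next
        case 2
        have "Suc s < \<eta>"
        proof (rule ccontr)
          assume "\<not> Suc s < \<eta>"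
          then have "\<eta> * m \<le> Suc s * m" by (intro mult_le_mono1) simp
          then show False using 2 by simp
        qed
        then show ?thesis using 2 mp by auto
      qed
    qed
    have "diag_sum \<eta> m r (p - m) q = - (\<Sum>t\<in>?A. r (p - m + Suc t * m) (q + t * m))"
      using less by (simp add: diag_sum_def)
    also have "(\<Sum>t\<in>?A. r (p - m + Suc t * m) (q + t * m)) =
        r p q + (\<Sum>t\<in>Suc ` ?B. r (p - m + Suc t * m) (q + t * m))"
      unfolding A using mp by (subst sum.insert) auto
    also have "(\<Sum>t\<in>Suc ` ?B. r (p - m + Suc t * m) (q + t * m)) = (\<Sum>t\<in>?B. r (p + Suc t * m) (q + m + t * m))"
      using mp by (subst sum.reindex) (auto intro!: sum.cong simp: add.assoc)
    finally have "diag_sum \<eta> m r (p - m) q = - (r p q + (\<Sum>t\<in>?B. r (p + Suc t * m) (q + m + t * m)))" .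
    moreover have "(\<Sum>t\<in>?B. r (p + Suc t * m) (q + m + t * m)) = - diag_sum \<eta> m r p (q + m)"
      using False by (simp add: diag_sum_def)
    \<comment> \<open>Beyond the last row the first term is cut off to 0, in agreement with an empty
      sum.\<close>
    moreover have "?B = {}" if "\<not> p < \<eta> * m + m" using that by auto
    ultimately show ?thesis using mp by auto
  qed
qed

text \<open>Double counting: the pairs \<open>(x, t)\<close> that hit a fixed \<open>y\<close> have
  distinct weights in \<open>{0..\<eta>}\<close>, so \<open>y\<close> is counted at most
  \<open>0 + 1 + ... + \<eta>\<close> times.\<close>

lemma sum_card_weight_le:
  fixes w :: "'i \<Rightarrow> nat" and r :: "'j \<Rightarrow> real" and V :: "'i \<Rightarrow> nat set"
  assumes fin: "finite Q" "finite S" "\<And>x. x \<in> Q \<Longrightarrow> finite (V x)"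
    and w: "\<And>x. x \<in> Q \<Longrightarrow> w x \<le> \<eta>"
    and h: "\<And>x t. x \<in> Q \<Longrightarrow> t \<in> V x \<Longrightarrow> h x t \<in> S"
    and inj: "\<And>x t x' t'. x \<in> Q \<Longrightarrow> t \<in> V x \<Longrightarrow> x' \<in> Q \<Longrightarrow> t' \<in> V x' \<Longrightarrow>
        h x t = h x' t' \<Longrightarrow> w x = w x' \<Longrightarrow> x = x' \<and> t = t'"
    and r: "\<And>y. r y \<ge> 0"
  shows "(\<Sum>x\<in>Q. real (w x) * (\<Sum>t\<in>V x. r (h x t))) \<le> real (\<eta> * (\<eta> + 1)) / 2 * (\<Sum>y\<in>S. r y)"
proof -
  let ?f = "\<lambda>(x, t). (h x t, w x)"
  have injf: "inj_on ?f (Sigma Q V)"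
    using inj by (auto simp: inj_on_def)
  have "(\<Sum>x\<in>Q. real (w x) * (\<Sum>t\<in>V x. r (h x t))) = (\<Sum>(x, t)\<in>Sigma Q V. real (w x) * r (h x t))"
    using fin by (simp add: sum_distrib_left sum.Sigma)
  also have "\<dots> = (\<Sum>(y, j)\<in>?f ` Sigma Q V. real j * r y)"
    by (subst sum.reindex[OF injf]) (auto intro!: sum.cong)
  also have "\<dots> \<le> (\<Sum>(y, j)\<in>S \<times> {..\<eta>}. real j * r y)"
    using fin h w r by (intro sum_mono2) auto
  also have "\<dots> = (\<Sum>j\<le>\<eta>. real j) * (\<Sum>y\<in>S. r y)"
    by (subst sum.cartesian_product[symmetric], subst sum.swap) (simp add: sum_product)
  also have "(\<Sum>j\<le>\<eta>. real j) = real (\<eta> * (\<eta> + 1)) / 2"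
    by (induction \<eta>) (auto simp: field_simps)
  finally show ?thesis .
qed

text \<open>Cauchy-Schwarz on the partial sums; the weight \<open>w\<close> below bounds the number of summands,
  and together with the summand it determines the position \<open>(p, q)\<close>.\<close>

lemma diag_sum_norm_le:
  fixes r :: "nat \<Rightarrow> nat \<Rightarrow> 'a::real_normed_field"
  assumes m: "m > 0"
  shows "(\<Sum>p<\<eta> * m + m. \<Sum>q<\<eta> * m + m. (norm (diag_sum \<eta> m r p q))\<^sup>2)
    \<le> real (\<eta> * (\<eta> + 1)) / 2 * (\<Sum>p<\<eta> * m + m + m. \<Sum>q<\<eta> * m. (norm (r p q))\<^sup>2)"
proof -
  define N where "N = \<eta> * m + m"
  define f where "f = (\<lambda>(p, q). (norm (diag_sum \<eta> m r p q))\<^sup>2)"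
  define g where "g = (\<lambda>(p, q). (norm (r p q))\<^sup>2)"
  \<comment> \<open>Positions on or above the diagonal only use residuals in \<open>S1\<close>,
    those below only residuals in \<open>S2\<close>. These sets are disjoint, so treating the two
    halves separately does not double the constant.\<close>
  define Q1 where "Q1 = {(p, q). p \<le> q \<and> p < N \<and> q < N}"
  define Q2 where "Q2 = {(p, q). q < p \<and> p < N \<and> q < N}"
  define S1 where "S1 = {(p, q). p \<le> q + m \<and> p < N + m \<and> q < \<eta> * m}"
  define S2 where "S2 = {(p, q). q + m < p \<and> p < N + m \<and> q < \<eta> * m}"
  have Q: "{..<N} \<times> {..<N} = Q1 \<union> Q2" "Q1 \<inter> Q2 = {}" unfolding Q1_def Q2_def by auto
  have S: "{..<N + m} \<times> {..<\<eta> * m} = S1 \<union> S2" "S1 \<inter> S2 = {}" unfolding S1_def S2_def by auto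
  have fin: "finite Q1" "finite Q2" "finite S1" "finite S2"
    using Q S by (metis finite_Un finite_SigmaI finite_lessThan)+
  define V1 where "V1 = (\<lambda>(p, q). {t. t < \<eta> \<and> t * m \<le> p \<and> Suc t * m \<le> q})"
  define V2 where "V2 = (\<lambda>(p, q). {t. t < \<eta> \<and> p + t * m < N \<and> q + t * m < \<eta> * m})"
  define h1 where "h1 = (\<lambda>(p, q) t. (p - t * m, q - Suc t * m))"
  define h2 where "h2 = (\<lambda>(p, q) t. (p + Suc t * m, q + t * m))"
  define w1 where "w1 = (\<lambda>(p :: nat, q). q div m)"
  define w2 where "w2 = (\<lambda>(p :: nat, q). \<eta> - q div m)"
  have finV: "finite (V1 x)" "finite (V2 x)" for x
    by (cases x; simp add: V1_def V2_def)+
  have "(\<Sum>x\<in>Q1. f x) \<le> (\<Sum>x\<in>Q1. real (w1 x) * (\<Sum>t\<in>V1 x. g (h1 x t)))"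
  proof (rule sum_mono)
    fix x assume x: "x \<in> Q1"
    obtain p q where pq: "x = (p, q)" by (cases x)
    have "V1 x \<subseteq> {..<w1 x}"
    proof
      fix t assume "t \<in> V1 x"
      then have "Suc t * m \<le> q" by (simp add: V1_def pq)
      then have "Suc t \<le> q div m" using m by (metis div_le_mono nonzero_mult_div_cancel_right less_numeral_extra(3))
      then show "t \<in> {..<w1 x}" by (simp add: w1_def pq)
    qed
    then have "card (V1 x) \<le> w1 x" using card_mono[of "{..<w1 x}" "V1 x"] by simp
    moreover have "f x \<le> card (V1 x) * (\<Sum>t\<in>V1 x. g (h1 x t))"
      using x norm_sum_sq_le_card[of "\<lambda>t. r (p - t * m) (q - Suc t * m)" "V1 x"]
      by (simp add: f_def g_def h1_def pq diag_sum_def Q1_def V1_def)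
    moreover have "(\<Sum>t\<in>V1 x. g (h1 x t)) \<ge> 0" by (intro sum_nonneg) (simp add: g_def split: prod.split)
    ultimately show "f x \<le> real (w1 x) * (\<Sum>t\<in>V1 x. g (h1 x t))"
      by (meson mult_right_mono of_nat_mono order_trans)
  qed
  also have "\<dots> \<le> real (\<eta> * (\<eta> + 1)) / 2 * (\<Sum>y\<in>S1. g y)"
  proof (rule sum_card_weight_le[OF fin(1,3) finV(1)])
    show "w1 x \<le> \<eta>" if "x \<in> Q1" for x
    proof -
      obtain p q where pq: "x = (p, q)" by (cases x)
      have "q < Suc \<eta> * m" using that by (simp add: Q1_def pq N_def add.commute)
      then show ?thesis using less_mult_imp_div_less[of q "Suc \<eta>" m] by (simp add: w1_def pq)
    qed
    show "h1 x t \<in> S1" if "x \<in> Q1" "t \<in> V1 x" for x t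
      using that by (auto simp: Q1_def V1_def h1_def S1_def N_def split: prod.splits)
    show "x = x' \<and> t = t'" if "x \<in> Q1" "t \<in> V1 x" "x' \<in> Q1" "t' \<in> V1 x'" "h1 x t = h1 x' t'" "w1 x = w1 x'"
      for x t x' t'
    proof -
      obtain p q p' q' where pq: "x = (p, q)" "x' = (p', q')" by (cases x, cases x')
      have b: "t * m \<le> p" "Suc t * m \<le> q" "t' * m \<le> p'" "Suc t' * m \<le> q'"
        and e: "p - t * m = p' - t' * m" "q - Suc t * m = q' - Suc t' * m" and d: "q div m = q' div m"
        using that by (auto simp: pq V1_def h1_def w1_def)
      \<comment> \<open>Equal targets and equal weights mean that \<open>a + Suc t * m\<close> and
        \<open>a + Suc t' * m\<close> lie in the same block, which forces
        \<open>t = t'\<close>.\<close>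
      define a where "a = q - Suc t * m"
      have "q = a + Suc t * m" "q' = a + Suc t' * m" using b e by (simp_all add: a_def)
      then have "a div m + Suc t = a div m + Suc t'" using d m by (metis div_mult_self1 add.commute less_not_refl2)
      then have "t = t'" by simp
      then show ?thesis using b e by (auto simp: pq)
    qed
    show "g y \<ge> 0" for y by (simp add: g_def split: prod.split)
  qed
  finally have 1: "(\<Sum>x\<in>Q1. f x) \<le> real (\<eta> * (\<eta> + 1)) / 2 * (\<Sum>y\<in>S1. g y)" .
  have "(\<Sum>x\<in>Q2. f x) \<le> (\<Sum>x\<in>Q2. real (w2 x) * (\<Sum>t\<in>V2 x. g (h2 x t)))"
  proof (rule sum_mono)
    fix x assume x: "x \<in> Q2"
    obtain p q where pq: "x = (p, q)" by (cases x)
    have "V2 x \<subseteq> {..<w2 x}"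
    proof
      fix t assume "t \<in> V2 x"
      then have "q + t * m < \<eta> * m" by (simp add: V2_def pq)
      then have "(q + t * m) div m < \<eta>" by (rule less_mult_imp_div_less)
      then show "t \<in> {..<w2 x}" using m by (simp add: w2_def pq)
    qed
    then have "card (V2 x) \<le> w2 x" using card_mono[of "{..<w2 x}" "V2 x"] by simp
    moreover have "f x \<le> card (V2 x) * (\<Sum>t\<in>V2 x. g (h2 x t))"
      using x norm_sum_sq_le_card[of "\<lambda>t. r (p + Suc t * m) (q + t * m)" "V2 x"]
      by (simp add: f_def g_def h2_def pq diag_sum_def Q2_def V2_def N_def)
    moreover have "(\<Sum>t\<in>V2 x. g (h2 x t)) \<ge> 0" by (intro sum_nonneg) (simp add: g_def split: prod.split)
    ultimately show "f x \<le> real (w2 x) * (\<Sum>t\<in>V2 x. g (h2 x t))"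
      by (meson mult_right_mono of_nat_mono order_trans)
  qed
  also have "\<dots> \<le> real (\<eta> * (\<eta> + 1)) / 2 * (\<Sum>y\<in>S2. g y)"
  proof (rule sum_card_weight_le[OF fin(2,4) finV(2)])
    show "w2 x \<le> \<eta>" for x by (simp add: w2_def split: prod.split)
    show "h2 x t \<in> S2" if "x \<in> Q2" "t \<in> V2 x" for x t
      using that by (auto simp: Q2_def V2_def h2_def S2_def N_def split: prod.splits)
    show "x = x' \<and> t = t'" if "x \<in> Q2" "t \<in> V2 x" "x' \<in> Q2" "t' \<in> V2 x'" "h2 x t = h2 x' t'" "w2 x = w2 x'"
      for x t x' t'
    proof -
      obtain p q p' q' where pq: "x = (p, q)" "x' = (p', q')" by (cases x, cases x')
      have e: "p + t * m = p' + t' * m" "q + t * m = q' + t' * m" and d: "\<eta> - q div m = \<eta> - q' div m"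
        and b: "q + t * m < \<eta> * m" "q' + t' * m < \<eta> * m"
        using that by (auto simp: pq V2_def h2_def w2_def)
      have "q div m < \<eta>" "q' div m < \<eta>" using b by (auto intro!: less_mult_imp_div_less)
      then have "q div m = q' div m" using d by linarith
      moreover have "q div m + t = q' div m + t'"
        using arg_cong[OF e(2), of "\<lambda>x. x div m"] m by simp
      ultimately have "t = t'" by simp
      then show ?thesis using e by (auto simp: pq)
    qed
    show "g y \<ge> 0" for y by (simp add: g_def split: prod.split)
  qed
  finally have 2: "(\<Sum>x\<in>Q2. f x) \<le> real (\<eta> * (\<eta> + 1)) / 2 * (\<Sum>y\<in>S2. g y)" .
  have "(\<Sum>p<N. \<Sum>q<N. (norm (diag_sum \<eta> m r p q))\<^sup>2) = (\<Sum>x\<in>Q1. f x) + (\<Sum>x\<in>Q2. f x)"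
    unfolding sum.union_disjoint[OF fin(1,2) Q(2), symmetric] Q(1)[symmetric] f_def
    by (simp add: sum.cartesian_product)
  also have "\<dots> \<le> real (\<eta> * (\<eta> + 1)) / 2 * ((\<Sum>y\<in>S1. g y) + (\<Sum>y\<in>S2. g y))"
    using 1 2 by (simp add: distrib_left)
  also have "(\<Sum>y\<in>S1. g y) + (\<Sum>y\<in>S2. g y) = (\<Sum>p<N + m. \<Sum>q<\<eta> * m. (norm (r p q))\<^sup>2)"
    unfolding sum.union_disjoint[OF fin(3,4) S(2), symmetric] S(1)[symmetric] g_def
    by (simp add: sum.cartesian_product)
  finally show ?thesis unfolding N_def .
qed

section \<open>Strict equivalence of the perturbed Kronecker block\<close>

text \<open>Minus the contribution of \<open>Y * (\<lambda> G1 + G0)\<close> to the coefficients of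
  its product with the dual basis. Block row \<open>p div m\<close> stands for the power
  \<open>\<eta> + 1 - p div m\<close>; the constant part \<open>G0\<close> has one power less and
  therefore enters one block lower. The product has degree up to \<open>\<eta> + 1\<close>, hence
  \<open>N + m\<close> rows of equations.\<close>

definition residual :: "nat \<Rightarrow> nat \<Rightarrow> 'a::comm_ring_1 mat \<Rightarrow> 'a mat \<Rightarrow> 'a mat \<Rightarrow> nat \<Rightarrow> nat \<Rightarrow> 'a" where
  "residual N m G1 G0 Y p q =
     - ((if p < N then (Y * G1) $$ (p, q) else 0) + (if m \<le> p then (Y * G0) $$ (p - m, q) else 0))"

lemma residual_add:
  assumes "G1 \<in> carrier_mat N k" "G0 \<in> carrier_mat N k" "Y \<in> carrier_mat N N" "Y' \<in> carrier_mat N N"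
    "p < N + m" "q < k"
  shows "residual N m G1 G0 (Y + Y') p q = residual N m G1 G0 Y p q + residual N m G1 G0 Y' p q"
  using assms
  by (auto simp: residual_def add_mult_distrib_mat[OF assms(3,4,1)] add_mult_distrib_mat[OF assms(3,4,2)])

text \<open>Two terms meet in each entry, which costs the factor 2; it cancels the 1/2 in the bound
  for summation along diagonals.\<close>

lemma residual_norm_le:
  fixes G1 G0 Y :: "'a::real_normed_field mat"
  assumes G: "G1 \<in> carrier_mat N k" "G0 \<in> carrier_mat N k" and Y: "Y \<in> carrier_mat N N"
  shows "(\<Sum>p<N + m. \<Sum>q<k. (norm (residual N m G1 G0 Y p q))\<^sup>2) \<le>
    2 * ((frobenius_norm (Y * G1))\<^sup>2 + (frobenius_norm (Y * G0))\<^sup>2)"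
proof -
  let ?a = "\<lambda>p q. if p < N then (norm ((Y * G1) $$ (p, q)))\<^sup>2 else 0"
  let ?b = "\<lambda>p q. if m \<le> p then (norm ((Y * G0) $$ (p - m, q)))\<^sup>2 else 0"
  have sq: "(norm (x + y))\<^sup>2 \<le> 2 * (norm x)\<^sup>2 + 2 * (norm y)\<^sup>2" for x y :: 'a
  proof -
    have "(norm (x + y))\<^sup>2 \<le> (norm x + norm y)\<^sup>2"
      by (rule power_mono[OF norm_triangle_ineq]) simp
    also have "\<dots> \<le> 2 * (norm x)\<^sup>2 + 2 * (norm y)\<^sup>2"
      using sum_squares_ge_zero[of "norm x - norm y" 0] by (simp add: power2_eq_square algebra_simps)
    finally show ?thesis .
  qed
  have "(\<Sum>p<N + m. \<Sum>q<k. (norm (residual N m G1 G0 Y p q))\<^sup>2) \<le> (\<Sum>p<N + m. \<Sum>q<k. 2 * ?a p q + 2 * ?b p q)"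
  proof (intro sum_mono)
    fix p q
    show "(norm (residual N m G1 G0 Y p q))\<^sup>2 \<le> 2 * ?a p q + 2 * ?b p q"
      using sq[of "if p < N then (Y * G1) $$ (p, q) else 0" "if m \<le> p then (Y * G0) $$ (p - m, q) else 0"]
      unfolding residual_def norm_minus_cancel by (auto split: if_splits)
  qed
  also have "\<dots> = 2 * (\<Sum>p<N + m. \<Sum>q<k. ?a p q) + 2 * (\<Sum>p<N + m. \<Sum>q<k. ?b p q)"
    by (simp add: sum.distrib sum_distrib_left)
  also have "(\<Sum>p<N + m. \<Sum>q<k. ?a p q) = (\<Sum>p<N. \<Sum>q<k. (norm ((Y * G1) $$ (p, q)))\<^sup>2)"
    by (rule sum.mono_neutral_cong_right) auto
  also have "\<dots> = (frobenius_norm (Y * G1))\<^sup>2"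
    by (rule frobenius_norm_sq[symmetric]) (use Y G in auto)
  also have "(\<Sum>p<N + m. \<Sum>q<k. ?b p q) = (\<Sum>p\<in>(\<lambda>p. p + m) ` {..<N}. \<Sum>q<k. ?b p q)"
  proof (rule sum.mono_neutral_right)
    show "\<forall>p\<in>{..<N + m} - (\<lambda>p. p + m) ` {..<N}. (\<Sum>q<k. ?b p q) = 0"
    proof
      fix p assume p: "p \<in> {..<N + m} - (\<lambda>p. p + m) ` {..<N}"
      have "\<not> m \<le> p"
      proof
        assume "m \<le> p"
        then have "p = (p - m) + m" "p - m < N" using p by auto
        then show False using p by blast
      qed
      then show "(\<Sum>q<k. ?b p q) = 0" by simp
    qed
  qed auto
  also have "\<dots> = (\<Sum>p<N. \<Sum>q<k. (norm ((Y * G0) $$ (p, q)))\<^sup>2)"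
    by (subst sum.reindex) (auto simp: inj_on_def)
  also have "\<dots> = (frobenius_norm (Y * G0))\<^sup>2"
    by (rule frobenius_norm_sq[symmetric]) (use Y G in auto)
  finally show ?thesis by simp
qed

lemma diag_sum_add: "diag_sum \<eta> m (\<lambda>p q. r p q + r' p q) p q = diag_sum \<eta> m r p q + diag_sum \<eta> m r' p q"
  by (simp add: diag_sum_def sum.distrib)

lemma diag_sum_scale: "diag_sum \<eta> m (\<lambda>p q. a * r p q) p q = a * diag_sum \<eta> m r p q"
  by (simp add: diag_sum_def sum_distrib_left)

lemma diag_sum_cong:
  assumes "\<And>p q. p < \<eta> * m + m + m \<Longrightarrow> q < \<eta> * m \<Longrightarrow> r p q = r' p q"
    and "p < \<eta> * m + m" "q < \<eta> * m + m"
  shows "diag_sum \<eta> m r p q = diag_sum \<eta> m r' p q"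
  unfolding diag_sum_def using assms by (auto intro!: sum.cong assms(1))

text \<open>The shift equation is a linear fixed point equation for a contraction, and in finite dimension
  a contraction has no eigenvalue 1; so no completeness of the field is needed.\<close>

lemma bidiag_perturbation_solution:
  fixes G1 G0 :: "'a::real_normed_field mat"
  assumes m: "m > 0"
    and G: "G1 \<in> carrier_mat (\<eta> * m + m) (\<eta> * m)" "G0 \<in> carrier_mat (\<eta> * m + m) (\<eta> * m)"
    and small: "real (\<eta> * (\<eta> + 1)) * ((frobenius_norm G1)\<^sup>2 + (frobenius_norm G0)\<^sup>2) \<le> 1 / 16"
  obtains X where "X \<in> carrier_mat (\<eta> * m + m) (\<eta> * m + m)"
    and "\<And>p q. p < \<eta> * m + m + m \<Longrightarrow> q < \<eta> * m \<Longrightarrow>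
      (if p < \<eta> * m + m then X $$ (p, q + m) else 0) - (if m \<le> p then X $$ (p - m, q) else 0)
        = residual (\<eta> * m + m) m G1 G0 (1\<^sub>m (\<eta> * m + m) + X) p q"
    and "frobenius_norm X \<le>
      4 / 3 * sqrt (real (\<eta> * (\<eta> + 1)) * ((frobenius_norm G1)\<^sup>2 + (frobenius_norm G0)\<^sup>2))"
proof -
  define k where "k = \<eta> * m"
  define N where "N = k + m"
  note G' = G[folded k_def, folded N_def]
  define g where "g = (frobenius_norm G1)\<^sup>2 + (frobenius_norm G0)\<^sup>2"
  define \<kappa> where "\<kappa> = sqrt (real (\<eta> * (\<eta> + 1)) * g)"
  have g0: "g \<ge> 0" by (simp add: g_def)
  have \<kappa>2: "\<kappa>\<^sup>2 = real (\<eta> * (\<eta> + 1)) * g" using g0 by (simp add: \<kappa>_def)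
  have \<kappa>0: "\<kappa> \<ge> 0" using g0 by (simp add: \<kappa>_def)
  have "\<kappa>\<^sup>2 \<le> (1 / 4)\<^sup>2" using small unfolding \<kappa>2 g_def by (simp add: power2_eq_square)
  then have \<kappa>le: "\<kappa> \<le> 1 / 4" by (rule power2_le_imp_le) simp
  \<comment> \<open>\<open>\<Theta> Y\<close> solves the shift equation with right-hand side
    \<open>residual\<close> of \<open>Y\<close>; the matrix sought is a solution of
    \<open>X = \<Theta> (1 + X)\<close>.\<close>
  define \<Theta> where "\<Theta> Y = mat N N (\<lambda>(p, q). diag_sum \<eta> m (residual N m G1 G0 Y) p q)" for Y
  have \<Theta>c: "\<Theta> Y \<in> carrier_mat N N" for Y by (simp add: \<Theta>_def)
  \<comment> \<open>The constant \<open>c\<close> need not be the norm of \<open>Y\<close>: for the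
    identity matrix \<open>c = 1\<close> is admissible, whereas its Frobenius norm grows with
    \<open>N\<close>.\<close>
  have \<Theta>le: "frobenius_norm (\<Theta> Y) \<le> \<kappa> * c"
    if Y: "Y \<in> carrier_mat N N" and c: "c \<ge> 0"
      and le: "(frobenius_norm (Y * G1))\<^sup>2 + (frobenius_norm (Y * G0))\<^sup>2 \<le> c\<^sup>2 * g" for Y c
  proof (rule power2_le_imp_le)
    have "(frobenius_norm (\<Theta> Y))\<^sup>2 = (\<Sum>p<N. \<Sum>q<N. (norm (diag_sum \<eta> m (residual N m G1 G0 Y) p q))\<^sup>2)"
      unfolding frobenius_norm_sq[OF \<Theta>c] by (auto simp: \<Theta>_def intro!: sum.cong)
    also have "\<dots> \<le> real (\<eta> * (\<eta> + 1)) / 2 * (\<Sum>p<N + m. \<Sum>q<k. (norm (residual N m G1 G0 Y p q))\<^sup>2)"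
      unfolding N_def k_def by (rule diag_sum_norm_le[OF m])
    also have "\<dots> \<le> real (\<eta> * (\<eta> + 1)) / 2 * (2 * (c\<^sup>2 * g))"
      using residual_norm_le[OF G' Y, of m] le by (intro mult_left_mono) auto
    also have "\<dots> = (\<kappa> * c)\<^sup>2" unfolding power_mult_distrib \<kappa>2 by simp
    finally show "(frobenius_norm (\<Theta> Y))\<^sup>2 \<le> (\<kappa> * c)\<^sup>2" .
  qed (use \<kappa>0 c in simp)
  have \<Theta>lin: "frobenius_norm (\<Theta> Y) \<le> \<kappa> * frobenius_norm Y" if Y: "Y \<in> carrier_mat N N" for Y
  proof (rule \<Theta>le[OF Y frobenius_norm_nonneg])
    have "(frobenius_norm (Y * G1))\<^sup>2 \<le> (frobenius_norm Y * frobenius_norm G1)\<^sup>2"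
      "(frobenius_norm (Y * G0))\<^sup>2 \<le> (frobenius_norm Y * frobenius_norm G0)\<^sup>2"
      using frobenius_norm_mult_le[OF Y G'(1)] frobenius_norm_mult_le[OF Y G'(2)]
      by (auto intro!: power_mono frobenius_norm_nonneg)
    then show "(frobenius_norm (Y * G1))\<^sup>2 + (frobenius_norm (Y * G0))\<^sup>2 \<le> (frobenius_norm Y)\<^sup>2 * g"
      unfolding g_def power_mult_distrib by (simp add: distrib_left)
  qed
  have \<Theta>1: "frobenius_norm (\<Theta> (1\<^sub>m N)) \<le> \<kappa> * 1"
    by (rule \<Theta>le) (use G' in \<open>auto simp: g_def\<close>)
  have \<Theta>add: "\<Theta> (Y + Y') = \<Theta> Y + \<Theta> Y'" if "Y \<in> carrier_mat N N" "Y' \<in> carrier_mat N N" for Y Y'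
  proof (rule eq_matI)
    fix p q assume "p < dim_row (\<Theta> Y + \<Theta> Y')" "q < dim_col (\<Theta> Y + \<Theta> Y')"
    then have pq: "p < N" "q < N" by (auto simp: \<Theta>_def)
    have "diag_sum \<eta> m (residual N m G1 G0 (Y + Y')) p q =
        diag_sum \<eta> m (\<lambda>p q. residual N m G1 G0 Y p q + residual N m G1 G0 Y' p q) p q"
      by (rule diag_sum_cong)
        (use residual_add[OF G' that, of _ m] pq in \<open>auto simp: N_def k_def\<close>)
    then show "\<Theta> (Y + Y') $$ (p, q) = (\<Theta> Y + \<Theta> Y') $$ (p, q)"
      using pq by (simp add: \<Theta>_def diag_sum_add)
  qed (auto simp: \<Theta>_def)
  have \<Theta>smult: "\<Theta> (a \<cdot>\<^sub>m Y) $$ (p, q) = a * \<Theta> Y $$ (p, q)"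
    if Y: "Y \<in> carrier_mat N N" and pq: "p < N" "q < N" for a Y p q
  proof -
    have "diag_sum \<eta> m (residual N m G1 G0 (a \<cdot>\<^sub>m Y)) p q =
        diag_sum \<eta> m (\<lambda>p q. a * residual N m G1 G0 Y p q) p q"
      by (rule diag_sum_cong)
        (use pq Y G' in \<open>auto simp: N_def k_def residual_def mult_smult_assoc_mat[OF Y G'(1)]
            mult_smult_assoc_mat[OF Y G'(2)] algebra_simps\<close>)
    then show ?thesis using pq by (simp add: \<Theta>_def diag_sum_scale)
  qed
  \<comment> \<open>Linearity is required at every index, also outside the matrix, hence the default
    value 0 there.\<close>
  define T where "T x i = (if fst i < N \<and> snd i < N then \<Theta> (mat N N x) $$ i else 0)" for x i
  have "\<exists>x. \<forall>i\<in>{..<N} \<times> {..<N}. x i = \<Theta> (1\<^sub>m N) $$ i + T x i"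
  proof (rule finite_dim_fixpoint)
    show "finite ({..<N} \<times> {..<N})" by simp
    fix x y :: "nat \<times> nat \<Rightarrow> 'a" and i a
    have "mat N N (\<lambda>i. x i + y i) = mat N N x + mat N N y" by (rule eq_matI) auto
    then show "T (\<lambda>i. x i + y i) i = T x i + T y i"
      using carrier_matD[OF \<Theta>c] by (cases i) (simp add: T_def \<Theta>add)
    have "mat N N (\<lambda>i. a * x i) = a \<cdot>\<^sub>m mat N N x" by (rule eq_matI) auto
    then show "T (\<lambda>i. a * x i) i = a * T x i"
      by (cases i) (simp add: T_def \<Theta>smult)
  next
    fix x y :: "nat \<times> nat \<Rightarrow> 'a"
    assume "\<And>i. i \<in> {..<N} \<times> {..<N} \<Longrightarrow> x i = y i"
    then have "mat N N x = mat N N y" by (intro eq_matI) auto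
    then show "T x = T y" by (simp add: T_def fun_eq_iff)
  next
    fix x :: "nat \<times> nat \<Rightarrow> 'a" and i
    assume x: "\<And>i. i \<in> {..<N} \<times> {..<N} \<Longrightarrow> x i = T x i" and i: "i \<in> {..<N} \<times> {..<N}"
    let ?X = "mat N N x"
    have X: "?X = \<Theta> ?X"
    proof (rule eq_matI)
      fix p q assume "p < dim_row (\<Theta> ?X)" "q < dim_col (\<Theta> ?X)"
      then have "p < N" "q < N" using \<Theta>c[of ?X] by auto
      then show "?X $$ (p, q) = \<Theta> ?X $$ (p, q)" using x[of "(p, q)"] by (simp add: T_def)
    qed (use \<Theta>c[of ?X] in auto)
    have "frobenius_norm ?X \<le> \<kappa> * frobenius_norm ?X"
      using \<Theta>lin[of ?X] X by simp
    also have "\<dots> \<le> 1 / 4 * frobenius_norm ?X"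
      using \<kappa>le by (intro mult_right_mono frobenius_norm_nonneg)
    finally have "frobenius_norm ?X = 0" using frobenius_norm_nonneg[of ?X] by linarith
    then have "(\<Sum>p<N. \<Sum>q<N. (norm (?X $$ (p, q)))\<^sup>2) = 0"
      using frobenius_norm_sq[of ?X N N] by simp
    then have "\<forall>p<N. \<forall>q<N. norm (?X $$ (p, q)) = 0"
      by (simp add: sum_nonneg_eq_0_iff sum_nonneg)
    then show "x i = 0" using i by auto
  qed
  then obtain x where x: "\<And>i. i \<in> {..<N} \<times> {..<N} \<Longrightarrow> x i = \<Theta> (1\<^sub>m N) $$ i + T x i" by blast
  define X where "X = mat N N x"
  have X: "X \<in> carrier_mat N N" by (simp add: X_def)
  have X_sum: "X = \<Theta> (1\<^sub>m N) + \<Theta> X"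
  proof (rule eq_matI)
    fix p q assume "p < dim_row (\<Theta> (1\<^sub>m N) + \<Theta> X)" "q < dim_col (\<Theta> (1\<^sub>m N) + \<Theta> X)"
    then have "p < N" "q < N" using \<Theta>c[of X] by auto
    then show "X $$ (p, q) = (\<Theta> (1\<^sub>m N) + \<Theta> X) $$ (p, q)"
      using x[of "(p, q)"] carrier_matD[OF \<Theta>c] by (simp add: T_def X_def)
  qed (use \<Theta>c[of X] X in auto)
  then have X_eq: "X = \<Theta> (1\<^sub>m N + X)" using \<Theta>add[of "1\<^sub>m N" X] X by simp
  have "frobenius_norm X \<le> frobenius_norm (\<Theta> (1\<^sub>m N)) + frobenius_norm (\<Theta> X)"
    using frobenius_norm_add_le[OF \<Theta>c \<Theta>c, of "1\<^sub>m N" X] X_sum by simp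
  also have "\<dots> \<le> \<kappa> + \<kappa> * frobenius_norm X"
    using \<Theta>1 \<Theta>lin[OF X] by simp
  also have "\<dots> \<le> \<kappa> + 1 / 4 * frobenius_norm X"
    using mult_right_mono[OF \<kappa>le frobenius_norm_nonneg[of X]] by simp
  finally have bound: "frobenius_norm X \<le> 4 / 3 * \<kappa>" by simp
  show thesis
  proof (rule that)
    show "X \<in> carrier_mat (\<eta> * m + m) (\<eta> * m + m)" using X unfolding N_def k_def .
    show "frobenius_norm X \<le>
      4 / 3 * sqrt (real (\<eta> * (\<eta> + 1)) * ((frobenius_norm G1)\<^sup>2 + (frobenius_norm G0)\<^sup>2))"
      using bound unfolding \<kappa>_def g_def .
    fix p q assume pq: "p < \<eta> * m + m + m" "q < \<eta> * m"
    have idx: "X $$ (p, q) = diag_sum \<eta> m (residual N m G1 G0 (1\<^sub>m N + X)) p q" if "p < N" "q < N" for p q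
      by (subst X_eq) (use that in \<open>simp add: \<Theta>_def\<close>)
    have "(if p < N then X $$ (p, q + m) else 0) - (if m \<le> p then X $$ (p - m, q) else 0) =
       (if p < N then diag_sum \<eta> m (residual N m G1 G0 (1\<^sub>m N + X)) p (q + m) else 0)
       - (if m \<le> p then diag_sum \<eta> m (residual N m G1 G0 (1\<^sub>m N + X)) (p - m) q else 0)"
      using pq idx[of p "q + m"] idx[of "p - m" q] by (auto simp: N_def k_def)
    also have "\<dots> = residual N m G1 G0 (1\<^sub>m N + X) p q"
      using diag_sum_step[OF pq, of "residual N m G1 G0 (1\<^sub>m N + X)"] unfolding N_def k_def .
    finally show "(if p < \<eta> * m + m then X $$ (p, q + m) else 0) - (if m \<le> p then X $$ (p - m, q) else 0)
        = residual (\<eta> * m + m) m G1 G0 (1\<^sub>m (\<eta> * m + m) + X) p q"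
      unfolding N_def k_def .
  qed
qed

lemma frobenius_norm_mult_vec_le:
  fixes A :: "'a::real_normed_field mat"
  assumes A: "A \<in> carrier_mat r n" and v: "v \<in> carrier_vec n"
  shows "(\<Sum>i<r. (norm ((A *\<^sub>v v) $ i))\<^sup>2) \<le> (frobenius_norm A)\<^sup>2 * (\<Sum>j<n. (norm (v $ j))\<^sup>2)"
proof -
  have "(\<Sum>i<r. (norm ((A *\<^sub>v v) $ i))\<^sup>2) = (\<Sum>i<r. (norm (\<Sum>t<n. A $$ (i, t) * v $ t))\<^sup>2)"
    by (intro sum.cong) (auto simp: mult_mat_vec_entry[OF A v])
  also have "\<dots> \<le> (\<Sum>i<r. (\<Sum>t<n. (norm (A $$ (i, t)))\<^sup>2) * (\<Sum>t<n. (norm (v $ t))\<^sup>2))"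
    by (intro sum_mono norm_sum_mult_sq_le)
  also have "\<dots> = (frobenius_norm A)\<^sup>2 * (\<Sum>j<n. (norm (v $ j))\<^sup>2)"
    unfolding frobenius_norm_sq[OF A] by (simp add: sum_distrib_right)
  finally show ?thesis .
qed

lemma vec_eq_0_if_norm_le:
  fixes v :: "'a::real_normed_field vec"
  assumes v: "v \<in> carrier_vec n" and c: "c < 1"
    and le: "(\<Sum>j<n. (norm (v $ j))\<^sup>2) \<le> c * (\<Sum>j<n. (norm (v $ j))\<^sup>2)"
  shows "v = 0\<^sub>v n"
proof -
  let ?s = "\<Sum>j<n. (norm (v $ j))\<^sup>2"
  have "?s \<ge> 0" by (intro sum_nonneg) simp
  moreover have "(1 - c) * ?s \<le> 0" using le by (simp add: algebra_simps)
  ultimately have "?s = 0" using c by (metis diff_gt_0_iff_gt less_eq_real_def mult_pos_pos not_less)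
  then have "\<forall>j<n. v $ j = 0" by (simp add: sum_nonneg_eq_0_iff)
  then show ?thesis using v by auto
qed

lemma mult_mat_zero_vec: "A \<in> carrier_mat r c \<Longrightarrow> A *\<^sub>v 0\<^sub>v c = 0\<^sub>v r"
  by (intro eq_vecI) auto

text \<open>Invertibility comes from injectivity: \<open>1 + X\<close> is injective since
  \<open>X\<close> has norm at most 1/3, the perturbed leading coefficient since \<open>G1\<close>
  has norm below 1, and \<open>Z\<close> inherits injectivity from it. The injectivity of the
  leading coefficient is also exported, because it later bounds the degree of the second component
  of right null vectors.\<close>

lemma bidiag_strictly_equivalent:
  fixes G1 G0 :: "'a::real_normed_field mat"
  assumes m: "m > 0"
    and G: "G1 \<in> carrier_mat (\<eta> * m + m) (\<eta> * m)" "G0 \<in> carrier_mat (\<eta> * m + m) (\<eta> * m)"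
    and small: "real (\<eta> * (\<eta> + 1)) * ((frobenius_norm G1)\<^sup>2 + (frobenius_norm G0)\<^sup>2) \<le> 1 / 16"
    and G1: "frobenius_norm G1 < 1"
  obtains X Ai Z Zi where
    "X \<in> carrier_mat (\<eta> * m + m) (\<eta> * m + m)" "Ai \<in> carrier_mat (\<eta> * m + m) (\<eta> * m + m)"
    "(1\<^sub>m (\<eta> * m + m) + X) * Ai = 1\<^sub>m (\<eta> * m + m)" "Ai * (1\<^sub>m (\<eta> * m + m) + X) = 1\<^sub>m (\<eta> * m + m)"
    "Z \<in> carrier_mat (\<eta> * m) (\<eta> * m)" "Zi \<in> carrier_mat (\<eta> * m) (\<eta> * m)"
    "Z * Zi = 1\<^sub>m (\<eta> * m)" "Zi * Z = 1\<^sub>m (\<eta> * m)"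
    "(1\<^sub>m (\<eta> * m + m) + X) * (bidiag (\<eta> * m) m 0 1 + G1) = bidiag (\<eta> * m) m 0 1 * Z"
    "(1\<^sub>m (\<eta> * m + m) + X) * (bidiag (\<eta> * m) m 1 0 + G0) = bidiag (\<eta> * m) m 1 0 * Z"
    "frobenius_norm X \<le>
      4 / 3 * sqrt (real (\<eta> * (\<eta> + 1)) * ((frobenius_norm G1)\<^sup>2 + (frobenius_norm G0)\<^sup>2))"
    "\<And>v. v \<in> carrier_vec (\<eta> * m) \<Longrightarrow> (bidiag (\<eta> * m) m 0 1 + G1) *\<^sub>v v = 0\<^sub>v (\<eta> * m + m) \<Longrightarrow> v = 0\<^sub>v (\<eta> * m)"
proof -
  define k where "k = \<eta> * m"
  define N where "N = k + m"
  note G' = G[folded k_def, folded N_def]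
  define g where "g = (frobenius_norm G1)\<^sup>2 + (frobenius_norm G0)\<^sup>2"
  obtain X where X: "X \<in> carrier_mat N N"
    and X_eq: "\<And>p q. p < N + m \<Longrightarrow> q < k \<Longrightarrow>
      (if p < N then X $$ (p, q + m) else 0) - (if m \<le> p then X $$ (p - m, q) else 0)
        = residual N m G1 G0 (1\<^sub>m N + X) p q"
    and X_le: "frobenius_norm X \<le> 4 / 3 * sqrt (real (\<eta> * (\<eta> + 1)) * g)"
    using bidiag_perturbation_solution[OF m G small] unfolding N_def k_def g_def by blast
  define Y where "Y = 1\<^sub>m N + X"
  have Y: "Y \<in> carrier_mat N N" using X by (simp add: Y_def)
  let ?E1 = "bidiag k m 0 1 :: 'a mat" and ?E0 = "bidiag k m 1 0 :: 'a mat"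
  have E: "?E1 \<in> carrier_mat N k" "?E0 \<in> carrier_mat N k" by (simp_all add: N_def)
  have F: "?E1 + G1 \<in> carrier_mat N k" "?E0 + G0 \<in> carrier_mat N k" using E G' by auto
  have YF: "Y * (?E1 + G1) \<in> carrier_mat N k" "Y * (?E0 + G0) \<in> carrier_mat N k" using Y F by auto
  have YF1: "(Y * (?E1 + G1)) $$ (p, q) = Y $$ (p, q + m) + (Y * G1) $$ (p, q)"
    and YF0: "(Y * (?E0 + G0)) $$ (p, q) = - Y $$ (p, q) + (Y * G0) $$ (p, q)" if "p < N" "q < k" for p q
    using that Y G' E mult_bidiag[OF Y[unfolded N_def], of p q 0 1] mult_bidiag[OF Y[unfolded N_def], of p q 1 0]
    by (simp_all add: mult_add_distrib_mat[OF Y E(1) G'(1)] mult_add_distrib_mat[OF Y E(2) G'(2)] N_def)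
  \<comment> \<open>These are the coefficients of the dual basis times
    \<open>Y * (K + \<Delta>K)\<close>; the shift equation for \<open>X\<close> was set up to make
    them vanish. For \<open>X\<close> replaced by \<open>Y\<close> the left-hand side is unchanged,
    as the ones on the diagonal cancel.\<close>
  have key: "(if p < N then (Y * (?E1 + G1)) $$ (p, q) else 0)
      + (if m \<le> p then (Y * (?E0 + G0)) $$ (p - m, q) else 0) = 0" if pq: "p < N + m" "q < k" for p q
  proof -
    have "(if p < N then Y $$ (p, q + m) else 0) - (if m \<le> p then Y $$ (p - m, q) else 0) =
        (if p < N then X $$ (p, q + m) else 0) - (if m \<le> p then X $$ (p - m, q) else 0)"
      using pq X by (auto simp: Y_def N_def)
    also have "\<dots> = residual N m G1 G0 Y p q" using X_eq[OF pq] unfolding Y_def .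
    finally have e: "(if p < N then Y $$ (p, q + m) else 0) - (if m \<le> p then Y $$ (p - m, q) else 0) =
        residual N m G1 G0 Y p q" .
    have 1: "(if p < N then (Y * (?E1 + G1)) $$ (p, q) else 0) =
        (if p < N then Y $$ (p, q + m) else 0) + (if p < N then (Y * G1) $$ (p, q) else 0)"
      using pq YF1 by simp
    have "p - m < N" if "m \<le> p" using pq that by simp
    then have 2: "(if m \<le> p then (Y * (?E0 + G0)) $$ (p - m, q) else 0) =
        - (if m \<le> p then Y $$ (p - m, q) else 0) + (if m \<le> p then (Y * G0) $$ (p - m, q) else 0)"
      using pq YF0 by simp
    have alg: "a + c + (- b + d) = 0" if "a - b = - (c + d)" for a b c d :: 'a
    proof -
      have "a + c + (- b + d) = (a - b) + (c + d)" by (simp add: algebra_simps)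
      also have "\<dots> = 0" unfolding that by simp
      finally show ?thesis .
    qed
    show ?thesis
      unfolding 1 2 by (rule alg[OF e[unfolded residual_def]])
  qed
  \<comment> \<open>By \<open>key\<close>, the first block row of \<open>Y * (?E1 + G1)\<close> and
    the last one of \<open>Y * (?E0 + G0)\<close> vanish, and the remaining rows agree up to sign.
    This is the shape of \<open>?E1 * Z\<close> and \<open>?E0 * Z\<close> with a common
    \<open>Z\<close>.\<close>
  define Z where "Z = mat k k (\<lambda>(p, q). (Y * (?E1 + G1)) $$ (p + m, q))"
  have Z: "Z \<in> carrier_mat k k" by (simp add: Z_def)
  have YF1_Z: "Y * (?E1 + G1) = ?E1 * Z"
  proof (rule eq_matI)
    fix p q assume "p < dim_row (?E1 * Z)" "q < dim_col (?E1 * Z)"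
    then have pq: "p < N" "q < k" using Z by (auto simp: N_def)
    show "(Y * (?E1 + G1)) $$ (p, q) = (?E1 * Z) $$ (p, q)"
      using pq key[of p q] bidiag_mult[OF Z, of p m q 0 1] by (auto simp: N_def Z_def)
  qed (use Y G' Z in \<open>auto simp: N_def\<close>)
  have YF0_Z: "Y * (?E0 + G0) = ?E0 * Z"
  proof (rule eq_matI)
    fix p q assume "p < dim_row (?E0 * Z)" "q < dim_col (?E0 * Z)"
    then have pq: "p < N" "q < k" using Z by (auto simp: N_def)
    show "(Y * (?E0 + G0)) $$ (p, q) = (?E0 * Z) $$ (p, q)"
      using pq key[of "p + m" q] bidiag_mult[OF Z, of p m q 1 0]
      by (auto simp: N_def Z_def eq_neg_iff_add_eq_0 add.commute)
  qed (use Y G' Z in \<open>auto simp: N_def\<close>)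
  have g0: "g \<ge> 0" by (simp add: g_def)
  have "sqrt (real (\<eta> * (\<eta> + 1)) * g) \<le> sqrt ((1 / 4)\<^sup>2)"
    using small by (intro real_sqrt_le_mono) (simp add: g_def power2_eq_square)
  then have X_third: "frobenius_norm X \<le> 1 / 3" using X_le by simp
  obtain Ai where Ai: "Ai \<in> carrier_mat N N" "Y * Ai = 1\<^sub>m N" "Ai * Y = 1\<^sub>m N"
  proof (rule inverse_if_injective[OF Y])
    fix v assume v: "v \<in> carrier_vec N" "Y *\<^sub>v v = 0\<^sub>v N"
    have "v + X *\<^sub>v v = 0\<^sub>v N"
      using v X add_mult_distrib_mat_vec[OF one_carrier_mat X v(1)] by (simp add: Y_def)
    then have "v $ i = - (X *\<^sub>v v) $ i" if "i < N" for i
      using that X v by (metis add.inverse_unique add.commute carrier_vecD index_add_vec(1) index_zero_vec(1)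
          dim_mult_mat_vec carrier_matD(1) minus_equation_iff)
    then have "(\<Sum>i<N. (norm (v $ i))\<^sup>2) = (\<Sum>i<N. (norm ((X *\<^sub>v v) $ i))\<^sup>2)" by simp
    also have "\<dots> \<le> (frobenius_norm X)\<^sup>2 * (\<Sum>i<N. (norm (v $ i))\<^sup>2)"
      by (rule frobenius_norm_mult_vec_le[OF X v(1)])
    finally show "v = 0\<^sub>v N"
    proof (rule vec_eq_0_if_norm_le[OF v(1), rotated])
      have "(frobenius_norm X)\<^sup>2 \<le> (1 / 3)\<^sup>2"
        by (rule power_mono[OF X_third frobenius_norm_nonneg])
      also have "\<dots> < 1" by (simp add: power2_eq_square)
      finally show "(frobenius_norm X)\<^sup>2 < 1" .
    qed
  qed auto
  \<comment> \<open>\<open>?E1\<close> copies \<open>v\<close> into the rows from \<open>m\<close>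
    on, so a null vector satisfies \<open>v = - G1 v\<close> there, and the norm of
    \<open>G1\<close> is below 1.\<close>
  have F1_inj: "v = 0\<^sub>v k" if v: "v \<in> carrier_vec k" "(?E1 + G1) *\<^sub>v v = 0\<^sub>v N" for v
  proof -
    have sum0: "?E1 *\<^sub>v v + G1 *\<^sub>v v = 0\<^sub>v N"
      using v add_mult_distrib_mat_vec[OF E(1) G'(1) v(1)] by simp
    have "v $ i = - (G1 *\<^sub>v v) $ (i + m)" if i: "i < k" for i
    proof -
      have im: "i + m < N" using i by (simp add: N_def)
      have "(?E1 *\<^sub>v v) $ (i + m) = (\<Sum>t<k. ?E1 $$ (i + m, t) * v $ t)"
        by (rule mult_mat_vec_entry[OF E(1) v(1) im])
      also have "\<dots> = (\<Sum>t<k. if t = i then v $ t else 0)"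
        by (rule sum.cong) (use im in \<open>auto simp: bidiag_def N_def\<close>)
      finally have "(?E1 *\<^sub>v v) $ (i + m) = v $ i" using i by simp
      moreover have "(?E1 *\<^sub>v v) $ (i + m) + (G1 *\<^sub>v v) $ (i + m) = 0"
        using arg_cong[OF sum0, of "\<lambda>v. v $ (i + m)"] im G' by simp
      ultimately show ?thesis by (simp add: eq_neg_iff_add_eq_0)
    qed
    then have "(\<Sum>i<k. (norm (v $ i))\<^sup>2) = (\<Sum>i<k. (norm ((G1 *\<^sub>v v) $ (i + m)))\<^sup>2)" by simp
    also have "\<dots> = (\<Sum>i\<in>(\<lambda>i. i + m) ` {..<k}. (norm ((G1 *\<^sub>v v) $ i))\<^sup>2)"
      by (subst sum.reindex) (auto simp: inj_on_def)
    also have "\<dots> \<le> (\<Sum>i<N. (norm ((G1 *\<^sub>v v) $ i))\<^sup>2)"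
      by (rule sum_mono2) (auto simp: N_def)
    also have "\<dots> \<le> (frobenius_norm G1)\<^sup>2 * (\<Sum>i<k. (norm (v $ i))\<^sup>2)"
      by (rule frobenius_norm_mult_vec_le[OF G'(1) v(1)])
    finally show ?thesis
    proof (rule vec_eq_0_if_norm_le[OF v(1), rotated])
      show "(frobenius_norm G1)\<^sup>2 < 1"
        using G1 frobenius_norm_nonneg[of G1] by (simp add: abs_square_less_1)
    qed
  qed
  obtain Zi where Zi: "Zi \<in> carrier_mat k k" "Z * Zi = 1\<^sub>m k" "Zi * Z = 1\<^sub>m k"
  proof (rule inverse_if_injective[OF Z])
    fix v assume v: "v \<in> carrier_vec k" "Z *\<^sub>v v = 0\<^sub>v k"
    have "Y *\<^sub>v ((?E1 + G1) *\<^sub>v v) = (?E1 * Z) *\<^sub>v v"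
      using assoc_mult_mat_vec[OF Y F(1) v(1)] YF1_Z by simp
    also have "\<dots> = ?E1 *\<^sub>v (Z *\<^sub>v v)" by (rule assoc_mult_mat_vec[OF E(1) Z v(1)])
    also have "\<dots> = 0\<^sub>v N" unfolding v(2) by (rule mult_mat_zero_vec[OF E(1)])
    finally have e: "Y *\<^sub>v ((?E1 + G1) *\<^sub>v v) = 0\<^sub>v N" .
    have Fv: "(?E1 + G1) *\<^sub>v v \<in> carrier_vec N" using F(1) v(1) by (rule mult_mat_vec_carrier)
    have "(?E1 + G1) *\<^sub>v v = (Ai * Y) *\<^sub>v ((?E1 + G1) *\<^sub>v v)" unfolding Ai(3) using Fv by simp
    also have "\<dots> = Ai *\<^sub>v (Y *\<^sub>v ((?E1 + G1) *\<^sub>v v))" by (rule assoc_mult_mat_vec[OF Ai(1) Y Fv])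
    also have "\<dots> = 0\<^sub>v N" unfolding e by (rule mult_mat_zero_vec[OF Ai(1)])
    finally show "v = 0\<^sub>v k" by (rule F1_inj[OF v(1)])
  qed auto
  show thesis
    using that[of X Ai Z Zi] X Ai Z Zi YF1_Z YF0_Z X_le F1_inj
    unfolding Y_def N_def k_def g_def by blast
qed

section \<open>Norms of matrix polynomials\<close>

lemma poly_frobenius_norm_eq:
  fixes R :: "'a::real_normed_vector poly mat"
  assumes R: "R \<in> carrier_mat r c" and grade: "has_grade d R"
  shows "poly_frobenius_norm R = sqrt (\<Sum>s\<le>d. \<Sum>i<r. \<Sum>j<c. (norm (coeff (R $$ (i, j)) s))\<^sup>2)"
proof -
  have fn: "(frobenius_norm (coeff_mat R s))\<^sup>2 = (\<Sum>i<r. \<Sum>j<c. (norm (coeff (R $$ (i, j)) s))\<^sup>2)" for s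
  proof -
    have "coeff_mat R s \<in> carrier_mat r c" using R by (simp add: coeff_mat_def)
    then show ?thesis using R by (auto simp: frobenius_norm_sq coeff_mat_def intro!: sum.cong)
  qed
  have "(\<Sum>s. (frobenius_norm (coeff_mat R s))\<^sup>2) = (\<Sum>s\<le>d. (frobenius_norm (coeff_mat R s))\<^sup>2)"
  proof (rule suminf_finite)
    fix s assume s: "s \<notin> {..d}"
    have "coeff (R $$ (i, j)) s = 0" if "i < r" "j < c" for i j
    proof (rule coeff_eq_0)
      have "degree (R $$ (i, j)) \<le> d" using R grade that unfolding has_grade_def by auto
      then show "degree (R $$ (i, j)) < s" using s by simp
    qed
    then show "(frobenius_norm (coeff_mat R s))\<^sup>2 = 0" unfolding fn by simp
  qed simp
  then show ?thesis unfolding poly_frobenius_norm_def by (simp add: fn)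
qed

lemma poly_frobenius_norm_sq:
  fixes R :: "'a::real_normed_vector poly mat"
  assumes R: "R \<in> carrier_mat r c" and grade: "has_grade d R"
  shows "(poly_frobenius_norm R)\<^sup>2 = (\<Sum>s\<le>d. \<Sum>i<r. \<Sum>j<c. (norm (coeff (R $$ (i, j)) s))\<^sup>2)"
  unfolding poly_frobenius_norm_eq[OF assms] by (simp add: sum_nonneg)

lemma poly_frobenius_norm_pencil:
  assumes A: "A1 \<in> carrier_mat r c" "A0 \<in> carrier_mat r c"
  shows "poly_frobenius_norm (pencil A1 A0) = sqrt ((frobenius_norm A1)\<^sup>2 + (frobenius_norm A0)\<^sup>2)"
  unfolding poly_frobenius_norm_eq[OF pencil_carrier[OF A] has_grade_pencil[OF A]]
    frobenius_norm_sq[OF A(1)] frobenius_norm_sq[OF A(2)]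
  by (simp add: atMost_Suc pencil_index[OF A])

lemma poly_frobenius_norm_nonneg:
  fixes R :: "'a::real_normed_vector poly mat"
  shows "R \<in> carrier_mat r c \<Longrightarrow> has_grade d R \<Longrightarrow> poly_frobenius_norm R \<ge> 0"
  by (simp only: poly_frobenius_norm_eq) (intro real_sqrt_ge_zero sum_nonneg zero_le_power2)

lemma poly_frobenius_norm_nonneg_pencil:
  "A1 \<in> carrier_mat r c \<Longrightarrow> A0 \<in> carrier_mat r c \<Longrightarrow> poly_frobenius_norm (pencil A1 A0) \<ge> 0"
  by (simp add: poly_frobenius_norm_pencil)

lemma poly_frobenius_norm_pencil_add_le:
  assumes "A1 \<in> carrier_mat r c" "A0 \<in> carrier_mat r c" "B1 \<in> carrier_mat r c" "B0 \<in> carrier_mat r c"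
  shows "poly_frobenius_norm (pencil (A1 + B1) (A0 + B0)) \<le>
    poly_frobenius_norm (pencil A1 A0) + poly_frobenius_norm (pencil B1 B0)"
proof -
  have "poly_frobenius_norm (pencil (A1 + B1) (A0 + B0)) \<le>
      sqrt ((frobenius_norm A1 + frobenius_norm B1)\<^sup>2 + (frobenius_norm A0 + frobenius_norm B0)\<^sup>2)"
    using assms frobenius_norm_add_le[of A1 r c B1] frobenius_norm_add_le[of A0 r c B0]
    by (subst poly_frobenius_norm_pencil[of _ r c])
      (auto intro!: real_sqrt_le_mono add_mono power_mono frobenius_norm_nonneg)
  also have "\<dots> \<le> poly_frobenius_norm (pencil A1 A0) + poly_frobenius_norm (pencil B1 B0)"
    using assms by (simp add: poly_frobenius_norm_pencil real_sqrt_sum_squares_triangle_ineq)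
  finally show ?thesis .
qed

lemma poly_frobenius_norm_pencil_mult_le:
  fixes X :: "'a::real_normed_field mat"
  assumes X: "X \<in> carrier_mat r s" and B: "B1 \<in> carrier_mat s c" "B0 \<in> carrier_mat s c"
  shows "poly_frobenius_norm (pencil (X * B1) (X * B0)) \<le> frobenius_norm X * poly_frobenius_norm (pencil B1 B0)"
proof -
  have "poly_frobenius_norm (pencil (X * B1) (X * B0)) \<le>
      sqrt ((frobenius_norm X * frobenius_norm B1)\<^sup>2 + (frobenius_norm X * frobenius_norm B0)\<^sup>2)"
    using assms frobenius_norm_mult_le[OF X B(1)] frobenius_norm_mult_le[OF X B(2)]
    by (subst poly_frobenius_norm_pencil[of _ r c])
      (auto intro!: real_sqrt_le_mono add_mono power_mono frobenius_norm_nonneg)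
  also have "\<dots> = sqrt ((frobenius_norm X)\<^sup>2 * ((frobenius_norm B1)\<^sup>2 + (frobenius_norm B0)\<^sup>2))"
    by (simp add: power_mult_distrib distrib_left)
  also have "\<dots> = frobenius_norm X * poly_frobenius_norm (pencil B1 B0)"
    unfolding poly_frobenius_norm_pencil[OF B] real_sqrt_mult by (simp add: frobenius_norm_nonneg)
  finally show ?thesis .
qed

section \<open>Norms of block pencils and of products with the dual basis\<close>

lemma sum_lessThan_add: "(\<Sum>j<a + b. f j) = (\<Sum>j<a. f j) + (\<Sum>j<b. f (a + j) :: 'a::comm_monoid_add)" for a b :: nat
  by (induction b) (auto simp: add.assoc)

lemma poly_frobenius_norm_append_cols:
  assumes A: "A1 \<in> carrier_mat r a" "A0 \<in> carrier_mat r a" and B: "B1 \<in> carrier_mat r b" "B0 \<in> carrier_mat r b"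
  shows "(poly_frobenius_norm (append_cols (pencil A1 A0) (pencil B1 B0)))\<^sup>2 =
    (poly_frobenius_norm (pencil A1 A0))\<^sup>2 + (poly_frobenius_norm (pencil B1 B0))\<^sup>2"
proof -
  note pA = pencil_carrier[OF A] and pB = pencil_carrier[OF B]
  note gA = has_grade_pencil[OF A] and gB = has_grade_pencil[OF B]
  have e1: "append_cols (pencil A1 A0) (pencil B1 B0) $$ (i, j) = pencil A1 A0 $$ (i, j)" if "i < r" "j < a" for i j
    using that A B by (simp add: append_cols_def)
  have e2: "append_cols (pencil A1 A0) (pencil B1 B0) $$ (i, a + j) = pencil B1 B0 $$ (i, j)" if "i < r" "j < b" for i j
    using that A B by (simp add: append_cols_def)
  show ?thesis
    unfolding poly_frobenius_norm_sq[OF append_cols_carrier[OF pA pB] has_grade_append_cols[OF pA pB gA gB]]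
      poly_frobenius_norm_sq[OF pA gA] poly_frobenius_norm_sq[OF pB gB] sum_lessThan_add
    by (simp add: sum.distrib e1 e2)
qed

text \<open>With at most one nonzero summand, norm and sum commute without the loss of a
  Cauchy-Schwarz estimate.\<close>

lemma norm_sum_at_most_one:
  fixes f :: "'i \<Rightarrow> 'a::real_normed_vector"
  assumes "finite A" and one: "\<And>q q'. q \<in> A \<Longrightarrow> q' \<in> A \<Longrightarrow> Q q \<Longrightarrow> Q q' \<Longrightarrow> q = q'"
  shows "(norm (\<Sum>q\<in>A. if Q q then f q else 0))\<^sup>2 = (\<Sum>q\<in>A. if Q q then (norm (f q))\<^sup>2 else 0)"
proof (cases "\<exists>q\<in>A. Q q")
  case True
  then obtain q where q: "q \<in> A" "Q q" by blast
  have "(\<Sum>x\<in>A. if Q x then f x else 0) = (\<Sum>x\<in>A. if x = q then f x else 0)"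
    "(\<Sum>x\<in>A. if Q x then (norm (f x))\<^sup>2 else 0) = (\<Sum>x\<in>A. if x = q then (norm (f x))\<^sup>2 else 0)"
    using one q by (auto intro!: sum.cong)
  then show ?thesis using assms(1) q by simp
next
  case False
  then have "(\<Sum>x\<in>A. if Q x then f x else 0) = 0" "(\<Sum>x\<in>A. if Q x then (norm (f x))\<^sup>2 else 0) = 0"
    by (auto intro!: sum.neutral)
  then show ?thesis by simp
qed

lemma coeff_monom_mult_linear:
  fixes x y :: "'a::comm_ring_1"
  shows "coeff (monom 1 e * [:x, y:]) s = (if s = e then x else 0) + (if s = Suc e then y else 0)"
proof (cases "e \<le> s")
  case True
  then obtain t where t: "s = e + t" by (auto simp: le_iff_add)
  show ?thesis unfolding t coeff_monom_mult
    by (cases t; cases "t - 1") auto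
qed (simp add: coeff_monom_mult del: mult_pCons_right)

text \<open>Each coefficient of the product is a sum of at most one entry of \<open>H0\<close> and
  one of \<open>H1\<close>, and no entry is used twice. Thus the constant is \<open>sqrt 2\<close>,
  independent of \<open>\<eta>\<close>.\<close>

lemma poly_frobenius_norm_Lambda_mult_le:
  fixes H1 H0 :: "'a::real_normed_field mat"
  assumes m: "m > 0" and H: "H1 \<in> carrier_mat (\<eta> * m + m) n" "H0 \<in> carrier_mat (\<eta> * m + m) n"
  shows "poly_frobenius_norm (mat m (\<eta> * m + m) (\<lambda>(r, q). shift_power m (\<eta> * m + r) q) * pencil H1 H0)
    \<le> sqrt 2 * poly_frobenius_norm (pencil H1 H0)" (is "poly_frobenius_norm (?D * _) \<le> _")
proof -
  define N where "N = \<eta> * m + m"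
  have D: "?D \<in> carrier_mat m N" by (simp add: N_def)
  note H' = H[folded N_def]
  note DH = mult_carrier_mat[OF D pencil_carrier[OF H']]
  have grade: "has_grade (\<eta> + 1) (?D * pencil H1 H0)"
    by (rule has_grade_mult[OF D has_grade_shift_power pencil_carrier[OF H'] has_grade_pencil[OF H']])
  \<comment> \<open>\<open>a r q s\<close> says that row \<open>q\<close> of \<open>H0\<close>
    contributes to row \<open>r\<close> of coefficient \<open>s\<close>; \<open>b\<close> does this
    for \<open>H1\<close>, whose entries carry one more power.\<close>
  define a where "a r q s \<longleftrightarrow> r = q mod m \<and> s = \<eta> - q div m" for r q s
  define b where "b r q s \<longleftrightarrow> r = q mod m \<and> s = Suc (\<eta> - q div m)" for r q s
  have qd: "q div m \<le> \<eta>" if "q < N" for q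
    using that less_mult_imp_div_less[of q "Suc \<eta>" m] by (simp add: N_def add.commute)
  have a_one: "q = q'" if "q < N" "q' < N" "a r q s" "a r q' s" for q q' r s
    using that qd[of q] qd[of q'] unfolding a_def by (metis diff_diff_cancel div_mult_mod_eq)
  have b_one: "q = q'" if "q < N" "q' < N" "b r q s" "b r q' s" for q q' r s
    using that qd[of q] qd[of q'] unfolding b_def by (metis diff_diff_cancel div_mult_mod_eq nat.inject)
  have le: "(norm (coeff ((?D * pencil H1 H0) $$ (r, c)) s))\<^sup>2 \<le>
      2 * (\<Sum>q<N. if a r q s then (norm (H0 $$ (q, c)))\<^sup>2 else 0) + 2 * (\<Sum>q<N. if b r q s then (norm (H1 $$ (q, c)))\<^sup>2 else 0)"
    if rc: "r < m" "c < n" for r c s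
  proof -
    have "coeff (shift_power m (\<eta> * m + r) q * [:H0 $$ (q, c), H1 $$ (q, c):]) s =
        (if a r q s then H0 $$ (q, c) else 0) + (if b r q s then H1 $$ (q, c) else 0)" if "q < N" for q
      using that rc unfolding N_def
      by (simp add: shift_power_last a_def b_def coeff_monom_mult_linear del: mult_pCons_right)
    then have e: "coeff ((?D * pencil H1 H0) $$ (r, c)) s =
        (\<Sum>q<N. if a r q s then H0 $$ (q, c) else 0) + (\<Sum>q<N. if b r q s then H1 $$ (q, c) else 0)"
      unfolding mult_mat_entry[OF D pencil_carrier[OF H'] rc] coeff_sum sum.distrib[symmetric]
      using rc by (intro sum.cong) (auto simp: pencil_index[OF H'] N_def)
    have "(norm (coeff ((?D * pencil H1 H0) $$ (r, c)) s))\<^sup>2 \<le>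
        (norm (\<Sum>q<N. if a r q s then H0 $$ (q, c) else 0) + norm (\<Sum>q<N. if b r q s then H1 $$ (q, c) else 0))\<^sup>2"
      unfolding e by (rule power_mono[OF norm_triangle_ineq norm_ge_zero])
    also have "\<dots> \<le> 2 * (norm (\<Sum>q<N. if a r q s then H0 $$ (q, c) else 0))\<^sup>2
        + 2 * (norm (\<Sum>q<N. if b r q s then H1 $$ (q, c) else 0))\<^sup>2"
    proof -
      have "(x + y)\<^sup>2 \<le> 2 * x\<^sup>2 + 2 * y\<^sup>2" for x y :: real
        using sum_squares_ge_zero[of "x - y" 0] by (simp add: power2_eq_square algebra_simps)
      then show ?thesis .
    qed
    also have "(norm (\<Sum>q<N. if a r q s then H0 $$ (q, c) else 0))\<^sup>2 = (\<Sum>q<N. if a r q s then (norm (H0 $$ (q, c)))\<^sup>2 else 0)"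
      by (rule norm_sum_at_most_one) (auto intro: a_one)
    also have "(norm (\<Sum>q<N. if b r q s then H1 $$ (q, c) else 0))\<^sup>2 = (\<Sum>q<N. if b r q s then (norm (H1 $$ (q, c)))\<^sup>2 else 0)"
      by (rule norm_sum_at_most_one) (auto intro: b_one)
    finally show ?thesis .
  qed
  \<comment> \<open>Conversely \<open>q\<close> determines \<open>r\<close> and \<open>s\<close>, so
    every entry is counted at most once.\<close>
  have swap: "(\<Sum>s\<le>\<eta> + 1. \<Sum>r<m. \<Sum>c<n. \<Sum>q<N. if Q r q s then (norm (F $$ (q, c)))\<^sup>2 else 0) \<le> (frobenius_norm F)\<^sup>2"
    if F: "F \<in> carrier_mat N n" and Q: "\<And>r q s r' s'. Q r q s \<Longrightarrow> Q r' q s' \<Longrightarrow> r = r' \<and> s = s'" for Q and F :: "'a mat"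
  proof -
    have "(\<Sum>s\<le>\<eta> + 1. \<Sum>r<m. \<Sum>c<n. \<Sum>q<N. if Q r q s then (norm (F $$ (q, c)))\<^sup>2 else 0) =
        (\<Sum>(s, r)\<in>{..\<eta> + 1} \<times> {..<m}. \<Sum>(q, c)\<in>{..<N} \<times> {..<n}. if Q r q s then (norm (F $$ (q, c)))\<^sup>2 else 0)"
      unfolding sum.cartesian_product[symmetric] by (intro sum.cong refl sum.swap)
    also have "\<dots> = (\<Sum>(q, c)\<in>{..<N} \<times> {..<n}. \<Sum>(s, r)\<in>{..\<eta> + 1} \<times> {..<m}. if Q r q s then (norm (F $$ (q, c)))\<^sup>2 else 0)"
      unfolding case_prod_unfold by (rule sum.swap)
    also have "\<dots> \<le> (\<Sum>(q, c)\<in>{..<N} \<times> {..<n}. (norm (F $$ (q, c)))\<^sup>2)"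
    proof (rule sum_mono, clarify)
      fix q c
      let ?V = "(norm (F $$ (q, c)))\<^sup>2"
      let ?I = "{..\<eta> + 1} \<times> {..<m}"
      have "(\<Sum>x\<in>?I. if Q (snd x) q (fst x) then ?V else 0) \<le> ?V"
      proof (cases "\<exists>x\<in>?I. Q (snd x) q (fst x)")
        case True
        then obtain x where x: "x \<in> ?I" "Q (snd x) q (fst x)" by blast
        have "(\<Sum>y\<in>?I. if Q (snd y) q (fst y) then ?V else 0) = (\<Sum>y\<in>?I. if y = x then ?V else 0)"
          by (rule sum.cong) (use Q x in \<open>auto simp: prod_eq_iff\<close>)
        also have "\<dots> = ?V" by (subst sum.delta) (use x(1) in auto)
        finally show ?thesis by simp
      next
        case False
        then have "(\<Sum>y\<in>?I. if Q (snd y) q (fst y) then ?V else 0) = 0"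
          by (intro sum.neutral) auto
        then show ?thesis by simp
      qed
      then show "(\<Sum>(s, r)\<in>?I. if Q r q s then ?V else 0) \<le> ?V"
        unfolding case_prod_unfold .
    qed
    also have "\<dots> = (frobenius_norm F)\<^sup>2"
      unfolding frobenius_norm_sq[OF F] by (simp add: sum.cartesian_product)
    finally show ?thesis .
  qed
  have "(poly_frobenius_norm (?D * pencil H1 H0))\<^sup>2 \<le>
      (\<Sum>s\<le>\<eta> + 1. \<Sum>r<m. \<Sum>c<n. 2 * (\<Sum>q<N. if a r q s then (norm (H0 $$ (q, c)))\<^sup>2 else 0)
         + 2 * (\<Sum>q<N. if b r q s then (norm (H1 $$ (q, c)))\<^sup>2 else 0))"
    unfolding poly_frobenius_norm_sq[OF DH grade] by (intro sum_mono le) auto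
  also have "\<dots> = 2 * (\<Sum>s\<le>\<eta> + 1. \<Sum>r<m. \<Sum>c<n. \<Sum>q<N. if a r q s then (norm (H0 $$ (q, c)))\<^sup>2 else 0)
      + 2 * (\<Sum>s\<le>\<eta> + 1. \<Sum>r<m. \<Sum>c<n. \<Sum>q<N. if b r q s then (norm (H1 $$ (q, c)))\<^sup>2 else 0)"
    by (simp only: sum.distrib sum_distrib_left)
  also have "\<dots> \<le> 2 * (frobenius_norm H0)\<^sup>2 + 2 * (frobenius_norm H1)\<^sup>2"
    using swap[OF H'(2), of a] swap[OF H'(1), of b] by (simp add: a_def b_def)
  also have "\<dots> = (sqrt 2 * poly_frobenius_norm (pencil H1 H0))\<^sup>2"
    unfolding poly_frobenius_norm_pencil[OF H'] by (simp add: power_mult_distrib)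
  finally show ?thesis
    by (rule power2_le_imp_le) (simp add: poly_frobenius_norm_nonneg_pencil[OF H'])
qed

section \<open>Perturbed block Kronecker pencils\<close>

lemma has_grade_const_mat: "has_grade 0 (const_mat A)"
  unfolding has_grade_def by auto

lemma const_mat_mult_eq_one:
  fixes A B :: "'a::comm_ring_1 mat"
  assumes "A \<in> carrier_mat n n" "B \<in> carrier_mat n n" "A * B = 1\<^sub>m n"
  shows "const_mat A * const_mat B = 1\<^sub>m n"
  using const_poly_hom.mat_hom_mult[OF assms(1,2)] unfolding assms(3) const_poly_hom.mat_hom_one by simp

lemma coeff_mat_mult_const_mat:
  fixes D :: "'a::comm_ring_1 poly mat"
  assumes D: "D \<in> carrier_mat r s" and A: "A \<in> carrier_mat s c"
  shows "coeff_mat (D * const_mat A) i = coeff_mat D i * A"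
proof (rule eq_matI)
  have cD: "coeff_mat D i \<in> carrier_mat r s" and cA: "const_mat A \<in> carrier_mat s c"
    using D A by (auto simp: coeff_mat_def)
  fix p q assume "p < dim_row (coeff_mat D i * A)" "q < dim_col (coeff_mat D i * A)"
  then have pq: "p < r" "q < c" using D A by (auto simp: coeff_mat_def)
  have "coeff_mat (D * const_mat A) i $$ (p, q) = coeff ((D * const_mat A) $$ (p, q)) i"
    using pq D A by (simp add: coeff_mat_def)
  also have "\<dots> = (\<Sum>t<s. coeff (D $$ (p, t)) i * A $$ (t, q))"
    unfolding mult_mat_entry[OF D cA pq] coeff_sum
    using pq A by (intro sum.cong) (auto simp: mult.commute)
  also have "\<dots> = (coeff_mat D i * A) $$ (p, q)"
    unfolding mult_mat_entry[OF cD A pq] using pq D by (intro sum.cong) (auto simp: coeff_mat_def)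
  finally show "coeff_mat (D * const_mat A) i $$ (p, q) = (coeff_mat D i * A) $$ (p, q)" .
qed (use D A in \<open>auto simp: coeff_mat_def\<close>)

lemma append_cols_add:
  fixes A B :: "'a::comm_monoid_add mat"
  assumes "A \<in> carrier_mat r a" "B \<in> carrier_mat r b" "C \<in> carrier_mat r a" "D \<in> carrier_mat r b"
  shows "append_cols A B + append_cols C D = append_cols (A + C) (B + D)"
  unfolding append_cols_def using assms by (auto intro!: eq_matI)

lemma pencil_split_cols:
  fixes Q :: "'a::comm_monoid_add poly mat"
  assumes Q: "Q \<in> carrier_mat r (a + b)" "has_grade 1 Q"
  obtains A1 A0 B1 B0 where "A1 \<in> carrier_mat r a" "A0 \<in> carrier_mat r a"
    "B1 \<in> carrier_mat r b" "B0 \<in> carrier_mat r b" "Q = append_cols (pencil A1 A0) (pencil B1 B0)"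
proof -
  define A where "A s = mat r a (\<lambda>(i, j). coeff (Q $$ (i, j)) s)" for s
  define B where "B s = mat r b (\<lambda>(i, j). coeff (Q $$ (i, a + j)) s)" for s
  have A: "A s \<in> carrier_mat r a" and B: "B s \<in> carrier_mat r b" for s by (simp_all add: A_def B_def)
  have cQ: "coeff_mat Q s \<in> carrier_mat r (a + b)" for s using Q by (simp add: coeff_mat_def)
  have "Q $$ (i, j) = append_cols (pencil (A 1) (A 0)) (pencil (B 1) (B 0)) $$ (i, j)"
    if ij: "i < r" "j < a + b" for i j
  proof -
    have "Q $$ (i, j) = [:coeff (Q $$ (i, j)) 0, coeff (Q $$ (i, j)) 1:]"
      using arg_cong[OF pencil_coeff_mat[OF Q], of "\<lambda>X. X $$ (i, j)"] pencil_index[OF cQ cQ ij, of 1 0] ij Q(1)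
      by (simp add: coeff_mat_def)
    moreover have "append_cols (pencil (A 1) (A 0)) (pencil (B 1) (B 0)) $$ (i, j) =
        [:coeff (Q $$ (i, j)) 0, coeff (Q $$ (i, j)) 1:]"
    proof (cases "j < a")
      case True
      then have "append_cols (pencil (A 1) (A 0)) (pencil (B 1) (B 0)) $$ (i, j) = pencil (A 1) (A 0) $$ (i, j)"
        using ij carrier_matD[OF A] carrier_matD[OF B] by (simp add: append_cols_def)
      then show ?thesis using pencil_index[OF A A ij(1) True, of 1 0] ij True by (simp add: A_def)
    next
      case False
      then have jb: "j - a < b" using ij by simp
      have "append_cols (pencil (A 1) (A 0)) (pencil (B 1) (B 0)) $$ (i, j) = pencil (B 1) (B 0) $$ (i, j - a)"
        using False ij carrier_matD[OF A] carrier_matD[OF B] by (simp add: append_cols_def)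
      then show ?thesis using pencil_index[OF B B ij(1) jb, of 1 0] ij False jb by (simp add: B_def)
    qed
    ultimately show ?thesis by simp
  qed
  then have "Q = append_cols (pencil (A 1) (A 0)) (pencil (B 1) (B 0))"
    using Q carrier_matD[OF append_cols_carrier[OF pencil_carrier[OF A A] pencil_carrier[OF B B]], of 1 0 1 0]
    by (intro eq_matI) auto
  then show thesis by (rule that[OF A A B B])
qed

text \<open>With d = \<open>\<eta> + 1\<close> the hypothesis gives
  \<open>g \<le> 1 / (4 d^3)\<close>, so the product is at most \<open>\<eta> / (4 d^2)\<close>.
  This is at most 1/16 because \<open>4 \<eta> \<le> (\<eta> + 1)^2\<close>, which is tight for
  \<open>\<eta> = 1\<close>.\<close>

lemma perturbation_smallness:
  fixes \<delta> g :: real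
  assumes \<delta>: "0 \<le> \<delta>" "\<delta> < 1 / (2 * real (\<eta> + 1) powr (3 / 2))" and g: "g \<le> \<delta>\<^sup>2"
  shows "real (\<eta> * (\<eta> + 1)) * g \<le> 1 / 16" "\<delta> < 1"
proof -
  define d where "d = real (\<eta> + 1)"
  have d: "d \<ge> 1" by (simp add: d_def)
  have p: "d powr (3 / 2) \<ge> 1" using d by (simp add: ge_one_powr_ge_zero)
  have "1 / (2 * d powr (3 / 2)) \<le> 1" using p by (auto simp: divide_le_eq_1)
  then show "\<delta> < 1" by (rule less_le_trans[OF \<delta>(2)[folded d_def]])
  have "(d powr (3 / 2))\<^sup>2 = d powr 3"
    using d by (simp add: power2_eq_square powr_add[symmetric])
  also have "\<dots> = d ^ 3" using d by (simp add: powr_numeral)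
  finally have d3: "(d powr (3 / 2))\<^sup>2 = d ^ 3" .
  have "g \<le> (1 / (2 * d powr (3 / 2)))\<^sup>2"
    using g power_mono[OF less_imp_le[OF \<delta>(2)[folded d_def]] \<delta>(1), of 2] by (rule order_trans)
  also have "\<dots> = 1 / (4 * d ^ 3)" by (simp add: power_divide power_mult_distrib d3)
  finally have g': "g \<le> 1 / (4 * d ^ 3)" .
  have "real (\<eta> * (\<eta> + 1)) * g \<le> real (\<eta> * (\<eta> + 1)) * (1 / (4 * d ^ 3))"
    using g' by (intro mult_left_mono) auto
  also have "\<dots> = (real \<eta> * d) * (1 / (4 * d ^ 3))" by (simp add: d_def algebra_simps)
  also have "\<dots> = real \<eta> / (4 * d\<^sup>2)"
    using d by (simp add: power3_eq_cube power2_eq_square)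
  also have "\<dots> \<le> 1 / 16"
  proof -
    have "4 * real \<eta> \<le> d\<^sup>2"
      using sum_squares_ge_zero[of "real \<eta> - 1" 0] by (simp add: d_def power2_eq_square algebra_simps)
    then show ?thesis using d by (simp add: field_simps)
  qed
  finally show "real (\<eta> * (\<eta> + 1)) * g \<le> 1 / 16" .
qed

text \<open>Treats the row form with the bound cleared of its quotients. The perturbation is found
  from \<open>M + H = A (M + N)\<close>, where \<open>N\<close> perturbs \<open>M\<close>: then
  \<open>P + \<Delta>P\<close> is \<open>D\<close> times \<open>A (M + N)\<close>, and
  \<open>D\<close> times \<open>A\<close> is the dual basis of the perturbed block.\<close>

lemma block_kronecker_row_perturbation:
  fixes M1 M0 :: "'a::real_normed_field mat" and \<Delta>L :: "'a poly mat"
  assumes m: "m > 0"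
    and M: "M1 \<in> carrier_mat (\<eta> * m + m) n" "M0 \<in> carrier_mat (\<eta> * m + m) n"
    and \<Delta>L: "\<Delta>L \<in> carrier_mat (\<eta> * m + m) (n + \<eta> * m)" "has_grade 1 \<Delta>L"
    and small: "poly_frobenius_norm \<Delta>L < 1 / (2 * real (\<eta> + 1) powr (3 / 2))"
  defines "L \<equiv> block_kronecker_row m \<eta> M1 M0"
    and "P \<equiv> kronecker (transpose_mat (Lambda_col \<eta>)) (1\<^sub>m m) * pencil M1 M0"
  shows "\<exists>\<Delta>P. \<Delta>P \<in> carrier_mat m n \<and>
           is_strong_linearization (\<eta> + 1) (L + \<Delta>L) (P + \<Delta>P) \<and>
           poly_frobenius_norm \<Delta>P
             \<le> 2 * real (\<eta> + 1) * (1 + poly_frobenius_norm (pencil M1 M0)) * poly_frobenius_norm \<Delta>L \<and>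
           (\<forall>\<alpha>. are_right_minimal_indices (P + \<Delta>P) \<alpha> \<longrightarrow> are_right_minimal_indices (L + \<Delta>L) \<alpha>) \<and>
           (\<forall>\<alpha>. are_left_minimal_indices (P + \<Delta>P) \<alpha> \<longrightarrow>
                 are_left_minimal_indices (L + \<Delta>L) (map (\<lambda>a. a + \<eta>) \<alpha>))"
proof -
  define k where "k = \<eta> * m"
  define N where "N = k + m"
  note M' = M[folded k_def, folded N_def]
  obtain N1 N0 G1 G0 where Nc: "N1 \<in> carrier_mat N n" "N0 \<in> carrier_mat N n"
    and Gc: "G1 \<in> carrier_mat N k" "G0 \<in> carrier_mat N k"
    and \<Delta>L_eq: "\<Delta>L = append_cols (pencil N1 N0) (pencil G1 G0)"
    using pencil_split_cols[OF \<Delta>L] unfolding N_def k_def by blast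
  define \<delta> where "\<delta> = poly_frobenius_norm \<Delta>L"
  define \<delta>M where "\<delta>M = poly_frobenius_norm (pencil N1 N0)"
  define \<delta>K where "\<delta>K = poly_frobenius_norm (pencil G1 G0)"
  define \<mu> where "\<mu> = poly_frobenius_norm (pencil M1 M0)"
  have nonneg: "\<delta> \<ge> 0" "\<delta>M \<ge> 0" "\<delta>K \<ge> 0" "\<mu> \<ge> 0"
    unfolding \<delta>M_def \<delta>K_def \<mu>_def \<delta>_def
    by (rule poly_frobenius_norm_nonneg[OF \<Delta>L] poly_frobenius_norm_nonneg_pencil[OF Nc]
        poly_frobenius_norm_nonneg_pencil[OF Gc] poly_frobenius_norm_nonneg_pencil[OF M'])+
  have split: "\<delta>\<^sup>2 = \<delta>M\<^sup>2 + \<delta>K\<^sup>2"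
    unfolding \<delta>_def \<delta>M_def \<delta>K_def \<Delta>L_eq by (rule poly_frobenius_norm_append_cols[OF Nc Gc])
  have le_\<delta>: "\<delta>M \<le> \<delta>" "\<delta>K \<le> \<delta>"
    using nonneg split by (auto intro!: power2_le_imp_le[of _ \<delta>])
  have \<delta>K2: "(frobenius_norm G1)\<^sup>2 + (frobenius_norm G0)\<^sup>2 = \<delta>K\<^sup>2"
    unfolding \<delta>K_def poly_frobenius_norm_pencil[OF Gc] by simp
  have "\<delta>K\<^sup>2 \<le> \<delta>\<^sup>2" using split by simp
  note sm = perturbation_smallness[OF nonneg(1) small[folded \<delta>_def] this]
  have "(frobenius_norm G1)\<^sup>2 \<le> \<delta>\<^sup>2" using \<delta>K2 split by (smt (verit) zero_le_power2)
  then have "frobenius_norm G1 \<le> \<delta>" using nonneg(1) by (rule power2_le_imp_le)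
  then have G1_less: "frobenius_norm G1 < 1" using sm(2) by simp
  let ?E1 = "bidiag k m 0 1 :: 'a mat" and ?E0 = "bidiag k m 1 0 :: 'a mat"
  have E: "?E1 \<in> carrier_mat N k" "?E0 \<in> carrier_mat N k" by (simp_all add: N_def)
  obtain X Ai Z Zi where X: "X \<in> carrier_mat N N" and Ai: "Ai \<in> carrier_mat N N"
    and inv: "(1\<^sub>m N + X) * Ai = 1\<^sub>m N" "Ai * (1\<^sub>m N + X) = 1\<^sub>m N"
    and Z: "Z \<in> carrier_mat k k" "Zi \<in> carrier_mat k k" "Z * Zi = 1\<^sub>m k" "Zi * Z = 1\<^sub>m k"
    and eq1: "(1\<^sub>m N + X) * (?E1 + G1) = ?E1 * Z" and eq0: "(1\<^sub>m N + X) * (?E0 + G0) = ?E0 * Z"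
    and X_le: "frobenius_norm X \<le> 4 / 3 * sqrt (real (\<eta> * (\<eta> + 1)) * \<delta>K\<^sup>2)"
    and F1_inj: "\<And>v. v \<in> carrier_vec k \<Longrightarrow> (?E1 + G1) *\<^sub>v v = 0\<^sub>v N \<Longrightarrow> v = 0\<^sub>v k"
    using bidiag_strictly_equivalent[OF m, of G1 \<eta> G0] Gc sm(1) G1_less
    unfolding N_def k_def \<delta>K2 by metis
  define A where "A = 1\<^sub>m N + X"
  have A: "A \<in> carrier_mat N N" using X by (simp add: A_def)
  note inv' = inv[folded A_def] and eqs = eq1[folded A_def] eq0[folded A_def]
  define F1 where "F1 = ?E1 + G1"
  define F0 where "F0 = ?E0 + G0"
  define B1 where "B1 = M1 + N1"
  define B0 where "B0 = M0 + N0"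
  have F: "F1 \<in> carrier_mat N k" "F0 \<in> carrier_mat N k" using E Gc by (auto simp: F1_def F0_def)
  have B: "B1 \<in> carrier_mat N n" "B0 \<in> carrier_mat N n" using M' Nc by (auto simp: B1_def B0_def)
  define D where "D = (mat m (k + m) (\<lambda>(r, q). shift_power m (k + r) q) :: 'a poly mat)"
  define Dr where "Dr = (mat m (k + m) (\<lambda>(r, q). shift_power m q r) :: 'a poly mat)"
  have D: "D \<in> carrier_mat m N" and Dr: "Dr \<in> carrier_mat m N" by (simp_all add: D_def Dr_def N_def)
  have D_grade: "has_grade \<eta> D" unfolding D_def k_def by (rule has_grade_shift_power)
  have rev_D: "rev_mat \<eta> D = Dr"
    unfolding D_def Dr_def rev_mat_def k_def by (rule eq_matI) (auto simp: rev_shift_power)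
  have P_eq: "P = D * pencil M1 M0"
    unfolding P_def kronecker_Lambda_col D_def k_def ..
  have L_eq: "L = append_cols (pencil M1 M0) (pencil ?E1 ?E0)"
    unfolding L_def block_kronecker_row_def kronecker_L_pencil pencil_bidiag k_def ..
  have LL: "L + \<Delta>L = append_cols (pencil B1 B0) (pencil F1 F0)"
    unfolding L_eq \<Delta>L_eq
    by (simp add: append_cols_add[OF pencil_carrier[OF M'] pencil_carrier[OF E] pencil_carrier[OF Nc] pencil_carrier[OF Gc]]
        pencil_add[OF M' Nc] pencil_add[OF E Gc] B1_def B0_def F1_def F0_def)
  let ?c = "const_mat :: 'a mat \<Rightarrow> 'a poly mat"
  have cA: "?c A \<in> carrier_mat N N" "?c Ai \<in> carrier_mat N N" "?c A * ?c Ai = 1\<^sub>m N" "?c Ai * ?c A = 1\<^sub>m N"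
    using A Ai const_mat_mult_eq_one[OF A Ai inv'(1)] const_mat_mult_eq_one[OF Ai A inv'(2)] by auto
  have cZ: "?c Z \<in> carrier_mat k k" "?c Zi \<in> carrier_mat k k" "?c Z * ?c Zi = 1\<^sub>m k" "?c Zi * ?c Z = 1\<^sub>m k"
    using Z const_mat_mult_eq_one[OF Z(1,2,3)] const_mat_mult_eq_one[OF Z(2,1,4)] by auto
  have eqF: "A * F1 = ?E1 * Z" "A * F0 = ?E0 * Z" using eqs by (simp_all add: F1_def F0_def)
  have AF: "?c A * pencil F1 F0 = bidiag k m 1 [:0, 1:] * ?c Z"
    unfolding const_mat_mult_pencil[OF A F] eqF pencil_mult_const_mat[OF Z(1) E, symmetric] pencil_bidiag ..
  \<comment> \<open>The relation between \<open>F\<close> and \<open>K\<close> holds for each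
    coefficient separately, so it survives their exchange with the same \<open>A\<close> and
    \<open>Z\<close>.\<close>
  have AFr: "?c A * pencil F0 F1 = bidiag k m [:0, 1:] 1 * ?c Z"
    unfolding const_mat_mult_pencil[OF A F(2,1)] eqF pencil_mult_const_mat[OF Z(1) E(2,1), symmetric] pencil_bidiag ..
  note fr = dual_frame_conj[OF dual_frame_bidiag[OF m] cA[unfolded N_def] cZ pencil_carrier[OF F[unfolded N_def]] AF,
      folded D_def]
  note frr = dual_frame_conj[OF dual_frame_bidiag_rev[OF m] cA[unfolded N_def] cZ pencil_carrier[OF F(2,1)[unfolded N_def]] AFr,
      folded Dr_def]
  note Bp = pencil_carrier[OF B[unfolded N_def]] and Bpr = pencil_carrier[OF B(2,1)[unfolded N_def]]
  note F_grade = has_grade_append_cols[OF pencil_carrier[OF B] pencil_carrier[OF F] has_grade_pencil[OF B] has_grade_pencil[OF F]]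
  note Fr_grade = has_grade_append_cols[OF pencil_carrier[OF B(2,1)] pencil_carrier[OF F(2,1)]
      has_grade_pencil[OF B(2,1)] has_grade_pencil[OF F(2,1)]]
  have AB: "A * B1 \<in> carrier_mat N n" "A * B0 \<in> carrier_mat N n" using A B by auto
  have DAB: "D * ?c A * pencil B1 B0 = D * pencil (A * B1) (A * B0)"
    unfolding assoc_mult_mat[OF D cA(1) pencil_carrier[OF B]] const_mat_mult_pencil[OF A B] ..
  have DrAB: "Dr * ?c A * pencil B0 B1 = Dr * pencil (A * B0) (A * B1)"
    unfolding assoc_mult_mat[OF Dr cA(1) pencil_carrier[OF B(2,1)]] const_mat_mult_pencil[OF A B(2,1)] ..
  \<comment> \<open>\<open>N1 + X * B1\<close> equals \<open>A * B1 - M1\<close>; this form exposes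
    the two small factors \<open>N1\<close> and \<open>X\<close>.\<close>
  define H1 where "H1 = N1 + X * B1"
  define H0 where "H0 = N0 + X * B0"
  have XB: "X * B1 \<in> carrier_mat N n" "X * B0 \<in> carrier_mat N n" using X B by auto
  have H: "H1 \<in> carrier_mat N n" "H0 \<in> carrier_mat N n" using Nc XB by (auto simp: H1_def H0_def)
  have AB_eq: "A * B1 = B1 + X * B1" "A * B0 = B0 + X * B0"
    unfolding A_def add_mult_distrib_mat[OF one_carrier_mat X B(1)] add_mult_distrib_mat[OF one_carrier_mat X B(2)]
      left_mult_one_mat[OF B(1)] left_mult_one_mat[OF B(2)] by simp_all
  have MH: "M1 + H1 = A * B1" "M0 + H0 = A * B0"
    unfolding AB_eq H1_def H0_def
    using assoc_add_mat[OF M'(1) Nc(1) XB(1)] assoc_add_mat[OF M'(2) Nc(2) XB(2)]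
    by (simp_all add: B1_def B0_def)
  define \<Delta>P where "\<Delta>P = D * pencil H1 H0"
  have \<Delta>P: "\<Delta>P \<in> carrier_mat m n" unfolding \<Delta>P_def by (rule mult_carrier_mat[OF D pencil_carrier[OF H]])
  have PP': "P + \<Delta>P = D * pencil (A * B1) (A * B0)"
    unfolding P_eq \<Delta>P_def mult_add_distrib_mat[OF D pencil_carrier[OF M'] pencil_carrier[OF H], symmetric]
      pencil_add[OF M' H] MH ..
  then have PP: "P + \<Delta>P = D * ?c A * pencil B1 B0" unfolding DAB .
  have grade_PP: "has_grade (\<eta> + 1) (P + \<Delta>P)"
    unfolding PP' by (rule has_grade_mult[OF D D_grade pencil_carrier[OF AB] has_grade_pencil[OF AB]])
  have "rev_mat (\<eta> + 1) (P + \<Delta>P) = Dr * ?c A * pencil B0 B1"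
    unfolding PP' rev_mat_mult[OF D D_grade pencil_carrier[OF AB] has_grade_pencil[OF AB]] rev_D
      rev_mat_pencil[OF AB] DrAB ..
  moreover have "rev_mat 1 (L + \<Delta>L) = append_cols (pencil B0 B1) (pencil F0 F1)"
    unfolding LL rev_mat_append_cols[OF pencil_carrier[OF B] pencil_carrier[OF F]] rev_mat_pencil[OF B] rev_mat_pencil[OF F] ..
  ultimately have strong: "is_strong_linearization (\<eta> + 1) (L + \<Delta>L) (P + \<Delta>P)"
    unfolding is_strong_linearization_def
    using grade_PP dual_frame_linearization[OF fr Bp F_grade] dual_frame_linearization[OF frr Bpr Fr_grade]
    by (simp add: LL PP)
  have right: "are_right_minimal_indices (L + \<Delta>L) \<alpha>" if "are_right_minimal_indices (P + \<Delta>P) \<alpha>" for \<alpha>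
    unfolding LL
  proof (rule dual_frame_right_minimal_indices[OF fr Bp _ that[unfolded PP]])
    fix x y assume "x \<in> carrier_vec n" "y \<in> carrier_vec k"
      "pencil B1 B0 *\<^sub>v x + pencil F1 F0 *\<^sub>v y = 0\<^sub>v (k + m)"
    then show "vec_degree (x @\<^sub>v y) = vec_degree x"
      using vec_degree_append_pencil[OF B F] F1_inj unfolding F1_def N_def by blast
  qed
  have left: "are_left_minimal_indices (L + \<Delta>L) (map (\<lambda>a. a + \<eta>) \<alpha>)" if "are_left_minimal_indices (P + \<Delta>P) \<alpha>" for \<alpha>
    unfolding LL
  proof (rule dual_frame_left_minimal_indices[OF fr Bp _ that[unfolded PP]])
    fix z :: "'a poly vec" assume z: "z \<in> carrier_vec m" "z \<noteq> 0\<^sub>v m"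
    have DA: "D * ?c A \<in> carrier_mat m N" using D cA by auto
    have "has_grade (\<eta> + 0) (D * ?c A)"
      by (rule has_grade_mult[OF D D_grade cA(1) has_grade_const_mat])
    then show "vec_degree (transpose_mat (D * ?c A) *\<^sub>v z) = vec_degree z + \<eta>"
      unfolding add_0_right
    proof (rule vec_degree_transpose_mult[OF DA _ _ z])
      fix v :: "'a vec" assume v: "v \<in> carrier_vec m"
      define S where "S = coeff_mat D \<eta>"
      have S: "S \<in> carrier_mat m N" using D by (simp add: S_def coeff_mat_def)
      have SA: "S * A \<in> carrier_mat m N" using S A by auto
      assume "transpose_mat (coeff_mat (D * ?c A) \<eta>) *\<^sub>v v = 0\<^sub>v N"
      then have "transpose_mat (S * A) *\<^sub>v v = 0\<^sub>v N"
        unfolding coeff_mat_mult_const_mat[OF D A] S_def .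
      \<comment> \<open>Multiplying by the inverse removes \<open>A\<close> and leaves the leading
        coefficient of the unperturbed dual basis, \<open>[1 0]\<close>, whose transpose displays
        \<open>v\<close> in its first \<open>m\<close> rows.\<close>
      then have "transpose_mat Ai *\<^sub>v (transpose_mat (S * A) *\<^sub>v v) = 0\<^sub>v N"
        using mult_mat_zero_vec[of "transpose_mat Ai" N N] Ai by simp
      moreover have "transpose_mat Ai *\<^sub>v (transpose_mat (S * A) *\<^sub>v v) = (transpose_mat Ai * transpose_mat (S * A)) *\<^sub>v v"
        by (rule assoc_mult_mat_vec[symmetric, of _ N N _ m]) (use Ai SA v in auto)
      moreover have "transpose_mat Ai * transpose_mat (S * A) = transpose_mat S"
        unfolding transpose_mult[OF SA Ai, symmetric] assoc_mult_mat[OF S A Ai] inv'(1) right_mult_one_mat[OF S] ..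
      ultimately have "transpose_mat S *\<^sub>v v = 0\<^sub>v N" by simp
      moreover have "(transpose_mat S *\<^sub>v v) $ r = v $ r" if r: "r < m" for r
      proof -
        have rN: "r < N" using r by (simp add: N_def)
        have tS: "transpose_mat S \<in> carrier_mat N m" using S by simp
        have "(transpose_mat S *\<^sub>v v) $ r = (\<Sum>t<m. if t = r then v $ t else 0)"
          unfolding mult_mat_vec_entry[OF tS v rN]
          using r by (intro sum.cong) (auto simp: S_def D_def k_def coeff_mat_shift_power)
        then show ?thesis using r by simp
      qed
      ultimately have "v $ r = 0" if "r < m" for r
        using that by (metis N_def index_zero_vec(1) trans_less_add2)
      then show "v = 0\<^sub>v m" using v by auto
    qed
  qed
  have bound: "poly_frobenius_norm \<Delta>P \<le> 2 * real (\<eta> + 1) * (1 + \<mu>) * \<delta>"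
  proof -
    define d where "d = real (\<eta> + 1)"
    define \<xi> where "\<xi> = frobenius_norm X"
    have d: "d \<ge> 1" by (simp add: d_def)
    have \<xi>0: "\<xi> \<ge> 0" by (simp add: \<xi>_def frobenius_norm_nonneg)
    have "sqrt (real (\<eta> * (\<eta> + 1)) * \<delta>K\<^sup>2) \<le> sqrt (d\<^sup>2 * \<delta>K\<^sup>2)"
      by (intro real_sqrt_le_mono mult_right_mono) (auto simp: d_def power2_eq_square algebra_simps)
    also have "\<dots> = d * \<delta>K" using d nonneg by (simp add: real_sqrt_mult)
    finally have \<xi>_le: "\<xi> \<le> 4 / 3 * (d * \<delta>K)" using X_le by (simp add: \<xi>_def)
    have "sqrt (real (\<eta> * (\<eta> + 1)) * \<delta>K\<^sup>2) \<le> sqrt ((1 / 4)\<^sup>2)"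
      using sm(1) by (intro real_sqrt_le_mono) (simp add: power2_eq_square)
    then have \<xi>_third: "\<xi> \<le> 1 / 3" using X_le by (simp add: \<xi>_def)
    have "poly_frobenius_norm (pencil H1 H0) \<le> \<delta>M + poly_frobenius_norm (pencil (X * B1) (X * B0))"
      unfolding H1_def H0_def \<delta>M_def by (rule poly_frobenius_norm_pencil_add_le[OF Nc XB])
    also have "\<dots> \<le> \<delta>M + \<xi> * poly_frobenius_norm (pencil B1 B0)"
      using poly_frobenius_norm_pencil_mult_le[OF X B] by (simp add: \<xi>_def)
    also have "\<dots> \<le> \<delta>M + \<xi> * (\<mu> + \<delta>M)"
      using poly_frobenius_norm_pencil_add_le[OF M' Nc] \<xi>0
      by (simp add: B1_def B0_def \<mu>_def \<delta>M_def mult_left_mono)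
    \<comment> \<open>The two bounds on \<open>\<xi>\<close> are used in different places: the
      absolute bound 1/3 absorbs the product of two perturbations, the linear bound handles the term
      with \<open>\<mu>\<close>.\<close>
    also have "\<dots> \<le> 4 / 3 * \<delta>M + 4 / 3 * (d * \<delta>K) * \<mu>"
      using mult_right_mono[OF \<xi>_third nonneg(2)] mult_right_mono[OF \<xi>_le nonneg(4)]
      by (simp add: distrib_left)
    also have "\<dots> \<le> 4 / 3 * (d * \<delta>) + 4 / 3 * (d * \<delta>) * \<mu>"
    proof (intro add_mono mult_left_mono mult_right_mono)
      have "\<delta>M \<le> 1 * \<delta>" using le_\<delta> by simp
      also have "\<dots> \<le> d * \<delta>" using d nonneg by (intro mult_right_mono) auto
      finally show "\<delta>M \<le> d * \<delta>" .
    qed (use nonneg le_\<delta> d in auto)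
    finally have H_le: "poly_frobenius_norm (pencil H1 H0) \<le> 4 / 3 * (d * (1 + \<mu>) * \<delta>)"
      by (simp add: algebra_simps)
    have "poly_frobenius_norm \<Delta>P \<le> sqrt 2 * poly_frobenius_norm (pencil H1 H0)"
      unfolding \<Delta>P_def D_def k_def using H unfolding N_def k_def
      by (intro poly_frobenius_norm_Lambda_mult_le[OF m])
    \<comment> \<open>Rounding \<open>sqrt 2\<close> to 3/2 is exactly what the constant 2 of the
      claim allows, as 3/2 times 4/3 is 2.\<close>
    also have "\<dots> \<le> 3 / 2 * (4 / 3 * (d * (1 + \<mu>) * \<delta>))"
    proof (intro mult_mono H_le)
      show "sqrt 2 \<le> 3 / 2" by (rule real_le_lsqrt) (auto simp: power2_eq_square)
    qed (use poly_frobenius_norm_nonneg_pencil[OF H] in auto)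
    also have "\<dots> = 2 * d * (1 + \<mu>) * \<delta>" by (simp add: field_simps)
    finally show ?thesis unfolding d_def .
  qed
  show ?thesis
    using \<Delta>P strong right left bound unfolding \<mu>_def \<delta>_def by blast
qed

text \<open>Needed for the bound in quotient form. For \<open>\<eta> = 0\<close> the Kronecker block
  has no columns, so the argument goes through \<open>M\<close>: if it were zero, then so would be
  the product with the dual basis.\<close>

lemma block_kronecker_row_norm_nonzero:
  fixes M1 M0 :: "'a::real_normed_field mat"
  assumes M: "M1 \<in> carrier_mat (\<eta> * m + m) n" "M0 \<in> carrier_mat (\<eta> * m + m) n"
    and P: "kronecker (transpose_mat (Lambda_col \<eta>)) (1\<^sub>m m) * pencil M1 M0 \<noteq> 0\<^sub>m m n"
  shows "poly_frobenius_norm (block_kronecker_row m \<eta> M1 M0) \<noteq> 0"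
proof
  assume 0: "poly_frobenius_norm (block_kronecker_row m \<eta> M1 M0) = 0"
  have "(poly_frobenius_norm (block_kronecker_row m \<eta> M1 M0))\<^sup>2 =
      (poly_frobenius_norm (pencil M1 M0))\<^sup>2
      + (poly_frobenius_norm (pencil (bidiag (\<eta> * m) m 0 1) (bidiag (\<eta> * m) m 1 0 :: 'a mat)))\<^sup>2"
    unfolding block_kronecker_row_def kronecker_L_pencil pencil_bidiag(1)[symmetric]
    by (rule poly_frobenius_norm_append_cols[OF M bidiag_carrier bidiag_carrier])
  then have "(poly_frobenius_norm (pencil M1 M0))\<^sup>2 = 0"
    using 0 by (smt (verit) zero_le_power2 zero_power2)
  then have z: "(\<Sum>i<\<eta> * m + m. \<Sum>j<n. (norm (M1 $$ (i, j)))\<^sup>2) + (\<Sum>i<\<eta> * m + m. \<Sum>j<n. (norm (M0 $$ (i, j)))\<^sup>2) = 0"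
    unfolding poly_frobenius_norm_pencil[OF M] frobenius_norm_sq[OF M(1)] frobenius_norm_sq[OF M(2)]
    by (simp add: sum_nonneg)
  have "pencil M1 M0 $$ (i, j) = 0" if "i < \<eta> * m + m" "j < n" for i j
  proof -
    have "(\<Sum>i<\<eta> * m + m. \<Sum>j<n. (norm (M1 $$ (i, j)))\<^sup>2) = 0" "(\<Sum>i<\<eta> * m + m. \<Sum>j<n. (norm (M0 $$ (i, j)))\<^sup>2) = 0"
      using z by (simp_all add: add_nonneg_eq_0_iff sum_nonneg)
    then have "M1 $$ (i, j) = 0" "M0 $$ (i, j) = 0"
      using that by (simp_all add: sum_nonneg_eq_0_iff sum_nonneg)
    then show ?thesis by (simp add: pencil_index[OF M that])
  qed
  then have "pencil M1 M0 = 0\<^sub>m (\<eta> * m + m) n"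
    using M by (intro eq_matI) auto
  then have "kronecker (transpose_mat (Lambda_col \<eta>)) (1\<^sub>m m) * pencil M1 M0 = 0\<^sub>m m n"
    unfolding kronecker_Lambda_col by (simp add: right_mult_zero_mat[of _ m "\<eta> * m + m"])
  then show False using P by simp
qed

section \<open>Transposition and reduction of the column form\<close>

lemma is_linearization_transpose:
  fixes L P :: "'a::field poly mat"
  assumes "is_linearization L P"
  shows "is_linearization (transpose_mat L) (transpose_mat P)"
proof -
  obtain s U V where grade: "has_grade 1 L" and L: "L \<in> carrier_mat (s + dim_row P) (s + dim_col P)"
    and U: "unimodular (s + dim_row P) U" and V: "unimodular (s + dim_col P) V"
    and eq: "U * L * V = diag_block_mat [1\<^sub>m s, P]"
    using assms unfolding is_linearization_def by blast
  have Uc: "U \<in> carrier_mat (s + dim_row P) (s + dim_row P)" and Vc: "V \<in> carrier_mat (s + dim_col P) (s + dim_col P)"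
    using U V by (auto simp: unimodular_def)
  have diag: "diag_block_mat [1\<^sub>m s, Q] = four_block_mat (1\<^sub>m s) (0\<^sub>m s (dim_col Q)) (0\<^sub>m (dim_row Q) s) Q"
    for Q :: "'a poly mat"
    unfolding diag_block_mat.simps(2)[of "1\<^sub>m s"] diag_block_mat_singleton Let_def by simp
  have "transpose_mat V * transpose_mat L * transpose_mat U = transpose_mat V * (transpose_mat L * transpose_mat U)"
    by (rule assoc_mult_mat) (use Uc Vc L in auto)
  also have "\<dots> = transpose_mat (U * L * V)"
    using transpose_mult[OF mult_carrier_mat[OF Uc L] Vc] transpose_mult[OF Uc L] by simp
  also have "\<dots> = diag_block_mat [1\<^sub>m s, transpose_mat P]"
    unfolding eq diag
    by (subst transpose_four_block_mat[of _ s s _ "dim_col P" _ "dim_row P"]) auto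
  finally have eq': "transpose_mat V * transpose_mat L * transpose_mat U = diag_block_mat [1\<^sub>m s, transpose_mat P]" .
  have "unimodular (s + dim_row P) (transpose_mat U)" "unimodular (s + dim_col P) (transpose_mat V)"
    using U V det_transpose[OF Uc] det_transpose[OF Vc] by (auto simp: unimodular_def)
  moreover have "has_grade 1 (transpose_mat L)" using grade by (auto simp: has_grade_def)
  moreover have "transpose_mat L \<in> carrier_mat (s + dim_col P) (s + dim_row P)" using L by simp
  ultimately show ?thesis unfolding is_linearization_def using eq' by auto
qed

lemma is_strong_linearization_transpose:
  fixes L P :: "'a::field poly mat"
  assumes "is_strong_linearization d L P"
  shows "is_strong_linearization d (transpose_mat L) (transpose_mat P)"
proof -
  have rev: "rev_mat e (transpose_mat Q) = transpose_mat (rev_mat e Q)" for e and Q :: "'a poly mat"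
    by (auto simp: rev_mat_def)
  have "has_grade d (transpose_mat P)"
    using assms by (auto simp: is_strong_linearization_def has_grade_def)
  then show ?thesis
    using assms is_linearization_transpose unfolding is_strong_linearization_def rev by blast
qed

lemma poly_frobenius_norm_transpose: "poly_frobenius_norm (transpose_mat R) = poly_frobenius_norm R"
proof -
  have "frobenius_norm (coeff_mat (transpose_mat R) s) = frobenius_norm (coeff_mat R s)" for s
    unfolding frobenius_norm_def coeff_mat_def by (simp, subst sum.swap) simp
  then show ?thesis by (simp add: poly_frobenius_norm_def)
qed

lemma transpose_kronecker:
  "transpose_mat (kronecker A B) = kronecker (transpose_mat A) (transpose_mat B)"
proof (rule eq_matI)
  fix i j
  assume "i < dim_row (kronecker (transpose_mat A) (transpose_mat B))"
    "j < dim_col (kronecker (transpose_mat A) (transpose_mat B))"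
  then have ij: "i < dim_col A * dim_col B" "j < dim_row A * dim_row B" by (auto simp: kronecker_def)
  then have "dim_col B > 0" "dim_row B > 0" by (auto intro: Nat.gr0I)
  then show "transpose_mat (kronecker A B) $$ (i, j) = kronecker (transpose_mat A) (transpose_mat B) $$ (i, j)"
    using ij by (simp add: kronecker_def less_mult_imp_div_less)
qed (auto simp: kronecker_def)

lemma transpose_append_rows:
  assumes "A \<in> carrier_mat a c" "B \<in> carrier_mat b c"
  shows "transpose_mat (append_rows A B) = append_cols (transpose_mat A) (transpose_mat B)"
  unfolding append_rows_def append_cols_def using assms by (auto intro!: eq_matI)

lemma transpose_block_kronecker_col:
  fixes M1 M0 :: "'a::comm_ring_1 mat"
  assumes M: "M1 \<in> carrier_mat m (\<epsilon> * n + n)" "M0 \<in> carrier_mat m (\<epsilon> * n + n)"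
  shows "transpose_mat (block_kronecker_col n \<epsilon> M1 M0) =
    block_kronecker_row n \<epsilon> (transpose_mat M1) (transpose_mat M0)"
proof -
  have K: "kronecker (L_pencil \<epsilon>) (1\<^sub>m n :: 'a poly mat) \<in> carrier_mat (\<epsilon> * n) (\<epsilon> * n + n)"
    by (auto simp: kronecker_def L_pencil_def)
  show ?thesis
    unfolding block_kronecker_col_def block_kronecker_row_def
      transpose_append_rows[OF pencil_carrier[OF M] K] transpose_pencil[OF M] transpose_kronecker by simp
qed

text \<open>The factor \<open>l\<close> cancels since it is nonzero. For \<open>p = 0\<close> both
  sides are 0 by the convention on division.\<close>

lemma relative_bound:
  fixes x p l \<delta> c \<mu> :: real
  assumes "x \<le> c * \<mu> * \<delta>" "l \<noteq> 0" "p \<ge> 0"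
  shows "x / p \<le> c * (l / p) * \<mu> * (\<delta> / l)"
proof -
  have "c * (l / p) * \<mu> * (\<delta> / l) = (c * \<mu> * \<delta>) / p"
    using assms(2) by (cases "p = 0") (auto simp: field_simps)
  then show ?thesis using divide_right_mono[OF assms(1,3)] by simp
qed

theorem theorem5p22:
  fixes P L \<Delta>L :: "'a::real_normed_field poly mat"
    and M1 M0 :: "'a mat"
    and m n d \<epsilon> \<eta> :: nat
  assumes P: "P \<in> carrier_mat m n" "has_grade d P" "P \<noteq> 0\<^sub>m m n"
    and L: "(\<epsilon> = 0 \<and> d = \<eta> + 1 \<and>
               M1 \<in> carrier_mat ((\<eta> + 1) * m) n \<and> M0 \<in> carrier_mat ((\<eta> + 1) * m) n \<and>
               L = block_kronecker_row m \<eta> M1 M0 \<and>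
               P = kronecker (transpose_mat (Lambda_col \<eta>)) (1\<^sub>m m) * pencil M1 M0)
          \<or> (\<eta> = 0 \<and> d = \<epsilon> + 1 \<and>
               M1 \<in> carrier_mat m ((\<epsilon> + 1) * n) \<and> M0 \<in> carrier_mat m ((\<epsilon> + 1) * n) \<and>
               L = block_kronecker_col n \<epsilon> M1 M0 \<and>
               P = pencil M1 M0 * kronecker (Lambda_col \<epsilon>) (1\<^sub>m n))"
    and \<Delta>L: "\<Delta>L \<in> carrier_mat (dim_row L) (dim_col L)" "has_grade 1 \<Delta>L"
    and small: "poly_frobenius_norm \<Delta>L < 1 / (2 * real d powr (3 / 2))"
  shows "\<exists>\<Delta>P. \<Delta>P \<in> carrier_mat m n \<and>
           is_strong_linearization d (L + \<Delta>L) (P + \<Delta>P) \<and>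
           poly_frobenius_norm \<Delta>P / poly_frobenius_norm P
             \<le> 2 * real d * (poly_frobenius_norm L / poly_frobenius_norm P)
                 * (1 + poly_frobenius_norm (pencil M1 M0))
                 * (poly_frobenius_norm \<Delta>L / poly_frobenius_norm L) \<and>
           (\<forall>\<alpha>. are_right_minimal_indices (P + \<Delta>P) \<alpha> \<longrightarrow>
                 are_right_minimal_indices (L + \<Delta>L) (map (\<lambda>a. a + \<epsilon>) \<alpha>)) \<and>
           (\<forall>\<alpha>. are_left_minimal_indices (P + \<Delta>P) \<alpha> \<longrightarrow>
                 are_left_minimal_indices (L + \<Delta>L) (map (\<lambda>a. a + \<eta>) \<alpha>))"
proof -
  \<comment> \<open>A matrix without rows or columns would equal the zero matrix.\<close>
  have m: "m > 0" and n: "n > 0" using P(1,3) by (auto simp: mat_eq_iff intro!: Nat.gr0I)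
  have P0: "poly_frobenius_norm P \<ge> 0" by (rule poly_frobenius_norm_nonneg[OF P(1,2)])
  from L show ?thesis
  proof (elim disjE conjE)
    assume row: "\<epsilon> = 0" "d = \<eta> + 1" "M1 \<in> carrier_mat ((\<eta> + 1) * m) n" "M0 \<in> carrier_mat ((\<eta> + 1) * m) n"
      "L = block_kronecker_row m \<eta> M1 M0"
      "P = kronecker (transpose_mat (Lambda_col \<eta>)) (1\<^sub>m m) * pencil M1 M0"
    have M: "M1 \<in> carrier_mat (\<eta> * m + m) n" "M0 \<in> carrier_mat (\<eta> * m + m) n"
      using row(3,4) by (simp_all add: add.commute)
    have "L \<in> carrier_mat (\<eta> * m + m) (n + \<eta> * m)"
      unfolding row(5) block_kronecker_row_def kronecker_L_pencil
      by (rule append_cols_carrier[OF pencil_carrier[OF M] bidiag_carrier])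
    then have \<Delta>Lc: "\<Delta>L \<in> carrier_mat (\<eta> * m + m) (n + \<eta> * m)" using \<Delta>L(1) by auto
    obtain \<Delta>P where "\<Delta>P \<in> carrier_mat m n" "is_strong_linearization d (L + \<Delta>L) (P + \<Delta>P)"
      and bound: "poly_frobenius_norm \<Delta>P \<le> 2 * real d * (1 + poly_frobenius_norm (pencil M1 M0)) * poly_frobenius_norm \<Delta>L"
      and "\<And>\<alpha>. are_right_minimal_indices (P + \<Delta>P) \<alpha> \<Longrightarrow> are_right_minimal_indices (L + \<Delta>L) \<alpha>"
        "\<And>\<alpha>. are_left_minimal_indices (P + \<Delta>P) \<alpha> \<Longrightarrow> are_left_minimal_indices (L + \<Delta>L) (map (\<lambda>a. a + \<eta>) \<alpha>)"
      using block_kronecker_row_perturbation[OF m M \<Delta>Lc \<Delta>L(2) small[unfolded row(2)]]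
      unfolding row(2) row(5)[symmetric] row(6)[symmetric] by blast
    moreover have "poly_frobenius_norm L \<noteq> 0"
      unfolding row(5) by (rule block_kronecker_row_norm_nonzero[OF M]) (use P(3) row(6) in simp)
    ultimately show ?thesis
      using relative_bound[OF bound _ P0] row(1) by auto
  next
    assume col: "\<eta> = 0" "d = \<epsilon> + 1" "M1 \<in> carrier_mat m ((\<epsilon> + 1) * n)" "M0 \<in> carrier_mat m ((\<epsilon> + 1) * n)"
      "L = block_kronecker_col n \<epsilon> M1 M0" "P = pencil M1 M0 * kronecker (Lambda_col \<epsilon>) (1\<^sub>m n)"
    have M: "M1 \<in> carrier_mat m (\<epsilon> * n + n)" "M0 \<in> carrier_mat m (\<epsilon> * n + n)"
      using col(3,4) by (simp_all add: add.commute)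
    \<comment> \<open>Transposition turns the column form into the row form with \<open>m\<close>
      and \<open>n\<close> exchanged; norms are preserved, and left and right minimal indices trade
      places.\<close>
    let ?M1 = "transpose_mat M1" and ?M0 = "transpose_mat M0"
    have Mt: "?M1 \<in> carrier_mat (\<epsilon> * n + n) m" "?M0 \<in> carrier_mat (\<epsilon> * n + n) m" using M by auto
    have Lt: "transpose_mat L = block_kronecker_row n \<epsilon> ?M1 ?M0"
      unfolding col(5) by (rule transpose_block_kronecker_col[OF M])
    have Ltc: "transpose_mat L \<in> carrier_mat (\<epsilon> * n + n) (m + \<epsilon> * n)"
      unfolding Lt block_kronecker_row_def kronecker_L_pencil
      by (rule append_cols_carrier[OF pencil_carrier[OF Mt] bidiag_carrier])
    then have \<Delta>Lc: "transpose_mat \<Delta>L \<in> carrier_mat (\<epsilon> * n + n) (m + \<epsilon> * n)" using \<Delta>L(1) by auto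
    have \<Delta>Lg: "has_grade 1 (transpose_mat \<Delta>L)" using \<Delta>L(2) by (auto simp: has_grade_def)
    have kc: "kronecker (Lambda_col \<epsilon>) (1\<^sub>m n :: 'a poly mat) \<in> carrier_mat (\<epsilon> * n + n) n"
      by (auto simp: kronecker_def Lambda_col_def)
    have Pt: "transpose_mat P = kronecker (transpose_mat (Lambda_col \<epsilon>)) (1\<^sub>m n) * pencil ?M1 ?M0"
      unfolding col(6) transpose_mult[OF pencil_carrier[OF M] kc] transpose_kronecker transpose_pencil[OF M] by simp
    have Pt0: "transpose_mat P \<noteq> 0\<^sub>m n m"
      using P(3) by (metis transpose_transpose zero_transpose_mat)
    have small': "poly_frobenius_norm (transpose_mat \<Delta>L) < 1 / (2 * real (\<epsilon> + 1) powr (3 / 2))"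
      using small unfolding poly_frobenius_norm_transpose col(2) .
    obtain Q where Q: "Q \<in> carrier_mat n m"
      and strong: "is_strong_linearization d (transpose_mat L + transpose_mat \<Delta>L) (transpose_mat P + Q)"
      and bound: "poly_frobenius_norm Q \<le>
          2 * real d * (1 + poly_frobenius_norm (pencil ?M1 ?M0)) * poly_frobenius_norm (transpose_mat \<Delta>L)"
      and right: "\<And>\<alpha>. are_right_minimal_indices (transpose_mat P + Q) \<alpha> \<Longrightarrow>
          are_right_minimal_indices (transpose_mat L + transpose_mat \<Delta>L) \<alpha>"
      and left: "\<And>\<alpha>. are_left_minimal_indices (transpose_mat P + Q) \<alpha> \<Longrightarrow>
          are_left_minimal_indices (transpose_mat L + transpose_mat \<Delta>L) (map (\<lambda>a. a + \<epsilon>) \<alpha>)"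
      using block_kronecker_row_perturbation[OF n Mt \<Delta>Lc \<Delta>Lg small']
      unfolding col(2) Lt[symmetric] Pt[symmetric] by blast
    define \<Delta>P where "\<Delta>P = transpose_mat Q"
    have \<Delta>P: "\<Delta>P \<in> carrier_mat m n" using Q by (simp add: \<Delta>P_def)
    have PQ: "transpose_mat P + Q = transpose_mat (P + \<Delta>P)"
      using transpose_add[OF P(1) \<Delta>P] by (simp add: \<Delta>P_def)
    have LL: "transpose_mat L + transpose_mat \<Delta>L = transpose_mat (L + \<Delta>L)"
      by (rule transpose_add[symmetric, OF _ \<Delta>L(1)]) simp
    have "is_strong_linearization d (L + \<Delta>L) (P + \<Delta>P)"
      using is_strong_linearization_transpose[OF strong] unfolding PQ LL by simp
    moreover have "poly_frobenius_norm \<Delta>P \<le>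
        2 * real d * (1 + poly_frobenius_norm (pencil M1 M0)) * poly_frobenius_norm \<Delta>L"
      using bound unfolding transpose_pencil[OF M, symmetric] poly_frobenius_norm_transpose \<Delta>P_def .
    moreover have "poly_frobenius_norm L \<noteq> 0"
      using block_kronecker_row_norm_nonzero[OF Mt] Pt0 unfolding Pt[symmetric] Lt[symmetric] poly_frobenius_norm_transpose
      by simp
    \<comment> \<open>The shift by \<open>\<epsilon>\<close>, obtained for the left indices of the
      transposed pencil, becomes the shift of the right indices.\<close>
    moreover have "are_right_minimal_indices (P + \<Delta>P) \<alpha> \<Longrightarrow>
        are_right_minimal_indices (L + \<Delta>L) (map (\<lambda>a. a + \<epsilon>) \<alpha>)" for \<alpha>
      using left unfolding PQ LL are_left_minimal_indices_eq transpose_transpose .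
    moreover have "are_left_minimal_indices (P + \<Delta>P) \<alpha> \<Longrightarrow> are_left_minimal_indices (L + \<Delta>L) \<alpha>" for \<alpha>
      using right unfolding PQ LL are_left_minimal_indices_eq .
    ultimately show ?thesis
      using \<Delta>P relative_bound[OF _ _ P0] col(1) by auto
  qed
qed

end
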